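(* Let $X$ be a proper metric space, let $\mathcal H$ be an $X$-module, and let $B\subseteq\mathcal B(\mathcal H)$ be a C*-subalgebra such that $C_b(X)\,B\,C_b(X)=B$, such that $B$ is closed under block cutdowns, and such that $[C_0(X),B]\subseteq\mathcal K(X,B)$. For $b\in B$, the following are equivalent: (i) $[b,f]=0$ for all $f\in \mathrm{VL}_\infty(X)$; (ii) $b$ is quasi-local, i.e. $b$ has finite $\epsilon$-propagation for every $\epsilon>0$; (iii) $[b,g]\in\mathcal K(X,B)$ for all $g\in C_h(X)$. If, in addition, $X$ has straight finite decomposition complexity, then (i)–(iii) are also equivalent to (iv) $b\in\mathrm{Roe}(X,B)$.
   Context: $C_b(X)$ is the C*-algebra of bounded continuous complex functions on $X$, $C_0(X)$ the ideal of functions vanishing at infinity; $A_1$ denotes the closed unit ball of a C*-algebra $A$; $\mathcal K(\mathcal H)$ denotes the compact operators. Supports of functions are closed supports. **$X$-module.** An $X$-module is a Hilbert space $\mathcal H$ with an injective unital $*$-homomorphism $C_b(X)\to\mathcal B(\mathcal H)$ that is strictly continuous when $C_b(X)$ and $\mathcal B(\mathcal H)$ are viewed as multiplier algebras of $C_0(X)$ and $\mathcal K(\mathcal H)$ respectively. The homomorphism is suppressed and $C_b(X)$ is treated as a C*-subalgebra of $\mathcal B(\mathcal H)$. **Disjointness.** For subsets $Z,Z'$ of $X$, $d(Z,Z')=\inf\{d(z,z'):z\in Z,z'\in Z'\}$. A family of subsets $(Y_j)_{j\in J}$ is $R$-disjoint if $d(Y_j,Y_{j'})>R$ for all $j\ne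 j'$. **Propagation.** For $R\ge 0$, $a\in\mathcal B(\mathcal H)$ has propagation at most $R$ if $faf'=0$ whenever $f,f'\in C_b(X)$ have $R$-disjoint supports. For $R\ge0$, $\epsilon>0$, $a$ has $\epsilon$-propagation at most $R$ if $\|faf'\|<\epsilon$ whenever $f,f'\in C_b(X)_1$ have $R$-disjoint supports. "Finite propagation" (resp. "finite $\epsilon$-propagation") means at most $R$ for some $R\ge0$. **Block cutdowns.** For an equicontinuous family $(e_j)_{j\in J}$ of positive contractions in $C_b(X)$ with pairwise disjoint supports, the block cutdown map $\theta_{(e_j)_{j\in J}}:\mathcal B(\mathcal H)\to\mathcal B(\mathcal H)$ is $\theta_{(e_j)_{j\in J}}(a)=\sum_{j\in J}e_jae_j$ (convergence in the strong operator topology). $B$ is closed under block cutdowns if $\theta_{(e_j)_{j\in J}}(B)\subseteq B$ for every such family. **The algebras.** $\mathrm{Roe}(X,B)$ is the norm closure of $\{b\in B: b\text{ has finite propagation}\}$, and $\mathcal K(X,B)$ is the norm closure of $C_0(X)\,B\,C_0(X)$. **Very Lipschitz sequences.** A bounded sequence $(f_n)_{n=1}^\infty$ in $C_b(X)$ is very Lipschitz if for every $L>0$ there is $n_0$ such that $f_n$ is $L$-Lipschitz for all $n\ge n_0$. $\mathrm{VL}(X)$ is the C*-algebra of all such sequences, and $\mathrm{VL}_\infty(X)=\mathrm{VL}(X)/\{(f_n)\in\mathrm{VL}(X):\lim_n\|f_n\|=0\}$. For a C*-algebra $A$, $A_\infty=\ell^\infty(\mathbb N,A)/\{(a_n):\lim_n\|a_n\|=0\}$.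 Both $\mathrm{VL}_\infty(X)$ and $B$ (as constant sequences) are regarded as C*-subalgebras of $\mathcal B(\mathcal H)_\infty$, where the commutator in (i) is taken. **Higson functions.** $g\in C_b(X)$ is a Higson function if for every $R>0$ and $\epsilon>0$ there is a compact $A\subseteq X$ such that for $x,y\in X\setminus A$ with $d(x,y)<R$ one has $|g(x)-g(y)|<\epsilon$. $C_h(X)$ is the set of all Higson functions on $X$. **Straight finite decomposition complexity.** A metric family is an at most countable set of subsets of $X$; it is uniformly bounded if the diameters of its members have a finite supremum. A set $Z\subseteq X$ $R$-decomposes over a metric family $\mathcal Y$ if $Z=X_0\cup X_1$ where each $X_i$ ($i=0,1$) is the union of an $R$-disjoint family $(X_{ij})_j$ with all $X_{ij}\in\mathcal Y$. A metric family $\mathcal X$ $R$-decomposes over $\mathcal Y$, written $\mathcal X\xrightarrow{R}\mathcal Y$, if every member of $\mathcal X$ does. $X$ has straight finite decomposition complexity if for any sequence $0\le R_1<R_2<\cdots$ there exist $m\in\mathbb N$ and metric families $\{X\}=\mathcal X_0,\mathcal X_1,\dots,\mathcal X_m$ such that $\mathcal X_{i-1}\xrightarrow{R_i}\mathcal X_i$ for $i=1,\dots,m$ and $\mathcal X_m$ is uniformly bounded. *)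

theory Defs
  imports "HOL-Analysis.Analysis"
begin

section \<open>Complex Hilbert spaces and bounded operators\<close>

text \<open>The distribution only has real inner products.  A complex Hilbert space is a real one
  (with inner product the real part of the complex one, hence with the same norm) that carries a
  complex scalar multiplication and a sesquilinear form, linear in the second argument.\<close>

class complex_hilbert_space = real_inner + banach +
  fixes scaleC :: "complex \<Rightarrow> 'a \<Rightarrow> 'a" (infixr \<open>*\<^sub>C\<close> 75)
    and cinner :: "'a \<Rightarrow> 'a \<Rightarrow> complex"
  assumes scaleC_add_right: "c *\<^sub>C (x + y) = c *\<^sub>C x + c *\<^sub>C y"
    and scaleC_add_left: "(c + d) *\<^sub>C x = c *\<^sub>C x + d *\<^sub>C x"
    and scaleC_scaleC: "c *\<^sub>C (d *\<^sub>C x) = (c * d) *\<^sub>C x"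
    and scaleC_of_real: "complex_of_real r *\<^sub>C x = r *\<^sub>R x"
    and cinner_commute: "cinner x y = cnj (cinner y x)"
    and cinner_add_right: "cinner x (y + z) = cinner x y + cinner x z"
    and cinner_scaleC_right: "cinner x (c *\<^sub>C y) = c * cinner x y"
    and inner_eq_Re_cinner: "inner x y = Re (cinner x y)"

lemma cinner_self: "cinner x x = complex_of_real ((norm x)\<^sup>2)"
  for x :: "'a::complex_hilbert_space"
proof (rule complex_eqI)
  show "Re (cinner x x) = Re (complex_of_real ((norm x)\<^sup>2))"
    by (simp add: power2_norm_eq_inner inner_eq_Re_cinner)
  have "Im (cinner x x) = - Im (cinner x x)"
    using arg_cong[OF cinner_commute[of x x], of Im] by simp
  then show "Im (cinner x x) = Im (complex_of_real ((norm x)\<^sup>2))"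
    by simp
qed

lemma norm_scaleC: "norm (c *\<^sub>C x) = cmod c * norm x"
  for x :: "'a::complex_hilbert_space"
proof -
  have "complex_of_real ((norm (c *\<^sub>C x))\<^sup>2) = c * cinner (c *\<^sub>C x) x"
    by (simp only: cinner_self[symmetric] cinner_scaleC_right)
  also have "cinner (c *\<^sub>C x) x = cnj c * cinner x x"
    by (subst cinner_commute, subst cinner_scaleC_right)
      (simp add: cinner_commute[of x x, symmetric])
  also have "c * (cnj c * cinner x x) = complex_of_real ((cmod c)\<^sup>2 * (norm x)\<^sup>2)"
    by (simp only: mult.assoc[symmetric] complex_norm_square[symmetric] cinner_self of_real_mult)
  finally have "(norm (c *\<^sub>C x))\<^sup>2 = (cmod c * norm x)\<^sup>2"
    by (simp only: of_real_eq_iff power_mult_distrib)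
  then show ?thesis
    by (simp add: power2_eq_iff_nonneg)
qed

lemma bounded_linear_scaleC: "bounded_linear ((*\<^sub>C) c :: 'a \<Rightarrow> 'a::complex_hilbert_space)"
proof (rule bounded_linear_intro[where K = "cmod c"])
  fix r and x y :: 'a
  show "c *\<^sub>C (x + y) = c *\<^sub>C x + c *\<^sub>C y"
    by (rule scaleC_add_right)
  show "c *\<^sub>C (r *\<^sub>R x) = r *\<^sub>R (c *\<^sub>C x)"
    by (simp add: scaleC_of_real[symmetric] scaleC_scaleC mult.commute)
  show "norm (c *\<^sub>C x) \<le> norm x * cmod c"
    by (simp add: norm_scaleC)
qed

text \<open>\<^typ>\<open>'h \<Rightarrow>\<^sub>L 'h\<close> consists of the bounded real-linear maps; the operators of interest are the
  complex-linear ones among them.\<close>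

definition bounded_ops :: "('h::complex_hilbert_space \<Rightarrow>\<^sub>L 'h) set" where
  "bounded_ops = {a :: 'h \<Rightarrow>\<^sub>L 'h. \<forall>c x. a (c *\<^sub>C x) = c *\<^sub>C a x}"

lift_definition scaleC_op ::
    "complex \<Rightarrow> ('h::complex_hilbert_space \<Rightarrow>\<^sub>L 'h) \<Rightarrow> ('h \<Rightarrow>\<^sub>L 'h)" is "\<lambda>c a x. c *\<^sub>C a x"
  using bounded_linear_compose[OF bounded_linear_scaleC] by blast

definition is_adjoint :: "('h::complex_hilbert_space \<Rightarrow>\<^sub>L 'h) \<Rightarrow> ('h \<Rightarrow>\<^sub>L 'h) \<Rightarrow> bool" where
  "is_adjoint a a' \<longleftrightarrow> (\<forall>x y. cinner (a x) y = cinner x (a' y))"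

definition cstar_subalgebra :: "('h::complex_hilbert_space \<Rightarrow>\<^sub>L 'h) set \<Rightarrow> bool" where
  "cstar_subalgebra B \<longleftrightarrow>
     B \<subseteq> bounded_ops \<and> 0 \<in> B \<and> closed B \<and>
     (\<forall>a\<in>B. \<forall>b\<in>B. a + b \<in> B) \<and>
     (\<forall>c. \<forall>a\<in>B. scaleC_op c a \<in> B) \<and>
     (\<forall>a\<in>B. \<forall>b\<in>B. a o\<^sub>L b \<in> B) \<and>
     (\<forall>a\<in>B. \<exists>a'\<in>B. is_adjoint a a')"

definition compact_ops :: "('h::complex_hilbert_space \<Rightarrow>\<^sub>L 'h) set" where
  "compact_ops = {a \<in> bounded_ops. compact (closure (blinfun_apply a ` cball 0 1))}"

definition commutator :: "('h::real_normed_vector \<Rightarrow>\<^sub>L 'h) \<Rightarrow> ('h \<Rightarrow>\<^sub>L 'h) \<Rightarrow> ('h \<Rightarrow>\<^sub>L 'h)" where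
  "commutator a b = (a o\<^sub>L b) - (b o\<^sub>L a)"


section \<open>Bounded continuous functions\<close>

context includes bcontfun.lifting begin

lift_definition bc_mult ::
    "('x::topological_space \<Rightarrow>\<^sub>C complex) \<Rightarrow> ('x \<Rightarrow>\<^sub>C complex) \<Rightarrow> ('x \<Rightarrow>\<^sub>C complex)"
  is "\<lambda>f g x. f x * g x"
proof -
  fix f g :: "'x \<Rightarrow> complex"
  assume f: "f \<in> bcontfun" and g: "g \<in> bcontfun"
  obtain K L where "\<forall>x. cmod (f x) \<le> K" "\<forall>x. cmod (g x) \<le> L"
    using f g unfolding bcontfun_def bounded_iff by blast
  then have "\<forall>x. cmod (f x * g x) \<le> K * L"
    by (simp add: norm_mult mult_mono')
  with f g show "(\<lambda>x. f x * g x) \<in> bcontfun"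
    by (auto simp: bcontfun_def bounded_iff intro!: continuous_intros)
qed

lift_definition bc_cnj :: "('x::topological_space \<Rightarrow>\<^sub>C complex) \<Rightarrow> ('x \<Rightarrow>\<^sub>C complex)"
  is "\<lambda>f x. cnj (f x)"
  by (auto simp: bcontfun_def bounded_iff intro!: continuous_intros)

end

definition c0_functions :: "('x::topological_space \<Rightarrow>\<^sub>C complex) set" where
  "c0_functions = {f :: 'x \<Rightarrow>\<^sub>C complex. \<forall>\<epsilon>>0. \<exists>A. compact A \<and> (\<forall>x. x \<notin> A \<longrightarrow> cmod (f x) < \<epsilon>)}"

definition csupp :: "('x::topological_space \<Rightarrow>\<^sub>C complex) \<Rightarrow> 'x set" where
  "csupp f = closure {x. f x \<noteq> 0}"

text \<open>\<^const>\<open>setdist\<close> is \<open>0\<close> if one of the sets is empty, whereas the infimum over the empty set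
  is \<open>\<infinity>\<close> here.\<close>

definition apart :: "real \<Rightarrow> 'x::metric_space set \<Rightarrow> 'x set \<Rightarrow> bool" where
  "apart R Z Z' \<longleftrightarrow> Z = {} \<or> Z' = {} \<or> setdist Z Z' > R"

definition higson_functions :: "('x::metric_space \<Rightarrow>\<^sub>C complex) set" where
  "higson_functions =
     {g :: 'x \<Rightarrow>\<^sub>C complex. \<forall>R>0. \<forall>\<epsilon>>0. \<exists>A. compact A \<and>
           (\<forall>x y. x \<notin> A \<longrightarrow> y \<notin> A \<longrightarrow> dist x y < R \<longrightarrow> cmod (g x - g y) < \<epsilon>)}"

definition very_lipschitz :: "(nat \<Rightarrow> 'x::metric_space \<Rightarrow>\<^sub>C complex) set" where
  "very_lipschitz =
     {f. bounded (range f) \<and>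
         (\<forall>L>0. \<exists>n\<^sub>0. \<forall>n\<ge>n\<^sub>0. L-lipschitz_on UNIV (apply_bcontfun (f n)))}"


section \<open>Modules over a metric space\<close>

text \<open>The strict topology on a multiplier algebra \<open>M\<close> of \<open>A\<close>, generated by the seminorms
  \<open>m \<mapsto> \<parallel>m a\<parallel>\<close> and \<open>m \<mapsto> \<parallel>a m\<parallel>\<close> for \<open>a \<in> A\<close>.\<close>

definition strict_topology ::
    "('m \<Rightarrow> 'm \<Rightarrow> 'm) \<Rightarrow> 'm::real_normed_vector set \<Rightarrow> 'm set \<Rightarrow> 'm topology" where
  "strict_topology mul M A = topology_generated_by
     ({{m \<in> M. norm (mul (m - m\<^sub>0) a) < \<epsilon>} | m\<^sub>0 a \<epsilon>. m\<^sub>0 \<in> M \<and> a \<in> A \<and> \<epsilon> > 0} \<union>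
      {{m \<in> M. norm (mul a (m - m\<^sub>0)) < \<epsilon>} | m\<^sub>0 a \<epsilon>. m\<^sub>0 \<in> M \<and> a \<in> A \<and> \<epsilon> > 0})"

definition X_module ::
    "(('x::metric_space \<Rightarrow>\<^sub>C complex) \<Rightarrow> ('h::complex_hilbert_space \<Rightarrow>\<^sub>L 'h)) \<Rightarrow> bool" where
  "X_module \<phi> \<longleftrightarrow>
     range \<phi> \<subseteq> bounded_ops \<and>
     (\<forall>f g. \<phi> (f + g) = \<phi> f + \<phi> g) \<and>
     (\<forall>c f. \<phi> (bc_mult (const_bcontfun c) f) = scaleC_op c (\<phi> f)) \<and>
     (\<forall>f g. \<phi> (bc_mult f g) = \<phi> f o\<^sub>L \<phi> g) \<and>
     (\<forall>f. is_adjoint (\<phi> f) (\<phi> (bc_cnj f))) \<and>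
     \<phi> (const_bcontfun 1) = id_blinfun \<and>
     inj \<phi> \<and>
     continuous_map (strict_topology bc_mult UNIV c0_functions)
       (strict_topology (o\<^sub>L) bounded_ops compact_ops) \<phi>"

definition propagation_le ::
    "(('x::metric_space \<Rightarrow>\<^sub>C complex) \<Rightarrow> ('h::complex_hilbert_space \<Rightarrow>\<^sub>L 'h)) \<Rightarrow> real \<Rightarrow>
      ('h \<Rightarrow>\<^sub>L 'h) \<Rightarrow> bool" where
  "propagation_le \<phi> R a \<longleftrightarrow>
     (\<forall>f f'. apart R (csupp f) (csupp f') \<longrightarrow> \<phi> f o\<^sub>L a o\<^sub>L \<phi> f' = 0)"

definition eps_propagation_le ::
    "(('x::metric_space \<Rightarrow>\<^sub>C complex) \<Rightarrow> ('h::complex_hilbert_space \<Rightarrow>\<^sub>L 'h)) \<Rightarrow> real \<Rightarrow> real \<Rightarrow>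
      ('h \<Rightarrow>\<^sub>L 'h) \<Rightarrow> bool" where
  "eps_propagation_le \<phi> \<epsilon> R a \<longleftrightarrow>
     (\<forall>f f'. norm f \<le> 1 \<longrightarrow> norm f' \<le> 1 \<longrightarrow> apart R (csupp f) (csupp f') \<longrightarrow>
        norm (\<phi> f o\<^sub>L a o\<^sub>L \<phi> f') < \<epsilon>)"

definition quasi_local ::
    "(('x::metric_space \<Rightarrow>\<^sub>C complex) \<Rightarrow> ('h::complex_hilbert_space \<Rightarrow>\<^sub>L 'h)) \<Rightarrow>
      ('h \<Rightarrow>\<^sub>L 'h) \<Rightarrow> bool" where
  "quasi_local \<phi> a \<longleftrightarrow> (\<forall>\<epsilon>>0. \<exists>R\<ge>0. eps_propagation_le \<phi> \<epsilon> R a)"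

definition block_family :: "'j set \<Rightarrow> ('j \<Rightarrow> 'x::metric_space \<Rightarrow>\<^sub>C complex) \<Rightarrow> bool" where
  "block_family J e \<longleftrightarrow>
     (\<forall>x. \<forall>\<epsilon>>0. \<exists>\<delta>>0. \<forall>j\<in>J. \<forall>y. dist y x < \<delta> \<longrightarrow> cmod (e j y - e j x) < \<epsilon>) \<and>
     (\<forall>j\<in>J. (\<forall>x. e j x \<in> \<real> \<and> 0 \<le> Re (e j x)) \<and> norm (e j) \<le> 1) \<and>
     (\<forall>i\<in>J. \<forall>j\<in>J. i \<noteq> j \<longrightarrow> csupp (e i) \<inter> csupp (e j) = {})"

definition block_cutdown ::
    "(('x::metric_space \<Rightarrow>\<^sub>C complex) \<Rightarrow> ('h::complex_hilbert_space \<Rightarrow>\<^sub>L 'h)) \<Rightarrow>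
      'j set \<Rightarrow> ('j \<Rightarrow> 'x \<Rightarrow>\<^sub>C complex) \<Rightarrow> ('h \<Rightarrow>\<^sub>L 'h) \<Rightarrow> ('h \<Rightarrow>\<^sub>L 'h)" where
  "block_cutdown \<phi> J e a = Blinfun (\<lambda>x. \<Sum>\<^sub>\<infinity>j\<in>J. (\<phi> (e j) o\<^sub>L a o\<^sub>L \<phi> (e j)) x)"

text \<open>Nonzero functions with pairwise disjoint supports are distinct, so up to vanishing members
  (which contribute nothing) every block family can be indexed by a set of functions; the index
  type below is therefore no restriction.\<close>

definition closed_under_block_cutdowns ::
    "(('x::metric_space \<Rightarrow>\<^sub>C complex) \<Rightarrow> ('h::complex_hilbert_space \<Rightarrow>\<^sub>L 'h)) \<Rightarrow>
      ('h \<Rightarrow>\<^sub>L 'h) set \<Rightarrow> bool" where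
  "closed_under_block_cutdowns \<phi> B \<longleftrightarrow>
     (\<forall>(J :: ('x \<Rightarrow>\<^sub>C complex) set) e. block_family J e \<longrightarrow> block_cutdown \<phi> J e ` B \<subseteq> B)"

definition roe ::
    "(('x::metric_space \<Rightarrow>\<^sub>C complex) \<Rightarrow> ('h::complex_hilbert_space \<Rightarrow>\<^sub>L 'h)) \<Rightarrow>
      ('h \<Rightarrow>\<^sub>L 'h) set \<Rightarrow> ('h \<Rightarrow>\<^sub>L 'h) set" where
  "roe \<phi> B = closure {b \<in> B. \<exists>R\<ge>0. propagation_le \<phi> R b}"

definition compact_ideal ::
    "(('x::metric_space \<Rightarrow>\<^sub>C complex) \<Rightarrow> ('h::complex_hilbert_space \<Rightarrow>\<^sub>L 'h)) \<Rightarrow>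
      ('h \<Rightarrow>\<^sub>L 'h) set \<Rightarrow> ('h \<Rightarrow>\<^sub>L 'h) set" where
  "compact_ideal \<phi> B =
     closure {\<phi> f o\<^sub>L b o\<^sub>L \<phi> g | f b g. f \<in> c0_functions \<and> b \<in> B \<and> g \<in> c0_functions}"


section \<open>The sequence algebra of the bounded operators\<close>

definition asymp_eq :: "(nat \<Rightarrow> 'h::complex_hilbert_space \<Rightarrow>\<^sub>L 'h) \<Rightarrow> (nat \<Rightarrow> 'h \<Rightarrow>\<^sub>L 'h) \<Rightarrow> bool" where
  "asymp_eq a a' \<longleftrightarrow>
     range a \<subseteq> bounded_ops \<and> bounded (range a) \<and>
     range a' \<subseteq> bounded_ops \<and> bounded (range a') \<and>
     (\<lambda>n. norm (a n - a' n)) \<longlonglongrightarrow> 0"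

lemma zero_bounded_ops: "0 \<in> bounded_ops"
proof -
  have "c *\<^sub>C (0::'a) = 0" for c
    using bounded_linear.linear[OF bounded_linear_scaleC] by (rule linear_0)
  then show ?thesis
    by (simp add: bounded_ops_def)
qed

lemma diff_bounded_ops: "a \<in> bounded_ops \<Longrightarrow> b \<in> bounded_ops \<Longrightarrow> a - b \<in> bounded_ops"
  by (simp add: bounded_ops_def blinfun.diff_left
      linear_diff[OF bounded_linear.linear[OF bounded_linear_scaleC]])

lemma compose_bounded_ops: "a \<in> bounded_ops \<Longrightarrow> b \<in> bounded_ops \<Longrightarrow> a o\<^sub>L b \<in> bounded_ops"
  by (simp add: bounded_ops_def)

quotient_type (overloaded) 'h ops_infty =
  "nat \<Rightarrow> ('h::complex_hilbert_space \<Rightarrow>\<^sub>L 'h)" / partial: asymp_eq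
proof (rule part_equivpI)
  show "\<exists>a :: nat \<Rightarrow> 'h \<Rightarrow>\<^sub>L 'h. asymp_eq a a"
    by (rule exI[of _ "\<lambda>_. 0"]) (auto simp: asymp_eq_def zero_bounded_ops)
  show "symp (asymp_eq :: (nat \<Rightarrow> 'h \<Rightarrow>\<^sub>L 'h) \<Rightarrow> _)"
    by (rule sympI) (auto simp: asymp_eq_def norm_minus_commute)
  show "transp (asymp_eq :: (nat \<Rightarrow> 'h \<Rightarrow>\<^sub>L 'h) \<Rightarrow> _)"
  proof (rule transpI)
    fix a b c :: "nat \<Rightarrow> 'h \<Rightarrow>\<^sub>L 'h"
    assume ab: "asymp_eq a b" and bc: "asymp_eq b c"
    then have "(\<lambda>n. (a n - b n) + (b n - c n)) \<longlonglongrightarrow> 0 + 0"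
      by (intro tendsto_add) (simp_all add: asymp_eq_def tendsto_norm_zero_iff)
    with ab bc show "asymp_eq a c"
      by (simp add: asymp_eq_def tendsto_norm_zero_iff)
  qed
qed

instantiation ops_infty :: (complex_hilbert_space) "{zero, minus, times}"
begin

lift_definition zero_ops_infty :: "'a ops_infty" is "\<lambda>_. 0"
  by (auto simp: asymp_eq_def zero_bounded_ops)

lift_definition minus_ops_infty :: "'a ops_infty \<Rightarrow> 'a ops_infty \<Rightarrow> 'a ops_infty"
  is "\<lambda>a b n. a n - b n"
proof -
  fix a a' b b' :: "nat \<Rightarrow> 'a \<Rightarrow>\<^sub>L 'a"
  assume a: "asymp_eq a a'" and b: "asymp_eq b b'"
  then have "(\<lambda>n. (a n - a' n) - (b n - b' n)) \<longlonglongrightarrow> 0 - 0"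
    by (intro tendsto_diff) (simp_all add: asymp_eq_def tendsto_norm_zero_iff)
  with a b show "asymp_eq (\<lambda>n. a n - b n) (\<lambda>n. a' n - b' n)"
    by (auto simp: asymp_eq_def tendsto_norm_zero_iff algebra_simps
        intro!: bounded_minus_comp diff_bounded_ops)
qed

lift_definition times_ops_infty :: "'a ops_infty \<Rightarrow> 'a ops_infty \<Rightarrow> 'a ops_infty"
  is "\<lambda>a b n. a n o\<^sub>L b n"
proof -
  have bdd: "bounded (range (\<lambda>n. a n o\<^sub>L b n))"
    if ab: "bounded (range a)" "bounded (range b)" for a b :: "nat \<Rightarrow> 'a \<Rightarrow>\<^sub>L 'a"
  proof -
    obtain K L where K: "\<forall>n. norm (a n) \<le> K" and L: "\<forall>n. norm (b n) \<le> L"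
      using ab unfolding bounded_iff by blast
    have "norm (a n o\<^sub>L b n) \<le> K * L" for n
      using norm_blinfun_compose[of "a n" "b n"] mult_mono'[OF K[rule_format, of n] L[rule_format, of n]]
      by simp
    then show ?thesis
      by (auto simp: bounded_iff)
  qed
  fix a a' b b' :: "nat \<Rightarrow> 'a \<Rightarrow>\<^sub>L 'a"
  assume a: "asymp_eq a a'" and b: "asymp_eq b b'"
  have a0: "(\<lambda>n. a n - a' n) \<longlonglongrightarrow> 0" and b0: "(\<lambda>n. b n - b' n) \<longlonglongrightarrow> 0"
    using a b by (simp_all add: asymp_eq_def tendsto_norm_zero_iff)
  have 1: "(\<lambda>n. (a n - a' n) o\<^sub>L b n) \<longlonglongrightarrow> 0"
    unfolding tendsto_Zfun_iff diff_zero
  proof (rule bounded_bilinear.Zfun_prod_Bfun[OF bounded_bilinear_blinfun_compose])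
    show "Zfun (\<lambda>n. a n - a' n) sequentially"
      using a0 by (simp add: tendsto_Zfun_iff)
    show "Bfun b sequentially"
      using b by (auto simp: asymp_eq_def Bseq_eq_bounded)
  qed
  have 2: "(\<lambda>n. a' n o\<^sub>L (b n - b' n)) \<longlonglongrightarrow> 0"
    unfolding tendsto_Zfun_iff diff_zero
  proof (rule bounded_bilinear.Bfun_prod_Zfun[OF bounded_bilinear_blinfun_compose])
    show "Zfun (\<lambda>n. b n - b' n) sequentially"
      using b0 by (simp add: tendsto_Zfun_iff)
    show "Bfun a' sequentially"
      using a by (auto simp: asymp_eq_def Bseq_eq_bounded)
  qed
  have "(\<lambda>n. (a n o\<^sub>L b n) - (a' n o\<^sub>L b' n)) \<longlonglongrightarrow> 0"
    using tendsto_add[OF 1 2]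
    by (simp add: bounded_bilinear.diff_left[OF bounded_bilinear_blinfun_compose]
        bounded_bilinear.diff_right[OF bounded_bilinear_blinfun_compose])
  with a b show "asymp_eq (\<lambda>n. a n o\<^sub>L b n) (\<lambda>n. a' n o\<^sub>L b' n)"
    by (auto simp: asymp_eq_def tendsto_norm_zero_iff intro!: bdd compose_bounded_ops)
qed

instance ..

end

text \<open>The image of \<open>VL\<^sub>\<infinity>(X)\<close> under the embedding induced by \<open>\<phi>\<close>.\<close>

definition vl_infty ::
    "(('x::metric_space \<Rightarrow>\<^sub>C complex) \<Rightarrow> ('h::complex_hilbert_space \<Rightarrow>\<^sub>L 'h)) \<Rightarrow> 'h ops_infty set" where
  "vl_infty \<phi> = {abs_ops_infty (\<lambda>n. \<phi> (f n)) | f. f \<in> very_lipschitz}"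

definition const_infty :: "('h::complex_hilbert_space \<Rightarrow>\<^sub>L 'h) \<Rightarrow> 'h ops_infty" where
  "const_infty b = abs_ops_infty (\<lambda>_. b)"


section \<open>Straight finite decomposition complexity\<close>

text \<open>Distinct indices with the same nonempty set are never \<open>R\<close>-disjoint for \<open>R \<ge> 0\<close>, so an
  \<open>R\<close>-disjoint family of members of \<open>\<Y>\<close> is given by a subset of \<open>\<Y>\<close>.\<close>

definition decomposes :: "real \<Rightarrow> 'x::metric_space set \<Rightarrow> 'x set set \<Rightarrow> bool" where
  "decomposes R Z \<Y> \<longleftrightarrow>
     (\<exists>\<U>\<^sub>0 \<U>\<^sub>1. \<U>\<^sub>0 \<subseteq> \<Y> \<and> \<U>\<^sub>1 \<subseteq> \<Y> \<and> pairwise (apart R) \<U>\<^sub>0 \<and> pairwise (apart R) \<U>\<^sub>1 \<and>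
        Z = \<Union>\<U>\<^sub>0 \<union> \<Union>\<U>\<^sub>1)"

definition uniformly_bounded :: "'x::metric_space set set \<Rightarrow> bool" where
  "uniformly_bounded \<Y> \<longleftrightarrow> (\<exists>D. \<forall>Z\<in>\<Y>. bounded Z \<and> diameter Z \<le> D)"

definition straight_fdc :: "'x::metric_space itself \<Rightarrow> bool" where
  "straight_fdc _ \<longleftrightarrow>
     (\<forall>R :: nat \<Rightarrow> real. 0 \<le> R 1 \<and> (\<forall>i\<ge>1. R i < R (Suc i)) \<longrightarrow>
        (\<exists>m (\<X> :: nat \<Rightarrow> 'x set set).
           \<X> 0 = {UNIV} \<and> (\<forall>i\<le>m. countable (\<X> i)) \<and>
           (\<forall>i\<in>{1..m}. \<forall>Z\<in>\<X> (i - 1). decomposes (R i) Z (\<X> i)) \<and>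
           uniformly_bounded (\<X> m)))"

end

theory Submission
  imports Defs
begin

text \<open>A quasi-local \<open>b\<close> almost commutes with every function of small variation at large scale: cut the
  function into level bands; far apart bands contribute little to the commutator by quasi-locality,
  while the near-diagonal terms split into boundedly many orthogonal families, each small because
  the function hardly changes across neighbouring bands.  Conversely, a pair of separated functions
  witnessing failure of quasi-locality is separated by one Lipschitz bump \<open>g\<close>, so that
  \<open>f b f' = f [g, b] f'\<close>; if such pairs are moved to infinity along disjoint annuli, which is possible
  because \<open>C\<^sub>0(X)\<close> commutes with \<open>b\<close> modulo \<open>\<K>(X,B)\<close>, the bumps add up to a Higson function.

  For straight finite decomposition complexity, a decomposition at scale \<open>R\<close> allows one to replace a
  block cutdown of \<open>b\<close> by the sum of two block cutdowns along the pieces.  The off-diagonal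
  terms are controlled by averaging \<open>u b u\<close> over sign functions \<open>u\<close> which are constant on the pieces.
  The number of cutdowns doubles at each stage, so the error allowed at stage \<open>i\<close> is of order \<open>3\<^sup>-\<^sup>i\<close>;
  this dictates the scales at which straight finite decomposition complexity is applied.\<close>

section \<open>Operators and bounded continuous functions\<close>

text \<open>The obstacle in the decomposition argument is uniformity: blocks and pieces may be
  infinite in number, while quasi-locality controls a commutator only through the sup norm and the
  variation of the function. A bump around the union of any selection of separated pieces has the
  same Lipschitz bound as a bump around one piece, so one \<delta> serves all sign functions at
  once. Inside a block, errors are recorded as form bounds C ||e x|| ||e y||: by orthogonality such
  errors over disjoint blocks sum to an operator of norm at most C, however many blocks there are.
  Finite subfamilies are exhausted by strong limits, and this is where strict continuity of the
  representation and compactness of closed balls enter. The scales must be known before the number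
  of stages is. This is possible because the width \<open>t i\<close> of the transition zones
  depends only on the error allowed at stage i; supports spread by 2 t i at that stage, and R i has
  to dominate the spread accumulated so far. Elements of \<K>(X,B) are recognised by their decay:
  multiplied on either side by a function living far out, they become small in norm.\<close>

lemma bc_mult_apply [simp]: "apply_bcontfun (bc_mult f g) x = f x * g x"
  by (simp add: bc_mult.rep_eq)

lemma bc_cnj_apply [simp]: "apply_bcontfun (bc_cnj f) x = cnj (f x)"
  by (simp add: bc_cnj.rep_eq)

lemma bc_mult_commute: "bc_mult f g = bc_mult g f"
  by (rule bcontfun_eqI) (simp add: mult.commute)

lemma bc_mult_zero [simp]: "bc_mult f 0 = 0" "bc_mult 0 f = 0"
  by (rule bcontfun_eqI, simp)+

lemma sum_bcontfun_apply [simp]: "apply_bcontfun (sum f A) x = (\<Sum>i\<in>A. f i x)"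
  by (induction A rule: infinite_finite_induct) auto

definition bc_of_real :: "('x::topological_space \<Rightarrow> real) \<Rightarrow> 'x \<Rightarrow>\<^sub>C complex" where
  "bc_of_real h = Bcontfun (\<lambda>x. complex_of_real (h x))"

lemma bc_of_real_apply:
  assumes "continuous_on UNIV h" "\<And>x. \<bar>h x\<bar> \<le> C"
  shows "apply_bcontfun (bc_of_real h) x = complex_of_real (h x)"
proof -
  have "(\<lambda>x. complex_of_real (h x)) \<in> bcontfun"
    using assms by (intro bcontfun_normI[where b = C]) (auto intro!: continuous_intros)
  then show ?thesis
    by (simp add: bc_of_real_def Bcontfun_inverse)
qed

section \<open>Cauchy-Schwarz and rank one operators over the complex scalars\<close>

lemma cinner_zero_right [simp]: "cinner x 0 = 0"
  for x :: "'a::complex_hilbert_space"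
  using cinner_add_right[of x 0 0] by simp

lemma continuous_on_scaleC_left: "continuous_on S (\<lambda>c. c *\<^sub>C x)"
  for x :: "'a::complex_hilbert_space"
proof -
  have "bounded_linear (\<lambda>c. c *\<^sub>C x)"
    by (rule bounded_linear_intro[where K = "norm x"])
      (auto simp: scaleC_add_left norm_scaleC scaleC_of_real[symmetric] scaleC_scaleC
        scaleR_conv_of_real)
  then show ?thesis
    by (rule linear_continuous_on)
qed

text \<open>A phase \<open>u\<close> rotates the value onto the nonnegative real axis, where it is a
  real inner product and the real Cauchy-Schwarz inequality applies.\<close>

lemma norm_cinner_le: "cmod (cinner x y) \<le> norm x * norm y"
  for x :: "'a::complex_hilbert_space"
proof -
  obtain u where u: "cmod u = 1" "u * cinner x y = complex_of_real (cmod (cinner x y))"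
  proof (cases "cinner x y = 0")
    case True
    then show ?thesis using that[of 1] by simp
  next
    case False
    let ?u = "cnj (cinner x y) / cmod (cinner x y)"
    have "?u * cinner x y = complex_of_real (cmod (cinner x y))"
      using False by (simp add: mult.commute[of "cnj _"] complex_norm_square[symmetric] power2_eq_square)
    then show ?thesis
      using that[of ?u] False by (simp add: norm_divide)
  qed
  have "cmod (cinner x y) = inner x (u *\<^sub>C y)"
    by (simp add: inner_eq_Re_cinner cinner_scaleC_right u(2))
  also have "\<dots> \<le> norm x * norm (u *\<^sub>C y)"
    by (rule norm_cauchy_schwarz)
  finally show ?thesis
    by (simp add: norm_scaleC u(1))
qed

text \<open>Supplies the compact operator against which strict convergence is tested. The image of
  the unit ball lies in the image of a closed disc of scalars under multiplication of
  \<open>x\<close>, hence in a compact set.\<close>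

lemma rank_one_compact_op:
  fixes x :: "'h::complex_hilbert_space"
  obtains a where "a \<in> compact_ops" "\<And>y. blinfun_apply a y = cinner x y *\<^sub>C x"
proof -
  have lin: "bounded_linear (\<lambda>y. cinner x y *\<^sub>C x)"
  proof (rule bounded_linear_intro[where K = "norm x * norm x"])
    fix r y
    have "cinner x (r *\<^sub>R y) = complex_of_real r * cinner x y"
      by (metis cinner_scaleC_right scaleC_of_real)
    then show "cinner x (r *\<^sub>R y) *\<^sub>C x = r *\<^sub>R (cinner x y *\<^sub>C x)"
      by (simp add: scaleC_of_real[symmetric] scaleC_scaleC)
    show "norm (cinner x y *\<^sub>C x) \<le> norm y * (norm x * norm x)"
      using mult_right_mono[OF norm_cinner_le[of x y], of "norm x"]
      by (simp add: norm_scaleC mult_ac)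
  qed (simp add: cinner_add_right scaleC_add_left)
  define a where "a = Blinfun (\<lambda>y. cinner x y *\<^sub>C x)"
  have a: "blinfun_apply a y = cinner x y *\<^sub>C x" for y
    by (simp add: a_def bounded_linear_Blinfun_apply[OF lin])
  have cpt: "compact ((\<lambda>c. c *\<^sub>C x) ` cball 0 (norm x))"
    by (intro compact_continuous_image continuous_on_scaleC_left compact_cball)
  have "blinfun_apply a ` cball 0 1 \<subseteq> (\<lambda>c. c *\<^sub>C x) ` cball 0 (norm x)"
  proof safe
    fix y :: 'h assume "y \<in> cball 0 1"
    then have "cmod (cinner x y) \<le> norm x"
      using norm_cinner_le[of x y] mult_left_le[of "norm y" "norm x"] by simp
    then show "a y \<in> (\<lambda>c. c *\<^sub>C x) ` cball 0 (norm x)"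
      by (auto simp: a)
  qed
  then have "closure (blinfun_apply a ` cball 0 1) \<subseteq> (\<lambda>c. c *\<^sub>C x) ` cball 0 (norm x)"
    by (intro closure_minimal compact_imp_closed cpt)
  then have "compact (closure (blinfun_apply a ` cball 0 1))"
    using cpt compact_closure bounded_subset compact_imp_bounded closed_closure
      compact_Int_closed[of "(\<lambda>c. c *\<^sub>C x) ` cball 0 (norm x)" "closure (blinfun_apply a ` cball 0 1)"]
    by (metis inf.absorb_iff2)
  then have "a \<in> compact_ops"
    by (auto simp: compact_ops_def bounded_ops_def a cinner_scaleC_right scaleC_scaleC)
  then show thesis
    using that a by blast
qed

text \<open>A subbasis suffices to test a limit, since eventual membership passes to finite
  intersections and to unions. The strict topologies are given by such subbases.\<close>

lemma limitin_topology_generated_by: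
  assumes "l \<in> \<Union>S" "\<And>U. U \<in> S \<Longrightarrow> l \<in> U \<Longrightarrow> eventually (\<lambda>i. f i \<in> U) F"
  shows "limitin (topology_generated_by S) f l F"
  unfolding limitin_def
proof (intro conjI allI impI)
  show "l \<in> topspace (topology_generated_by S)"
    using assms(1) by simp
  fix U assume U: "openin (topology_generated_by S) U \<and> l \<in> U"
  then have "generate_topology_on S U"
    by (simp add: openin_topology_generated_by)
  then have "l \<in> U \<longrightarrow> eventually (\<lambda>i. f i \<in> U) F"
  proof induction
    case (UN K)
    show ?case
    proof
      assume "l \<in> \<Union>K"
      then obtain k where "k \<in> K" "l \<in> k" by blast
      then have "eventually (\<lambda>i. f i \<in> k) F" using UN by blast
      then show "eventually (\<lambda>i. f i \<in> \<Union>K) F"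
        by eventually_elim (use \<open>k \<in> K\<close> in blast)
    qed
  qed (auto simp: eventually_conj_iff assms(2))
  then show "eventually (\<lambda>i. f i \<in> U) F" using U by blast
qed

lemma norm_sq_sum_orthogonal:
  assumes "finite A" "\<And>i j. i \<in> A \<Longrightarrow> j \<in> A \<Longrightarrow> i \<noteq> j \<Longrightarrow> inner (f i) (f j) = 0"
  shows "(norm (sum f A))\<^sup>2 = (\<Sum>i\<in>A. (norm (f i))\<^sup>2)"
  using assms by (intro norm_sum_Pythagorean) (auto simp: pairwise_def orthogonal_def)

section \<open>The representation\<close>

text \<open>The sort \<open>heine_borel\<close> expresses properness: closed balls are compact. So
  every cutoff supported in a ball belongs to C_0(X).\<close>

locale x_module =
  fixes \<phi> :: "('x::heine_borel \<Rightarrow>\<^sub>C complex) \<Rightarrow> ('h::complex_hilbert_space \<Rightarrow>\<^sub>L 'h)"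
  assumes X_module: "X_module \<phi>"
begin

lemma in_bounded_ops: "\<phi> f \<in> bounded_ops"
  and phi_add: "\<phi> (f + g) = \<phi> f + \<phi> g"
  and phi_scale: "\<phi> (bc_mult (const_bcontfun c) f) = scaleC_op c (\<phi> f)"
  and phi_mult: "\<phi> (bc_mult f g) = \<phi> f o\<^sub>L \<phi> g"
  and phi_adj: "is_adjoint (\<phi> f) (\<phi> (bc_cnj f))"
  and phi_one: "\<phi> (const_bcontfun 1) = id_blinfun"
  and phi_strict: "continuous_map (strict_topology bc_mult UNIV c0_functions)
       (strict_topology (o\<^sub>L) bounded_ops compact_ops) \<phi>"
  using X_module unfolding X_module_def by auto

lemma phi_zero [simp]: "\<phi> 0 = 0"
  using phi_add[of 0 0] by simp

lemma phi_diff: "\<phi> (f - g) = \<phi> f - \<phi> g"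
  using phi_add[of "f - g" g] by (simp add: algebra_simps)

lemma phi_minus: "\<phi> (- f) = - \<phi> f"
  using phi_diff[of 0 f] by simp

lemma phi_sum: "\<phi> (sum f A) = (\<Sum>i\<in>A. \<phi> (f i))"
  by (induction A rule: infinite_finite_induct) (auto simp: phi_add)

lemma phi_scaleR: "\<phi> (r *\<^sub>R f) = r *\<^sub>R \<phi> f"
proof -
  have "r *\<^sub>R f = bc_mult (const_bcontfun (complex_of_real r)) f"
    by (rule bcontfun_eqI) (simp add: scaleR_conv_of_real)
  moreover have "scaleC_op (complex_of_real r) (\<phi> f) = r *\<^sub>R \<phi> f"
    by (rule blinfun_eqI) (simp add: scaleC_op.rep_eq scaleC_of_real blinfun.scaleR_left)
  ultimately show ?thesis
    by (simp add: phi_scale)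
qed

lemma phi_mult_apply: "\<phi> f (\<phi> g x) = \<phi> (bc_mult f g) x"
  by (simp add: phi_mult)

lemma phi_commute: "\<phi> f o\<^sub>L \<phi> g = \<phi> g o\<^sub>L \<phi> f"
  by (metis phi_mult bc_mult_commute)

lemma cinner_phi: "cinner (\<phi> f x) y = cinner x (\<phi> (bc_cnj f) y)"
  using phi_adj by (simp add: is_adjoint_def)

lemma inner_phi: "inner (\<phi> f x) (\<phi> g y) = Re (cinner x (\<phi> (bc_mult (bc_cnj f) g) y))"
  by (simp add: inner_eq_Re_cinner cinner_phi phi_mult)

lemma inner_phi_real:
  assumes "\<And>x. apply_bcontfun f x \<in> \<real>"
  shows "inner (\<phi> f x) y = inner x (\<phi> f y)"
proof -
  have "bc_cnj f = f"
    using assms by (intro bcontfun_eqI) (simp add: Reals_cnj_iff)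
  then show ?thesis
    by (simp add: inner_eq_Re_cinner cinner_phi)
qed

text \<open>Contractivity without spectral theory: for h the square root of ||f||^2 - |f|^2, the
  identity |f|^2 + h^2 = ||f||^2 is carried by the homomorphism to ||f x||^2 + ||h x||^2 = ||f||^2
  ||x||^2.\<close>

lemma norm_phi: "norm (\<phi> f) \<le> norm f"
proof (rule norm_blinfun_bound)
  fix x :: 'h
  define h where "h = bc_of_real (\<lambda>x. sqrt ((norm f)\<^sup>2 - (cmod (f x))\<^sup>2))"
  have h: "h y = complex_of_real (sqrt ((norm f)\<^sup>2 - (cmod (f y))\<^sup>2))" for y
    unfolding h_def
  proof (rule bc_of_real_apply[where C = "norm f"])
    show "\<bar>sqrt ((norm f)\<^sup>2 - (cmod (f x))\<^sup>2)\<bar> \<le> norm f" for x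
      using norm_bounded[of f x] by (simp add: real_sqrt_le_iff' power_mono real_le_lsqrt)
  qed (auto intro!: continuous_intros)
  have "bc_mult (bc_cnj f) f + bc_mult (bc_cnj h) h = bc_mult (const_bcontfun (complex_of_real ((norm f)\<^sup>2))) (const_bcontfun 1)"
  proof (rule bcontfun_eqI)
    fix y
    have "(cmod (f y))\<^sup>2 \<le> (norm f)\<^sup>2"
      using norm_bounded[of f y] by (simp add: power_mono)
    then show "(bc_mult (bc_cnj f) f + bc_mult (bc_cnj h) h) y = bc_mult (const_bcontfun (complex_of_real ((norm f)\<^sup>2))) (const_bcontfun 1) y"
      by (simp add: h mult.commute[of "cnj _"] complex_norm_square[symmetric] of_real_mult[symmetric] del: of_real_mult)
  qed
  then have "\<phi> (bc_mult (bc_cnj f) f) + \<phi> (bc_mult (bc_cnj h) h) = scaleC_op (complex_of_real ((norm f)\<^sup>2)) id_blinfun"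
    by (metis phi_add phi_scale phi_one)
  then have *: "\<phi> (bc_mult (bc_cnj f) f) x + \<phi> (bc_mult (bc_cnj h) h) x = (norm f)\<^sup>2 *\<^sub>R x"
    by (metis blinfun.add_left scaleC_op.rep_eq blinfun_apply_id_blinfun id_apply scaleC_of_real)
  have "(norm (\<phi> f x))\<^sup>2 + (norm (\<phi> h x))\<^sup>2 = inner x ((norm f)\<^sup>2 *\<^sub>R x)"
    unfolding power2_norm_eq_inner inner_phi
    by (simp only: *[symmetric] inner_eq_Re_cinner cinner_add_right plus_complex.sel)
  then have "(norm (\<phi> f x))\<^sup>2 \<le> (norm f * norm x)\<^sup>2"
    unfolding inner_scaleR_right power2_norm_eq_inner[symmetric] power_mult_distrib
    using zero_le_power2[of "norm (\<phi> h x)"] by linarith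
  then show "norm (\<phi> f x) \<le> norm f * norm x"
    by (rule power2_le_imp_le) simp
qed simp

lemma norm_phi_le: "norm f \<le> c \<Longrightarrow> norm (\<phi> f) \<le> c"
  using norm_phi[of f] by linarith

lemma norm_phi_apply_le: "norm f \<le> 1 \<Longrightarrow> norm (\<phi> f x) \<le> norm x"
  using norm_blinfun[of "\<phi> f" x] norm_phi_le[of f 1] mult_right_mono[of "norm (\<phi> f)" 1 "norm x"] by simp

text \<open>Only strong convergence of nets is extracted from strict continuity; it is tested on a rank
  one operator.\<close>

lemma phi_strong_limit:
  fixes f :: "'i \<Rightarrow> 'x \<Rightarrow>\<^sub>C complex" and g :: "'x \<Rightarrow>\<^sub>C complex"
  assumes C: "\<And>i x. cmod (f i x) \<le> C"
    and ev: "\<And>A. compact A \<Longrightarrow> eventually (\<lambda>i. \<forall>x\<in>A. apply_bcontfun (f i) x = g x) F"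
  shows "((\<lambda>i. \<phi> (f i) x) \<longlongrightarrow> \<phi> g x) F"
proof (cases "x = 0")
  case False
  have C': "norm (f i) \<le> \<bar>C\<bar>" for i
    using C[of i] by (intro norm_bound) (meson abs_ge_self order_trans)
  have "limitin (strict_topology bc_mult UNIV c0_functions) f g F"
    unfolding strict_topology_def
  proof (rule limitin_topology_generated_by)
    have "(0 :: 'x \<Rightarrow>\<^sub>C complex) \<in> c0_functions"
      by (auto simp: c0_functions_def intro: compact_empty)
    then show "g \<in> \<Union> ({{m \<in> UNIV. norm (bc_mult (m - m\<^sub>0) a) < \<epsilon>} |m\<^sub>0 a \<epsilon>. m\<^sub>0 \<in> UNIV \<and> a \<in> c0_functions \<and> 0 < \<epsilon>} \<union>
           {{m \<in> UNIV. norm (bc_mult a (m - m\<^sub>0)) < \<epsilon>} |m\<^sub>0 a \<epsilon>. m\<^sub>0 \<in> UNIV \<and> a \<in> c0_functions \<and> 0 < \<epsilon>})"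
      by (intro UnionI[of "{m \<in> UNIV. norm (bc_mult (m - g) 0) < 1}"] UnI1 CollectI exI[of _ g] exI[of _ 0] exI[of _ "1::real"])
        simp_all
    fix U assume "U \<in> {{m \<in> UNIV. norm (bc_mult (m - m\<^sub>0) a) < \<epsilon>} |m\<^sub>0 a \<epsilon>. m\<^sub>0 \<in> UNIV \<and> a \<in> c0_functions \<and> 0 < \<epsilon>} \<union>
           {{m \<in> UNIV. norm (bc_mult a (m - m\<^sub>0)) < \<epsilon>} |m\<^sub>0 a \<epsilon>. m\<^sub>0 \<in> UNIV \<and> a \<in> c0_functions \<and> 0 < \<epsilon>}"
      and gU: "g \<in> U"
    then obtain m0 a e where U: "U = {m. norm (bc_mult (m - m0) a) < e}" and a: "a \<in> c0_functions" "e > 0"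
      by (auto simp: bc_mult_commute)
    define e' where "e' = e - norm (bc_mult (g - m0) a)"
    have "e' > 0" using gU by (simp add: U e'_def)
    \<comment> \<open>\<open>D\<close> bounds |f i - g| uniformly. On the compact set
      \<open>A\<close> below the two functions eventually agree; off \<open>A\<close> the factor
      \<open>a\<close> is small compared with 1 / D.\<close>
    define D where "D = \<bar>C\<bar> + norm g + 1"
    have "D > 0" by (simp add: D_def add_nonneg_pos)
    then have "e' / (2 * D) > 0" using \<open>e' > 0\<close> by simp
    then obtain A where A: "compact A" "\<And>x. x \<notin> A \<Longrightarrow> cmod (a x) < e' / (2 * D)"
      using a(1) unfolding c0_functions_def by blast
    show "eventually (\<lambda>i. f i \<in> U) F"
      using ev[OF A(1)]
    proof eventually_elim
      case (elim i)
      have "norm (bc_mult (f i - g) a) \<le> e' / 2"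
      proof (rule norm_bound)
        fix x
        show "norm (bc_mult (f i - g) a x) \<le> e' / 2"
        proof (cases "x \<in> A")
          case False
          have "cmod (f i x - g x) \<le> D"
            using norm_triangle_ineq4[of "f i x" "g x"] norm_bounded[of "f i" x] C'[of i] norm_bounded[of g x]
            unfolding D_def by linarith
          then have "cmod (f i x - g x) * cmod (a x) \<le> D * (e' / (2 * D))"
            using A(2)[OF False] \<open>D > 0\<close> by (intro mult_mono) auto
          then show ?thesis
            using \<open>D > 0\<close> by (simp add: norm_mult)
        qed (use elim \<open>e' > 0\<close> in auto)
      qed
      moreover have "bc_mult (f i - m0) a = bc_mult (f i - g) a + bc_mult (g - m0) a"
        by (rule bcontfun_eqI) (simp add: algebra_simps)
      ultimately have "norm (bc_mult (f i - m0) a) \<le> e' / 2 + norm (bc_mult (g - m0) a)"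
        by (metis add_right_mono norm_triangle_ineq order_trans)
      also have "\<dots> < e" using \<open>e' > 0\<close> by (simp add: e'_def field_simps)
      finally show ?case by (simp add: U)
    qed
  qed
  then have lim: "limitin (strict_topology (o\<^sub>L) bounded_ops compact_ops) (\<phi> \<circ> f) (\<phi> g) F"
    by (rule continuous_map_limit[OF phi_strict])
  obtain a where a: "a \<in> compact_ops" "\<And>y. blinfun_apply a y = cinner x y *\<^sub>C x"
    using rank_one_compact_op[of x] by metis
  show ?thesis
    unfolding tendsto_iff
  proof (intro allI impI)
    fix e :: real assume "e > 0"
    define e' where "e' = e * norm x"
    have "e' > 0" using False \<open>e > 0\<close> by (simp add: e'_def)
    have "openin (strict_topology (o\<^sub>L) bounded_ops compact_ops) {m \<in> bounded_ops. norm ((m - \<phi> g) o\<^sub>L a) < e'}"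
      unfolding strict_topology_def
      by (intro topology_generated_by_Basis) (use in_bounded_ops a(1) \<open>e' > 0\<close> in blast)
    then have "eventually (\<lambda>i. (\<phi> \<circ> f) i \<in> {m \<in> bounded_ops. norm ((m - \<phi> g) o\<^sub>L a) < e'}) F"
      by (rule limitinD[OF lim]) (use in_bounded_ops \<open>e' > 0\<close> in simp)
    then show "eventually (\<lambda>i. dist (\<phi> (f i) x) (\<phi> g x) < e) F"
    proof eventually_elim
      case (elim i)
      \<comment> \<open>On \<open>x\<close> itself the rank one operator is multiplication by
        ||x||^2, so the strict seminorm given by \<open>a\<close> dominates the distance of the
        values at \<open>x\<close>; the factor ||x|| in \<open>e'\<close> makes the constants
        cancel.\<close>
      have ax: "a x = (norm x)\<^sup>2 *\<^sub>R x"
        by (simp add: a(2) cinner_self scaleC_of_real del: of_real_power)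
      have "(norm x)\<^sup>2 * norm (\<phi> (f i) x - \<phi> g x) = norm (((\<phi> (f i) - \<phi> g) o\<^sub>L a) x)"
        by (simp add: ax blinfun.diff_left blinfun.scaleR_right scaleR_diff_right[symmetric])
      also have "\<dots> \<le> norm ((\<phi> (f i) - \<phi> g) o\<^sub>L a) * norm x"
        by (rule norm_blinfun)
      also have "\<dots> < e' * norm x"
        using elim False by simp
      also have "\<dots> = (norm x)\<^sup>2 * e" by (simp add: e'_def power2_eq_square)
      finally show ?case using False by (simp add: dist_norm)
    qed
  qed
qed simp

end

section \<open>Commutators of quasi-local operators\<close>

lemma bc_of_real_unit:
  assumes "continuous_on UNIV h" "\<And>x. 0 \<le> h x \<and> h x \<le> 1"
  shows "apply_bcontfun (bc_of_real h) x = complex_of_real (h x)"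
proof (rule bc_of_real_apply[where C = 1])
  show "\<bar>h x\<bar> \<le> 1" for x
    using assms(2)[of x] by simp
qed (fact assms)

text \<open>Almost orthogonality in dual form: pair the sum s with itself and apply Cauchy-Schwarz
  over the index set. Asking for a bound on the pairing with every y, rather than for orthogonal
  vectors, lets error terms be treated like genuine blocks.\<close>

lemma norm_sum_sq_le_of_form_bound:
  fixes v :: "'i \<Rightarrow> 'a::real_inner"
  assumes form: "\<And>i y. i \<in> A \<Longrightarrow> inner (v i) y \<le> c i * N i y"
    and N: "\<And>y. (\<Sum>i\<in>A. (N i y)\<^sup>2) \<le> (norm y)\<^sup>2"
  shows "(norm (sum v A))\<^sup>2 \<le> (\<Sum>i\<in>A. (c i)\<^sup>2)"
proof -
  define s where "s = sum v A"
  have "(norm s)\<^sup>2 = (\<Sum>i\<in>A. inner (v i) s)"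
    by (simp add: power2_norm_eq_inner inner_sum_left[symmetric] s_def)
  also have "\<dots> \<le> (\<Sum>i\<in>A. \<bar>c i\<bar> * \<bar>N i s\<bar>)"
    by (intro sum_mono) (metis abs_ge_self abs_mult form order_trans)
  also have "\<dots> \<le> L2_set c A * L2_set (\<lambda>i. N i s) A"
    by (rule L2_set_mult_ineq)
  also have "L2_set (\<lambda>i. N i s) A \<le> norm s"
    using N[of s] by (simp add: L2_set_def real_le_lsqrt)
  finally have "(norm s)\<^sup>2 \<le> L2_set c A * norm s"
    by (simp add: mult_left_mono)
  then have "norm s \<le> L2_set c A"
    by (cases "norm s = 0") (auto simp: power2_eq_square)
  then have "(norm s)\<^sup>2 \<le> (L2_set c A)\<^sup>2"
    by (intro power_mono) auto
  then show ?thesis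
    by (simp add: s_def L2_set_def sum_nonneg)
qed

lemma norm_commutator_le: "norm (commutator b a) \<le> 2 * norm b * norm a"
  using norm_triangle_ineq4[of "b o\<^sub>L a" "a o\<^sub>L b"] norm_blinfun_compose[of b a] norm_blinfun_compose[of a b]
  unfolding commutator_def by (simp add: mult.commute)

lemma commutator_add_right: "commutator b (a + a') = commutator b a + commutator b a'"
  by (rule blinfun_eqI) (simp add: commutator_def blinfun.add_left blinfun.add_right blinfun.diff_left)

lemma commutator_scaleR_right: "commutator b (r *\<^sub>R a) = r *\<^sub>R commutator b a"
  by (rule blinfun_eqI)
    (simp add: commutator_def blinfun.scaleR_left blinfun.scaleR_right blinfun.diff_left scaleR_diff_right)

lemma commutator_scaleC_right:
  assumes "b \<in> bounded_ops"
  shows "commutator b (scaleC_op c a) = scaleC_op c (commutator b a)"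
  using assms
  by (intro blinfun_eqI) (simp add: commutator_def bounded_ops_def scaleC_op.rep_eq blinfun.diff_left
      linear_diff[OF bounded_linear.linear[OF bounded_linear_scaleC]])

lemma norm_scaleC_op_le: "norm (scaleC_op c a) \<le> cmod c * norm a"
proof (rule norm_blinfun_bound)
  show "norm (scaleC_op c a x) \<le> cmod c * norm a * norm x" for x
    using mult_left_mono[OF norm_blinfun[of a x], of "cmod c"]
    by (simp add: scaleC_op.rep_eq norm_scaleC mult.assoc)
qed simp

text \<open>The tent function of height 1 on [k - 1, k + 1], written as a difference of two
  consecutive clamped ramps so that sums over k telescope.\<close>

definition level_bump :: "nat \<Rightarrow> real \<Rightarrow> real" where
  "level_bump k y = max 0 (min 1 (y - k + 1)) - max 0 (min 1 (y - k))"

lemma level_bump_bounds: "0 \<le> level_bump k y" "level_bump k y \<le> 1"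
  by (auto simp: level_bump_def)

lemma level_bump_nonzero: "level_bump k y \<noteq> 0 \<Longrightarrow> \<bar>y - k\<bar> < 1"
  by (auto simp: level_bump_def split: if_splits simp: max_def min_def)

lemma sum_level_bump:
  assumes "0 \<le> y" "y \<le> real N"
  shows "(\<Sum>k\<le>N. level_bump k y) = 1"
proof -
  define F where "F = (\<lambda>k. max 0 (min 1 (y - real k + 1)))"
  have "level_bump k y = F k - F (Suc k)" for k
    by (simp add: level_bump_def F_def)
  then have "(\<Sum>k\<le>N. level_bump k y) = F 0 - F (Suc N)"
    by (simp add: sum_telescope)
  then show ?thesis
    using assms by (simp add: F_def)
qed

context x_module
begin

lemma phi_disjoint:
  assumes "\<And>x. apply_bcontfun f x = 0 \<or> apply_bcontfun g x = 0"
  shows "\<phi> f o\<^sub>L \<phi> g = 0"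
proof -
  have "bc_mult f g = 0"
    using assms by (intro bcontfun_eqI) auto
  then show ?thesis
    by (metis phi_mult phi_zero)
qed

lemma inner_phi_disjoint:
  assumes "\<And>x. apply_bcontfun f x = 0 \<or> apply_bcontfun g x = 0"
  shows "inner (\<phi> f x) (\<phi> g y) = 0"
proof -
  have "bc_mult (bc_cnj f) g = 0"
    using assms by (intro bcontfun_eqI) auto
  then show ?thesis
    by (simp add: inner_phi)
qed

lemma norm_sum_disjoint_le:
  fixes e :: "'i \<Rightarrow> 'x \<Rightarrow>\<^sub>C complex"
  assumes disj: "\<And>i j x. i \<in> A \<Longrightarrow> j \<in> A \<Longrightarrow> i \<noteq> j \<Longrightarrow> e i x = 0 \<or> e j x = 0"
    and le: "\<And>i. i \<in> A \<Longrightarrow> norm (e i) \<le> 1"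
  shows "norm (sum e A) \<le> 1"
proof (rule norm_bound)
  fix x
  show "cmod (sum e A x) \<le> 1"
  proof (cases "\<exists>i\<in>A. e i x \<noteq> 0")
    case True
    then obtain i where i: "i \<in> A" "e i x \<noteq> 0" by blast
    show ?thesis
    proof (cases "finite A")
      case True
      have "(\<Sum>j\<in>A. e j x) = (\<Sum>j\<in>{i}. e j x)"
        using disj[OF i(1)] i True by (intro sum.mono_neutral_right) auto
      then show ?thesis
        using norm_bounded[of "e i" x] le[OF i(1)] by simp
    qed simp
  qed simp
qed

lemma sum_norm_phi_sq_le:
  fixes e :: "'i \<Rightarrow> 'x \<Rightarrow>\<^sub>C complex"
  assumes disj: "\<And>i j x. i \<in> A \<Longrightarrow> j \<in> A \<Longrightarrow> i \<noteq> j \<Longrightarrow> e i x = 0 \<or> e j x = 0"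
    and le: "\<And>i. i \<in> A \<Longrightarrow> norm (e i) \<le> 1"
  shows "(\<Sum>i\<in>A. (norm (\<phi> (e i) x))\<^sup>2) \<le> (norm x)\<^sup>2"
proof (cases "finite A")
  case True
  have "(\<Sum>i\<in>A. (norm (\<phi> (e i) x))\<^sup>2) = (norm (\<Sum>i\<in>A. \<phi> (e i) x))\<^sup>2"
    using True disj by (intro norm_sq_sum_orthogonal[symmetric] inner_phi_disjoint) auto
  also have "(\<Sum>i\<in>A. \<phi> (e i) x) = \<phi> (sum e A) x"
    by (simp add: phi_sum blinfun.sum_left)
  also have "(norm (\<phi> (sum e A) x))\<^sup>2 \<le> (norm x)\<^sup>2"
    by (intro power_mono norm_phi_apply_le norm_sum_disjoint_le) (use assms in auto)
  finally show ?thesis .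
qed simp

text \<open>The inputs are orthogonal through the g i and the outputs through the f i, so the sum
  costs no more than one block. Two families are allowed because the blocks needed are off-diagonal
  ones.\<close>

lemma norm_sum_blocks_le:
  fixes f g :: "'i \<Rightarrow> 'x \<Rightarrow>\<^sub>C complex"
  assumes f_disj: "\<And>i j x. i \<in> A \<Longrightarrow> j \<in> A \<Longrightarrow> i \<noteq> j \<Longrightarrow> f i x = 0 \<or> f j x = 0"
    and g_disj: "\<And>i j x. i \<in> A \<Longrightarrow> j \<in> A \<Longrightarrow> i \<noteq> j \<Longrightarrow> g i x = 0 \<or> g j x = 0"
    and f_le: "\<And>i. i \<in> A \<Longrightarrow> norm (f i) \<le> 1"
    and g_le: "\<And>i. i \<in> A \<Longrightarrow> norm (g i) \<le> 1"
    and real: "\<And>i x. i \<in> A \<Longrightarrow> apply_bcontfun (f i) x \<in> \<real>"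
  shows "norm (\<Sum>i\<in>A. \<phi> (f i) o\<^sub>L b o\<^sub>L \<phi> (g i)) \<le> norm b"
proof (rule norm_blinfun_bound)
  fix x
  have "(norm (\<Sum>i\<in>A. \<phi> (f i) (b (\<phi> (g i) x))))\<^sup>2 \<le> (\<Sum>i\<in>A. (norm b * norm (\<phi> (g i) x))\<^sup>2)"
  proof (rule norm_sum_sq_le_of_form_bound)
    show "(\<Sum>i\<in>A. (norm (\<phi> (f i) y))\<^sup>2) \<le> (norm y)\<^sup>2" for y
      by (rule sum_norm_phi_sq_le) (use f_disj f_le in auto)
    fix i y assume "i \<in> A"
    have "inner (\<phi> (f i) (b (\<phi> (g i) x))) y = inner (b (\<phi> (g i) x)) (\<phi> (f i) y)"
      by (rule inner_phi_real[OF real[OF \<open>i \<in> A\<close>]])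
    also have "\<dots> \<le> norm (b (\<phi> (g i) x)) * norm (\<phi> (f i) y)"
      by (rule norm_cauchy_schwarz)
    also have "\<dots> \<le> norm b * norm (\<phi> (g i) x) * norm (\<phi> (f i) y)"
      by (intro mult_right_mono norm_blinfun) simp
    finally show "inner (\<phi> (f i) (b (\<phi> (g i) x))) y \<le> norm b * norm (\<phi> (g i) x) * norm (\<phi> (f i) y)" .
  qed
  also have "\<dots> = (norm b)\<^sup>2 * (\<Sum>i\<in>A. (norm (\<phi> (g i) x))\<^sup>2)"
    by (simp add: power_mult_distrib sum_distrib_left)
  also have "\<dots> \<le> (norm b)\<^sup>2 * (norm x)\<^sup>2"
    by (intro mult_left_mono sum_norm_phi_sq_le) (use g_disj g_le in auto)
  finally have "(norm (\<Sum>i\<in>A. \<phi> (f i) (b (\<phi> (g i) x))))\<^sup>2 \<le> (norm b * norm x)\<^sup>2"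
    by (simp add: power_mult_distrib)
  then have "norm (\<Sum>i\<in>A. \<phi> (f i) (b (\<phi> (g i) x))) \<le> norm b * norm x"
    by (rule power2_le_imp_le) simp
  then show "norm ((\<Sum>i\<in>A. \<phi> (f i) o\<^sub>L b o\<^sub>L \<phi> (g i)) x) \<le> norm b * norm x"
    by (simp add: blinfun.sum_left)
qed simp

text \<open>Cutting \<open>h\<close> into \<open>N + 1\<close> level bands with partition of unity \<open>p 0, \<dots>, p N\<close> gives
  \<open>[b, h] \<approx> \<Sum>\<^sub>k\<^sub>l (l - k)/N \<cdot> p\<^sub>k b p\<^sub>l\<close>.  Bands with \<open>\<bar>k - l\<bar> \<ge> 3\<close> are far apart, so quasi-locality applies;
  the remaining terms split into ten orthogonal families, each of norm at most \<open>2\<parallel>b\<parallel>/N\<close>.\<close>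

lemma norm_commutator_levels_le:
  assumes N: "N > 0"
    and eps: "eps_propagation_le \<phi> \<epsilon> R b"
    and cont: "continuous_on UNIV h" and h01: "\<And>x. 0 \<le> h x \<and> h x \<le> 1"
    and var: "\<And>x y. dist x y \<le> R + 1 \<Longrightarrow> \<bar>h x - h y\<bar> < 1 / N"
  shows "norm (commutator b (\<phi> (bc_of_real h))) \<le> 22 * norm b / N + (real N + 1)\<^sup>2 * \<epsilon>"
proof -
  define f where "f = bc_of_real h"
  have f: "f x = complex_of_real (h x)" for x
    unfolding f_def using cont h01 by (rule bc_of_real_unit)
  define p where "p = (\<lambda>k::nat. bc_of_real (\<lambda>x. level_bump k (real N * h x)))"
  have p: "p k x = complex_of_real (level_bump k (real N * h x))" for k x
    unfolding p_def
  proof (rule bc_of_real_unit)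
    show "continuous_on UNIV (\<lambda>x. level_bump k (real N * h x))"
      unfolding level_bump_def using cont by (intro continuous_intros)
    show "0 \<le> level_bump k (real N * h x) \<and> level_bump k (real N * h x) \<le> 1" for x
      using level_bump_bounds by simp
  qed
  have p_le: "norm (p k) \<le> 1" for k
    by (intro norm_bound) (use level_bump_bounds in \<open>auto simp: p\<close>)
  have p_disj: "p k x = 0 \<or> p l x = 0" if "k + 2 \<le> l \<or> l + 2 \<le> k" for k l x
  proof (rule ccontr)
    assume "\<not> (p k x = 0 \<or> p l x = 0)"
    then have "\<bar>real N * h x - k\<bar> < 1" "\<bar>real N * h x - l\<bar> < 1"
      by (auto simp: p intro: level_bump_nonzero)
    with that show False by linarith
  qed
  have p_sum: "(\<Sum>k\<le>N. \<phi> (p k)) = id_blinfun"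
  proof -
    have "(\<Sum>k\<le>N. p k) = const_bcontfun 1"
      using h01 N by (intro bcontfun_eqI)
        (simp add: p of_real_sum[symmetric] sum_level_bump mult_left_le del: of_real_sum)
    then show ?thesis
      by (metis phi_sum phi_one)
  qed
  define f' where "f' = (\<Sum>k\<le>N. (real k / N) *\<^sub>R p k)"
  have "norm (f - f') \<le> 1 / N"
  proof (rule norm_bound)
    fix x
    have s1: "(\<Sum>k\<le>N. level_bump k (real N * h x)) = 1"
      using h01 N by (intro sum_level_bump) (auto simp: mult_left_le)
    have "(f - f') x = complex_of_real (h x - (\<Sum>k\<le>N. (real k / N) * level_bump k (real N * h x)))"
      by (simp add: f'_def f p scaleR_conv_of_real)
    also have "h x - (\<Sum>k\<le>N. (real k / N) * level_bump k (real N * h x)) =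
        (\<Sum>k\<le>N. (h x - real k / N) * level_bump k (real N * h x))"
      by (simp add: left_diff_distrib sum_subtractf sum_distrib_left[symmetric] s1)
    finally have "norm ((f - f') x) \<le> (\<Sum>k\<le>N. \<bar>(h x - real k / N) * level_bump k (real N * h x)\<bar>)"
      by (simp add: sum_abs del: of_real_sum)
    also have "\<dots> \<le> (\<Sum>k\<le>N. (1 / N) * level_bump k (real N * h x))"
    proof (rule sum_mono)
      fix k
      show "\<bar>(h x - real k / N) * level_bump k (real N * h x)\<bar> \<le> (1 / N) * level_bump k (real N * h x)"
      proof (cases "level_bump k (real N * h x) = 0")
        case False
        then have "\<bar>real N * h x - k\<bar> < 1"
          by (rule level_bump_nonzero)
        then have "\<bar>h x - real k / N\<bar> \<le> 1 / N"
          using N by (simp add: abs_less_iff abs_le_iff field_simps)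
        then show ?thesis
          using mult_right_mono[OF _ level_bump_bounds(1)[of k "real N * h x"]] level_bump_bounds(1)[of k "real N * h x"]
          by (simp only: abs_mult abs_of_nonneg)
      qed simp
    qed
    also have "\<dots> = 1 / N"
      by (simp add: sum_distrib_left[symmetric] sum_divide_distrib[symmetric] s1)
    finally show "norm ((f - f') x) \<le> 1 / real N" .
  qed
  then have "norm (commutator b (\<phi> (f - f'))) \<le> 2 * norm b * (1 / N)"
    by (intro order_trans[OF norm_commutator_le] mult_left_mono norm_phi_le) auto
  then have first: "norm (commutator b (\<phi> (f - f'))) \<le> 2 * norm b / N"
    by simp
  define Q where "Q = (\<lambda>(k, l). \<phi> (p k) o\<^sub>L b o\<^sub>L \<phi> (p l))"
  define a where "a = (\<lambda>(k, l). (real l - real k) / N)"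
  define S where "S = {..N} \<times> {..N}"
  \<comment> \<open>The partition of unity is inserted on the left in b f' and on the right in f' b;
    comparing the two double sums leaves the coefficients (l - k) / N.\<close>
  have "commutator b (\<phi> f') = (\<Sum>i\<in>S. a i *\<^sub>R Q i)"
  proof (rule blinfun_eqI)
    fix x
    have id: "(\<Sum>k\<le>N. \<phi> (p k) y) = y" for y
      using arg_cong[OF p_sum, of "\<lambda>T. blinfun_apply T y"] by (simp add: blinfun.sum_left)
    have f'y: "\<phi> f' y = (\<Sum>k\<le>N. (real k / N) *\<^sub>R \<phi> (p k) y)" for y
      by (simp add: f'_def phi_sum phi_scaleR blinfun.sum_left blinfun.scaleR_left)
    have "b (\<phi> f' x) = (\<Sum>k\<le>N. \<phi> (p k) (b (\<phi> f' x)))"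
      by (simp add: id)
    also have "\<dots> = (\<Sum>k\<le>N. \<Sum>l\<le>N. (real l / N) *\<^sub>R \<phi> (p k) (b (\<phi> (p l) x)))"
      by (simp add: f'y blinfun.sum_right blinfun.scaleR_right)
    finally have 1: "b (\<phi> f' x) = (\<Sum>k\<le>N. \<Sum>l\<le>N. (real l / N) *\<^sub>R \<phi> (p k) (b (\<phi> (p l) x)))" .
    have "\<phi> f' (b x) = (\<Sum>k\<le>N. (real k / N) *\<^sub>R \<phi> (p k) (b (\<Sum>l\<le>N. \<phi> (p l) x)))"
      by (simp add: f'y id)
    also have "\<dots> = (\<Sum>k\<le>N. \<Sum>l\<le>N. (real k / N) *\<^sub>R \<phi> (p k) (b (\<phi> (p l) x)))"
      by (simp add: blinfun.sum_right scaleR_sum_right)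
    finally have 2: "\<phi> f' (b x) = (\<Sum>k\<le>N. \<Sum>l\<le>N. (real k / N) *\<^sub>R \<phi> (p k) (b (\<phi> (p l) x)))" .
    have "commutator b (\<phi> f') x = (\<Sum>k\<le>N. \<Sum>l\<le>N. ((real l - real k) / N) *\<^sub>R \<phi> (p k) (b (\<phi> (p l) x)))"
      by (simp add: commutator_def blinfun.diff_left 1 2 sum_subtractf[symmetric] scaleR_diff_left[symmetric] diff_divide_distrib)
    also have "\<dots> = (\<Sum>i\<in>S. a i *\<^sub>R Q i) x"
      by (simp add: S_def sum.cartesian_product a_def Q_def blinfun.sum_left blinfun.scaleR_left case_prod_beta)
    finally show "commutator b (\<phi> f') x = (\<Sum>i\<in>S. a i *\<^sub>R Q i) x" .
  qed
  \<comment> \<open>The closed supports lie in the bands |N h - k| \<le> 1. An index gap of 3 leaves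
    a gap of 1 in N h, that is 1 / N in h, which by hypothesis forces a distance above R + 1. The
    surplus 1 is there because the infimum of the distances has to exceed R strictly.\<close>
  define near where "near = {(k, l) \<in> S. \<not> (k + 3 \<le> l \<or> l + 3 \<le> k)}"
  have fin: "finite S" "finite near"
    by (auto simp: S_def near_def intro: finite_subset[of _ "{..N} \<times> {..N}"])
  have "norm (\<Sum>i\<in>S - near. a i *\<^sub>R Q i) \<le> (\<Sum>i\<in>S - near. \<epsilon>)"
  proof (rule sum_norm_le)
    fix i assume "i \<in> S - near"
    then obtain k l where i: "i = (k, l)" "k \<le> N" "l \<le> N" "k + 3 \<le> l \<or> l + 3 \<le> k"
      by (auto simp: S_def near_def)
    have sub: "csupp (p k) \<subseteq> {x. \<bar>real N * h x - k\<bar> \<le> 1}" for k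
      unfolding csupp_def
    proof (rule closure_minimal)
      show "{x. p k x \<noteq> 0} \<subseteq> {x. \<bar>real N * h x - k\<bar> \<le> 1}"
        using level_bump_nonzero by (force simp: p)
      show "closed {x. \<bar>real N * h x - k\<bar> \<le> 1}"
        using cont by (intro closed_Collect_le continuous_intros)
    qed
    have "apart R (csupp (p k)) (csupp (p l))"
    proof (cases "csupp (p k) = {} \<or> csupp (p l) = {}")
      case False
      have "R + 1 \<le> setdist (csupp (p k)) (csupp (p l))"
      proof (rule le_setdistI)
        fix x y assume "x \<in> csupp (p k)" "y \<in> csupp (p l)"
        then have "\<bar>real N * h x - k\<bar> \<le> 1" "\<bar>real N * h y - l\<bar> \<le> 1"
          using sub by blast+
        then have "1 \<le> \<bar>real N * h x - real N * h y\<bar>"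
          using i(4) by linarith
        also have "\<dots> = N * \<bar>h x - h y\<bar>"
          by (simp add: abs_mult right_diff_distrib[symmetric])
        finally have "\<not> \<bar>h x - h y\<bar> < 1 / N"
          using N by (simp add: field_simps)
        then show "R + 1 \<le> dist x y"
          using var[of x y] by linarith
      qed (use False in auto)
      then show ?thesis
        by (simp add: apart_def)
    qed (auto simp: apart_def)
    then have "norm (Q i) < \<epsilon>"
      using eps p_le unfolding eps_propagation_le_def by (simp add: Q_def i(1))
    moreover have "\<bar>a i\<bar> \<le> 1"
      using i N by (simp add: a_def)
    ultimately show "norm (a i *\<^sub>R Q i) \<le> \<epsilon>"
      using mult_mono[of "\<bar>a i\<bar>" 1 "norm (Q i)" \<epsilon>] by simp
  qed
  also have "\<dots> \<le> (real N + 1)\<^sup>2 * \<epsilon>"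
  proof -
    \<comment> \<open>The pair of zero functions is admissible and shows that \<epsilon> is
      positive, so the number of far terms may be overestimated.\<close>
    have "norm (\<phi> 0 o\<^sub>L b o\<^sub>L \<phi> 0) < \<epsilon>"
      using eps by (auto simp: eps_propagation_le_def csupp_def apart_def simp del: phi_zero)
    then have "\<epsilon> > 0" by simp
    have "card (S - near) \<le> card S"
      by (intro card_mono fin) auto
    also have "\<dots> = (N + 1)\<^sup>2"
      by (simp add: S_def power2_eq_square)
    finally have "real (card (S - near)) \<le> (real N + 1)\<^sup>2"
      by (metis of_nat_1 of_nat_add of_nat_mono of_nat_power)
    then show ?thesis
      using \<open>\<epsilon> > 0\<close> by simp
  qed
  finally have far_le: "norm (\<Sum>i\<in>S - near. a i *\<^sub>R Q i) \<le> (real N + 1)\<^sup>2 * \<epsilon>" .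
  \<comment> \<open>Classes by diagonal l - k (five values) and parity of k. Adjacent tents overlap,
    but two different indices in one class differ by at least 2 in both coordinates, so their tents
    are disjoint. The count 5 * 2 gives 20 ||b|| / N; replacing h by its step approximation adds
    another 2 ||b|| / N.\<close>
  define g where "g = (\<lambda>(k, l). (int l - int k, k mod 2))"
  define T where "T = {-2..2::int} \<times> {0, 1::nat}"
  have "(\<Sum>i\<in>near. a i *\<^sub>R Q i) = (\<Sum>t\<in>T. \<Sum>i\<in>{i \<in> near. g i = t}. a i *\<^sub>R Q i)"
    by (rule sum.group[symmetric, OF fin(2)]) (auto simp: T_def near_def g_def)
  also have "norm \<dots> \<le> (\<Sum>t\<in>T. 2 * norm b / N)"
  proof (rule sum_norm_le)
    fix t assume "t \<in> T"
    then obtain d r where t: "t = (d, r)" "\<bar>d\<bar> \<le> 2" by (auto simp: T_def)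
    let ?C = "{i \<in> near. g i = t}"
    have "(\<Sum>i\<in>?C. a i *\<^sub>R Q i) = (\<Sum>i\<in>?C. (real_of_int d / N) *\<^sub>R Q i)"
      by (rule sum.cong) (auto simp: t g_def a_def)
    also have "\<dots> = (real_of_int d / N) *\<^sub>R (\<Sum>i\<in>?C. \<phi> (p (fst i)) o\<^sub>L b o\<^sub>L \<phi> (p (snd i)))"
      by (simp add: scaleR_sum_right Q_def case_prod_beta)
    finally have *: "norm (\<Sum>i\<in>?C. a i *\<^sub>R Q i) = \<bar>real_of_int d\<bar> / N * norm (\<Sum>i\<in>?C. \<phi> (p (fst i)) o\<^sub>L b o\<^sub>L \<phi> (p (snd i)))"
      by simp
    have diff: "(fst i + 2 \<le> fst j \<or> fst j + 2 \<le> fst i) \<and> (snd i + 2 \<le> snd j \<or> snd j + 2 \<le> snd i)"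
      if "i \<in> ?C" "j \<in> ?C" "i \<noteq> j" for i j
    proof -
      obtain k l k' l' where ij: "i = (k, l)" "j = (k', l')" by fastforce
      have e: "int l - int k = int l' - int k'" "k mod 2 = k' mod 2"
        using that by (auto simp: ij g_def t)
      then have "k \<noteq> k'" using that(3) by (auto simp: ij)
      then consider "k < k'" | "k' < k" by linarith
      then have "k + 2 \<le> k' \<or> k' + 2 \<le> k"
        using e(2) by cases presburger+
      then show ?thesis using e(1) unfolding ij fst_conv snd_conv by linarith
    qed
    have "norm (\<Sum>i\<in>?C. \<phi> (p (fst i)) o\<^sub>L b o\<^sub>L \<phi> (p (snd i))) \<le> norm b"
    proof (rule norm_sum_blocks_le)
      fix i j x assume "i \<in> ?C" "j \<in> ?C" "i \<noteq> j"
      note d = diff[OF this]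
      show "p (fst i) x = 0 \<or> p (fst j) x = 0"
        by (rule p_disj) (rule conjunct1[OF d])
      show "p (snd i) x = 0 \<or> p (snd j) x = 0"
        by (rule p_disj) (rule conjunct2[OF d])
    qed (rule p_le, rule p_le, simp add: p)
    then have "\<bar>real_of_int d\<bar> / N * norm (\<Sum>i\<in>?C. \<phi> (p (fst i)) o\<^sub>L b o\<^sub>L \<phi> (p (snd i))) \<le> 2 / N * norm b"
      using t(2) by (intro mult_mono divide_right_mono) auto
    then show "norm (\<Sum>i\<in>?C. a i *\<^sub>R Q i) \<le> 2 * norm b / N"
      using * by simp
  qed
  also have "\<dots> = 20 * norm b / N"
    by (simp add: T_def)
  finally have near_le: "norm (\<Sum>i\<in>near. a i *\<^sub>R Q i) \<le> 20 * norm b / N" .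
  have "(\<Sum>i\<in>S. a i *\<^sub>R Q i) = (\<Sum>i\<in>S - near. a i *\<^sub>R Q i) + (\<Sum>i\<in>near. a i *\<^sub>R Q i)"
    by (rule sum.subset_diff[OF _ fin(1)]) (auto simp: near_def)
  then have "norm (commutator b (\<phi> f')) \<le> 20 * norm b / N + (real N + 1)\<^sup>2 * \<epsilon>"
    using \<open>commutator b (\<phi> f') = _\<close> far_le near_le norm_triangle_ineq[of "\<Sum>i\<in>S - near. a i *\<^sub>R Q i" "\<Sum>i\<in>near. a i *\<^sub>R Q i"]
    by simp
  moreover have "commutator b (\<phi> f) = commutator b (\<phi> (f - f')) + commutator b (\<phi> f')"
    by (simp add: commutator_add_right[symmetric] phi_add[symmetric])
  ultimately have "norm (commutator b (\<phi> f)) \<le> 2 * norm b / N + (20 * norm b / N + (real N + 1)\<^sup>2 * \<epsilon>)"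
    using first norm_triangle_ineq[of "commutator b (\<phi> (f - f'))" "commutator b (\<phi> f')"] by simp
  also have "\<dots> = 22 * norm b / N + (real N + 1)\<^sup>2 * \<epsilon>"
    by (simp add: add_divide_distrib[symmetric])
  finally show ?thesis
    by (simp add: f_def)
qed

text \<open>The order of choices matters: N depends on ||b|| and \<delta> alone, then \<epsilon> is
  taken small against (N + 1)^2, and quasi-locality for this \<epsilon> provides R.\<close>

lemma quasi_local_commutator_unit:
  assumes ql: "quasi_local \<phi> b" and "\<delta> > 0"
  obtains R \<eta> where "R > 0" "\<eta> > 0"
    "\<And>h. continuous_on UNIV h \<Longrightarrow> (\<And>x. 0 \<le> h x \<and> h x \<le> 1) \<Longrightarrow>
      (\<And>x y. dist x y \<le> R \<Longrightarrow> \<bar>h x - h y\<bar> < \<eta>) \<Longrightarrow> norm (commutator b (\<phi> (bc_of_real h))) \<le> \<delta>"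
proof -
  obtain N :: nat where N: "44 * norm b / \<delta> + 1 < N"
    using reals_Archimedean2 by blast
  moreover have "0 \<le> 44 * norm b / \<delta>"
    using \<open>\<delta> > 0\<close> by simp
  ultimately have "real N > 0" by linarith
  then have "N > 0" by simp
  have N1: "22 * norm b / N \<le> \<delta> / 2"
    using N \<open>\<delta> > 0\<close> \<open>N > 0\<close> by (simp add: field_simps)
  define \<epsilon> where "\<epsilon> = \<delta> / (2 * (real N + 1)\<^sup>2)"
  have "\<epsilon> > 0" using \<open>\<delta> > 0\<close> by (simp add: \<epsilon>_def add_nonneg_pos)
  then obtain R where R: "R \<ge> 0" "eps_propagation_le \<phi> \<epsilon> R b"
    using ql by (auto simp: quasi_local_def)
  have "(real N + 1)\<^sup>2 * \<epsilon> = \<delta> / 2"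
    by (simp add: \<epsilon>_def)
  then have "norm (commutator b (\<phi> (bc_of_real h))) \<le> \<delta>"
    if "continuous_on UNIV h" "\<And>x. 0 \<le> h x \<and> h x \<le> 1"
      "\<And>x y. dist x y \<le> R + 1 \<Longrightarrow> \<bar>h x - h y\<bar> < 1 / N" for h
    using norm_commutator_levels_le[OF \<open>N > 0\<close> R(2) that] N1 by linarith
  then show thesis
    using that[of "R + 1" "1 / N"] R(1) \<open>N > 0\<close> by auto
qed

text \<open>Real and imaginary part are mapped affinely from [-M, M] to [0, 1]. Undoing this
  multiplies each commutator by 2M, whence \<delta> / (4 M), and adds a scalar, which commutes with
  b. Complex linearity of b is what lets the factor \<i> pass through the commutator.\<close>

lemma quasi_local_commutator:
  assumes ql: "quasi_local \<phi> b" and b: "b \<in> bounded_ops" and "\<delta> > 0" "M > 0"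
  obtains R \<eta> where "R > 0" "\<eta> > 0"
    "\<And>f. norm f \<le> M \<Longrightarrow> (\<And>x y. dist x y \<le> R \<Longrightarrow> cmod (apply_bcontfun f x - apply_bcontfun f y) < \<eta>) \<Longrightarrow>
      norm (commutator b (\<phi> f)) \<le> \<delta>"
proof -
  have "\<delta> / (4 * M) > 0" using assms by simp
  then obtain R \<eta> where R: "R > 0" "\<eta> > 0" and
    *: "\<And>h. continuous_on UNIV h \<Longrightarrow> (\<And>x. 0 \<le> h x \<and> h x \<le> 1) \<Longrightarrow>
      (\<And>x y. dist x y \<le> R \<Longrightarrow> \<bar>h x - h y\<bar> < \<eta>) \<Longrightarrow> norm (commutator b (\<phi> (bc_of_real h))) \<le> \<delta> / (4 * M)"
    using quasi_local_commutator_unit[OF ql] by metis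
  have "norm (commutator b (\<phi> f)) \<le> \<delta>"
    if f: "norm f \<le> M" and var: "\<And>x y. dist x y \<le> R \<Longrightarrow> cmod (apply_bcontfun f x - apply_bcontfun f y) < 2 * M * \<eta>" for f
  proof -
    define u where "u = (\<lambda>t x. (t (apply_bcontfun f x) / M + 1) / 2 :: real)"
    have u: "norm (commutator b (\<phi> (bc_of_real (u t)))) \<le> \<delta> / (4 * M)"
       "bc_of_real (u t) x = complex_of_real (u t x)"
      if t: "t = Re \<or> t = Im" for t x
    proof -
      have cont: "continuous_on UNIV (u t)"
        unfolding u_def using t \<open>M > 0\<close> by (auto intro!: continuous_intros)
      have tf: "\<bar>t (f x)\<bar> \<le> M" for x
        using t f norm_bounded[of f x] abs_Re_le_cmod[of "f x"] abs_Im_le_cmod[of "f x"] by auto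
      have bds: "0 \<le> u t x \<and> u t x \<le> 1" for x
        using tf[of x] \<open>M > 0\<close> by (auto simp: u_def field_simps abs_le_iff)
      show "bc_of_real (u t) x = complex_of_real (u t x)"
        using cont bds by (rule bc_of_real_unit)
      show "norm (commutator b (\<phi> (bc_of_real (u t)))) \<le> \<delta> / (4 * M)"
      proof (rule *[OF cont bds])
        fix x y :: 'x assume "dist x y \<le> R"
        then have "cmod (f x - f y) < 2 * M * \<eta>" by (rule var)
        moreover have "\<bar>t (f x) - t (f y)\<bar> \<le> cmod (f x - f y)"
          using t abs_Re_le_cmod[of "f x - f y"] abs_Im_le_cmod[of "f x - f y"] by auto
        ultimately have "\<bar>t (f x) - t (f y)\<bar> / (2 * M) < \<eta>"
          using \<open>M > 0\<close> by (simp add: field_simps)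
        moreover have "u t x - u t y = (t (f x) - t (f y)) / (2 * M)"
          by (simp add: u_def field_simps diff_divide_distrib)
        ultimately show "\<bar>u t x - u t y\<bar> < \<eta>"
          using \<open>M > 0\<close> by simp
      qed
    qed
    define f1 f2 c where "f1 = (2 * M) *\<^sub>R bc_of_real (u Re)" and "f2 = (2 * M) *\<^sub>R bc_of_real (u Im)"
      and "c = - Complex M M"
    have "f = f1 + (bc_mult (const_bcontfun \<i>) f2 + bc_mult (const_bcontfun c) (const_bcontfun 1))"
    proof (rule bcontfun_eqI)
      fix x
      show "f x = (f1 + (bc_mult (const_bcontfun \<i>) f2 + bc_mult (const_bcontfun c) (const_bcontfun 1))) x"
        using \<open>M > 0\<close> by (simp add: f1_def f2_def c_def u complex_eq_iff) (simp add: u_def field_simps)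
    qed
    then have "\<phi> f = \<phi> f1 + (scaleC_op \<i> (\<phi> f2) + scaleC_op c id_blinfun)"
      by (metis phi_add phi_scale phi_one)
    moreover have "commutator b id_blinfun = 0"
      by (rule blinfun_eqI) (simp add: commutator_def blinfun.diff_left)
    moreover have "scaleC_op d (0 :: 'h \<Rightarrow>\<^sub>L 'h) = 0" for d
      using norm_scaleC_op_le[of d 0] by simp
    ultimately have "commutator b (\<phi> f) = commutator b (\<phi> f1) + scaleC_op \<i> (commutator b (\<phi> f2))"
      by (simp add: commutator_add_right commutator_scaleC_right[OF b])
    also have "norm \<dots> \<le> norm (commutator b (\<phi> f1)) + norm (commutator b (\<phi> f2))"
      using norm_triangle_ineq[of "commutator b (\<phi> f1)" "scaleC_op \<i> (commutator b (\<phi> f2))"]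
        norm_scaleC_op_le[of \<i> "commutator b (\<phi> f2)"] by simp
    also have "\<dots> = 2 * M * norm (commutator b (\<phi> (bc_of_real (u Re)))) + 2 * M * norm (commutator b (\<phi> (bc_of_real (u Im))))"
      using \<open>M > 0\<close> by (simp add: f1_def f2_def phi_scaleR commutator_scaleR_right)
    also have "\<dots> \<le> 2 * M * (\<delta> / (4 * M)) + 2 * M * (\<delta> / (4 * M))"
      using u(1)[of Re] u(1)[of Im] \<open>M > 0\<close> by (intro add_mono mult_left_mono) auto
    also have "\<dots> = \<delta>" using \<open>M > 0\<close> by simp
    finally show ?thesis .
  qed
  then show thesis
    using that[of R "2 * M * \<eta>"] R \<open>M > 0\<close> by simp
qed

end

section \<open>Cutoffs and the compact ideal\<close>

lemma apartD: "apart R Z Z' \<Longrightarrow> x \<in> Z \<Longrightarrow> y \<in> Z' \<Longrightarrow> R < dist x y"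
  using setdist_le_dist[of x Z y Z'] by (auto simp: apart_def)

lemma apart_mono:
  assumes "apart R Z Z'" "R' \<le> R" "W \<subseteq> Z" "W' \<subseteq> Z'"
  shows "apart R' W W'"
proof (cases "W = {} \<or> W' = {}")
  case False
  then have "setdist Z Z' \<le> setdist W Z'" "setdist W Z' \<le> setdist W W'"
    using assms by (auto intro!: setdist_subset_left setdist_subset_right)
  then show ?thesis
    using assms False by (auto simp: apart_def)
qed (auto simp: apart_def)

lemma csupp_memI: "apply_bcontfun f x \<noteq> 0 \<Longrightarrow> x \<in> csupp f"
  using closure_subset by (force simp: csupp_def)

lemma csupp_mono: "(\<And>x. apply_bcontfun f x \<noteq> 0 \<Longrightarrow> apply_bcontfun g x \<noteq> 0) \<Longrightarrow> csupp f \<subseteq> csupp g"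
  unfolding csupp_def by (intro closure_mono) auto

lemma norm_bc_mult_le:
  fixes f g :: "'a::topological_space \<Rightarrow>\<^sub>C complex"
  shows "norm (bc_mult f g) \<le> norm f * norm g"
  by (intro norm_bound) (auto simp: norm_mult intro!: mult_mono norm_bounded)

lemma norm_bc_mult_le_one: "norm f \<le> 1 \<Longrightarrow> norm g \<le> 1 \<Longrightarrow> norm (bc_mult f g) \<le> 1"
  using norm_bc_mult_le[of f g] mult_le_one[of "norm f" "norm g"] by simp

lemma blinfun_compose_assoc: "(a o\<^sub>L b) o\<^sub>L c = a o\<^sub>L (b o\<^sub>L c)"
  by (rule blinfun_eqI) simp

lemma norm_compose3_le: "norm (a o\<^sub>L b o\<^sub>L c) \<le> norm a * norm b * norm c"
  by (rule order_trans[OF norm_blinfun_compose mult_right_mono[OF norm_blinfun_compose norm_ge_zero]])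

lemma norm_add_less_le:
  fixes a b :: "'a::real_normed_vector"
  shows "norm a < r \<Longrightarrow> norm b \<le> s \<Longrightarrow> norm (a + b) < r + s"
  using norm_triangle_ineq[of a b] by linarith

text \<open>The value is 1 up to distance r - t from \<open>Z\<close>, 0 from distance r on, with
  slope 1 / t between. The empty set needs its own clause: \<open>infdist\<close> to it is 0, and
  the formula would give a nonzero constant whenever r and t are positive.\<close>

definition bump :: "real \<Rightarrow> real \<Rightarrow> 'x::metric_space set \<Rightarrow> 'x \<Rightarrow> real" where
  "bump r t Z x = (if Z = {} then 0 else max 0 (min 1 ((r - infdist x Z) / t)))"

lemma bump_bounds: "0 \<le> bump r t Z x \<and> bump r t Z x \<le> 1"
  by (simp add: bump_def)

lemma bump_lipschitz:
  assumes "t > 0"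
  shows "\<bar>bump r t Z x - bump r t Z y\<bar> \<le> dist x y / t"
proof (cases "Z = {}")
  case False
  have "\<bar>bump r t Z x - bump r t Z y\<bar> \<le> \<bar>(r - infdist x Z) / t - (r - infdist y Z) / t\<bar>"
    using False by (auto simp: bump_def max_def min_def)
  also have "\<dots> = \<bar>infdist x Z - infdist y Z\<bar> / t"
    using assms by (simp add: diff_divide_distrib[symmetric] abs_minus_commute)
  also have "\<dots> \<le> dist x y / t"
    using assms infdist_triangle_abs[of x Z y] by (intro divide_right_mono) auto
  finally show ?thesis .
qed (use assms in \<open>simp add: bump_def\<close>)

lemma bump_continuous: "t > 0 \<Longrightarrow> continuous_on UNIV (bump r t Z)"
proof -
  assume "t > 0"
  then have "(1 / t)-lipschitz_on UNIV (bump r t Z)"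
    using bump_lipschitz[of t r Z] by (intro lipschitz_onI) (auto simp: dist_real_def)
  then show ?thesis
    by (rule lipschitz_on_continuous_on)
qed

lemma bump_eq_1: "t > 0 \<Longrightarrow> Z \<noteq> {} \<Longrightarrow> infdist x Z \<le> r - t \<Longrightarrow> bump r t Z x = 1"
  by (simp add: bump_def field_simps)

lemma bump_nonzero: "t > 0 \<Longrightarrow> bump r t Z x \<noteq> 0 \<Longrightarrow> Z \<noteq> {} \<and> infdist x Z < r"
  by (auto simp: bump_def divide_le_0_iff split: if_splits)

lemma bump_nonzeroE:
  assumes "t > 0" "bump r t Z x \<noteq> 0"
  obtains z where "z \<in> Z" "dist x z < r"
proof -
  have "Z \<noteq> {}" "infdist x Z < r"
    using bump_nonzero[OF assms] by auto
  then show thesis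
    using that by (auto simp: infdist_def cINF_less_iff)
qed

lemma bc_bump_apply: "t > 0 \<Longrightarrow> apply_bcontfun (bc_of_real (bump r t Z)) x = complex_of_real (bump r t Z x)"
  by (intro bc_of_real_unit bump_continuous bump_bounds)

lemma norm_bc_bump: "t > 0 \<Longrightarrow> norm (bc_of_real (bump r t Z)) \<le> 1"
  using bump_bounds[of r t Z] by (intro norm_bound) (simp add: bc_bump_apply abs_le_iff order_trans[of _ 0])

text \<open>The transition from radius r to 2r has slope 1 / r, so large cutoffs have arbitrarily
  small variation at any fixed scale.\<close>

definition cutoff :: "'x::metric_space \<Rightarrow> real \<Rightarrow> 'x \<Rightarrow>\<^sub>C complex" where
  "cutoff z r = bc_of_real (bump (2 * r) r {z})"

lemma cutoff_apply: "r > 0 \<Longrightarrow> apply_bcontfun (cutoff z r) x = complex_of_real (bump (2 * r) r {z} x)"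
  by (simp add: cutoff_def bc_bump_apply)

lemma norm_cutoff: "r > 0 \<Longrightarrow> norm (cutoff z r) \<le> 1"
  by (simp add: cutoff_def norm_bc_bump)

lemma cutoff_eq_1: "r > 0 \<Longrightarrow> dist x z \<le> r \<Longrightarrow> apply_bcontfun (cutoff z r) x = 1"
  by (simp add: cutoff_apply bump_eq_1)

lemma cutoff_nonzero: "r > 0 \<Longrightarrow> apply_bcontfun (cutoff z r) x \<noteq> 0 \<Longrightarrow> dist x z < 2 * r"
  using bump_nonzero[of r "2 * r" "{z}" x] by (simp add: cutoff_apply)

definition cocutoff :: "'x::metric_space \<Rightarrow> real \<Rightarrow> 'x \<Rightarrow>\<^sub>C complex" where
  "cocutoff z r = const_bcontfun 1 - cutoff z r"

lemma norm_cocutoff: "r > 0 \<Longrightarrow> norm (cocutoff z r) \<le> 1"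
proof (rule norm_bound)
  fix x assume "r > 0"
  then have "cocutoff z r x = complex_of_real (1 - bump (2 * r) r {z} x)"
    by (simp add: cocutoff_def cutoff_apply)
  then show "cmod (cocutoff z r x) \<le> 1"
    using bump_bounds[of "2 * r" r "{z}" x] by (simp del: of_real_diff)
qed

lemma cocutoff_nonzero: "r > 0 \<Longrightarrow> apply_bcontfun (cocutoff z r) x \<noteq> 0 \<Longrightarrow> r < dist x z"
  using cutoff_eq_1[of r x z] by (force simp: cocutoff_def)

lemma cutoff_c0:
  assumes "r > 0"
  shows "cutoff (z::'x::heine_borel) r \<in> c0_functions"
  unfolding c0_functions_def
proof safe
  fix e :: real assume "e > 0"
  have "cmod (cutoff z r x) < e" if "x \<notin> cball z (2 * r)" for x
  proof -
    have "cutoff z r x = 0"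
      using cutoff_nonzero[OF assms, of z x] that by (auto simp: dist_commute)
    then show ?thesis using \<open>e > 0\<close> by simp
  qed
  then show "\<exists>A. compact A \<and> (\<forall>x. x \<notin> A \<longrightarrow> cmod (cutoff z r x) < e)"
    using compact_cball by blast
qed

lemma bc_mult_c0:
  assumes "g \<in> c0_functions" shows "bc_mult f g \<in> c0_functions"
  unfolding c0_functions_def
proof safe
  fix e :: real assume "e > 0"
  then have "e / (norm f + 1) > 0" by (simp add: add_nonneg_pos)
  then obtain A where A: "compact A" "\<forall>x. x \<notin> A \<longrightarrow> cmod (g x) < e / (norm f + 1)"
    using assms unfolding c0_functions_def by blast
  have "cmod (bc_mult f g x) < e" if "x \<notin> A" for x
  proof -
    have "cmod (f x) * cmod (g x) \<le> (norm f + 1) * cmod (g x)"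
      using norm_bounded[of f x] by (intro mult_right_mono) auto
    also have "\<dots> < e"
    proof -
      have "norm f + 1 > 0" by (simp add: add_nonneg_pos)
      moreover have "cmod (g x) < e / (norm f + 1)" using A(2) that by blast
      ultimately show ?thesis by (simp only: pos_less_divide_eq mult.commute)
    qed
    finally show ?thesis by (simp add: norm_mult)
  qed
  then show "\<exists>A. compact A \<and> (\<forall>x. x \<notin> A \<longrightarrow> cmod (bc_mult f g x) < e)"
    using A(1) by blast
qed

lemma c0_cocutoff_small:
  fixes f :: "'x::metric_space \<Rightarrow>\<^sub>C complex"
  assumes "f \<in> c0_functions" "e > 0"
  shows "eventually (\<lambda>r. norm (bc_mult f (cocutoff z r)) \<le> e) at_top"
proof -
  obtain A where A: "compact A" "\<forall>x. x \<notin> A \<longrightarrow> cmod (f x) < e"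
    using assms unfolding c0_functions_def by blast
  obtain \<rho> where \<rho>: "A \<subseteq> cball z \<rho>"
    using compact_imp_bounded[OF A(1)] bounded_any_center[of A z] by (auto simp: subset_eq mem_cball)
  show ?thesis
    using eventually_ge_at_top[of "max \<rho> 1"]
  proof eventually_elim
    case (elim r)
    then have r: "r > 0" "r \<ge> \<rho>" by auto
    show ?case
    proof (rule norm_bound)
      fix x
      show "norm (bc_mult f (cocutoff z r) x) \<le> e"
      proof (cases "x \<in> A")
        case True
        then have "dist x z \<le> r" using \<rho> r by (auto simp: dist_commute)
        then have "cocutoff z r x = 0" using cocutoff_nonzero[OF r(1), of z x] by force
        then show ?thesis using \<open>e > 0\<close> by simp
      next
        case False
        then have "cmod (f x) * cmod (cocutoff z r x) \<le> e * 1"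
          using \<open>e > 0\<close> A(2) norm_cocutoff[OF r(1), of z] norm_bounded[of "cocutoff z r" x] by (intro mult_mono) auto
        then show ?thesis by (simp add: norm_mult)
      qed
    qed
  qed
qed

section \<open>Decay of the compact ideal and commutators with Higson functions\<close>

context x_module
begin

lemma phi_cocutoff: "\<phi> (cocutoff z r) = id_blinfun - \<phi> (cutoff z r)"
  by (simp add: cocutoff_def phi_diff phi_one)

lemma phi_cutoff_strong: "((\<lambda>r. \<phi> (cutoff z (max 1 r)) x) \<longlongrightarrow> x) at_top"
proof -
  have "((\<lambda>r. \<phi> (cutoff z (max 1 r)) x) \<longlongrightarrow> \<phi> (const_bcontfun 1) x) at_top"
  proof (rule phi_strong_limit)
    show "cmod (cutoff z (max 1 r) x) \<le> 1" for r x
      using norm_bounded[of "cutoff z (max 1 r)" x] norm_cutoff[of "max 1 r" z] by linarith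
    fix A :: "'x set" assume A: "compact A"
    then obtain \<rho> where \<rho>: "A \<subseteq> cball z \<rho>"
      using compact_imp_bounded[OF A] bounded_any_center[of A z] by (auto simp: subset_eq mem_cball)
    show "eventually (\<lambda>r. \<forall>x\<in>A. cutoff z (max 1 r) x = const_bcontfun 1 x) at_top"
      using eventually_ge_at_top[of \<rho>]
    proof eventually_elim
      case (elim r)
      then show ?case
        using \<rho> by (auto intro!: cutoff_eq_1 simp: dist_commute)
    qed
  qed
  then show ?thesis by (simp add: phi_one)
qed

lemma norm_compose_phi_le:
  assumes "norm f \<le> 1"
  shows "norm (a o\<^sub>L \<phi> f) \<le> norm a" "norm (\<phi> f o\<^sub>L a) \<le> norm a"
  using norm_blinfun_compose[of a "\<phi> f"] norm_blinfun_compose[of "\<phi> f" a]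
    mult_left_le[of "norm (\<phi> f)" "norm a"] norm_phi_le[OF assms]
  by (auto simp: mult.commute intro: order_trans)

text \<open>This is how membership in the ideal is exploited. Up to e / 2 the element is one product
  f b g, and the cocutoff is absorbed by whichever C_0 factor it meets.\<close>

lemma compact_ideal_cocutoff_small:
  assumes a: "a \<in> compact_ideal \<phi> B" and "e > 0"
  shows "eventually (\<lambda>r. norm (a o\<^sub>L \<phi> (cocutoff z r)) < e \<and> norm (\<phi> (cocutoff z r) o\<^sub>L a) < e) at_top"
proof -
  obtain s where s: "s \<in> {\<phi> f o\<^sub>L b o\<^sub>L \<phi> g | f b g. f \<in> c0_functions \<and> b \<in> B \<and> g \<in> c0_functions}" "dist s a < e / 2"
    using a half_gt_zero[OF \<open>e > 0\<close>] unfolding compact_ideal_def closure_approachable by blast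
  then obtain f b g where fbg: "s = \<phi> f o\<^sub>L b o\<^sub>L \<phi> g" "f \<in> c0_functions" "g \<in> c0_functions"
    by blast
  have sa: "norm (a - s) < e / 2"
    using s(2) by (simp add: dist_norm norm_minus_commute)
  \<comment> \<open>The summand 1 avoids division by zero; with this choice both products to be
    estimated stay below e / 2.\<close>
  define e' where "e' = e / 2 / (norm f * norm b + norm b * norm g + 1)"
  have "e' > 0" using \<open>e > 0\<close> by (simp add: e'_def add_nonneg_pos)
  have e': "norm f * norm b * e' \<le> e / 2" "e' * (norm b * norm g) \<le> e / 2"
  proof -
    let ?d = "norm f * norm b + norm b * norm g + 1"
    have "?d > 0" by (simp add: add_nonneg_pos)
    then have "e' * ?d = e / 2" unfolding e'_def by (subst times_divide_eq_left) (rule nonzero_mult_div_cancel_right, simp)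
    moreover have "norm f * norm b * e' \<le> e' * ?d" "e' * (norm b * norm g) \<le> e' * ?d"
      using \<open>e' > 0\<close> by (auto simp: algebra_simps)
    ultimately show "norm f * norm b * e' \<le> e / 2" "e' * (norm b * norm g) \<le> e / 2"
      by auto
  qed
  show ?thesis
    using c0_cocutoff_small[OF fbg(2) \<open>e' > 0\<close>, of z] c0_cocutoff_small[OF fbg(3) \<open>e' > 0\<close>, of z] eventually_gt_at_top[of 0]
  proof eventually_elim
    case (elim r)
    let ?c = "cocutoff z r"
    have "s o\<^sub>L \<phi> ?c = (\<phi> f o\<^sub>L b) o\<^sub>L \<phi> (bc_mult g ?c)"
      by (simp add: fbg(1) phi_mult blinfun_compose_assoc)
    then have "norm (s o\<^sub>L \<phi> ?c) \<le> norm (\<phi> f) * norm b * norm (\<phi> (bc_mult g ?c))"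
      using norm_compose3_le[of "\<phi> f" b "\<phi> (bc_mult g ?c)"] by simp
    also have "\<dots> \<le> norm f * norm b * e'"
      using elim(2) by (intro mult_mono norm_phi order_trans[OF norm_phi]) auto
    finally have 1: "norm (s o\<^sub>L \<phi> ?c) \<le> e / 2" using e' by linarith
    have "\<phi> ?c o\<^sub>L s = \<phi> (bc_mult f ?c) o\<^sub>L (b o\<^sub>L \<phi> g)"
      by (simp add: fbg(1) bc_mult_commute[of f] phi_mult blinfun_compose_assoc)
    then have "norm (\<phi> ?c o\<^sub>L s) \<le> norm (\<phi> (bc_mult f ?c)) * norm b * norm (\<phi> g)"
      using norm_compose3_le[of "\<phi> (bc_mult f ?c)" b "\<phi> g"] by (simp add: blinfun_compose_assoc)
    also have "\<dots> = norm (\<phi> (bc_mult f ?c)) * (norm b * norm (\<phi> g))" by simp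
    also have "\<dots> \<le> e' * (norm b * norm g)"
      using elim(1) \<open>e' > 0\<close> by (intro mult_mono norm_phi order_trans[OF norm_phi]) auto
    finally have 2: "norm (\<phi> ?c o\<^sub>L s) \<le> e / 2" using e' by linarith
    have eq: "a o\<^sub>L \<phi> ?c = ((a - s) o\<^sub>L \<phi> ?c) + (s o\<^sub>L \<phi> ?c)" "\<phi> ?c o\<^sub>L a = (\<phi> ?c o\<^sub>L (a - s)) + (\<phi> ?c o\<^sub>L s)"
      by (auto intro!: blinfun_eqI simp: blinfun.diff_left blinfun.diff_right blinfun.add_left)
    have small: "norm ((a - s) o\<^sub>L \<phi> ?c) < e / 2" "norm (\<phi> ?c o\<^sub>L (a - s)) < e / 2"
      using norm_compose_phi_le[OF norm_cocutoff[OF elim(3), of z], of "a - s"] sa by linarith+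
    have "norm (a o\<^sub>L \<phi> ?c) < e / 2 + e / 2"
      unfolding eq(1) by (rule norm_add_less_le[OF small(1) 1])
    moreover have "norm (\<phi> ?c o\<^sub>L a) < e / 2 + e / 2"
      unfolding eq(2) by (rule norm_add_less_le[OF small(2) 2])
    ultimately show ?case by simp
  qed
qed

lemma compact_ideal_minus:
  assumes "a \<in> compact_ideal \<phi> B" shows "- a \<in> compact_ideal \<phi> B"
proof -
  let ?S = "{\<phi> f o\<^sub>L b o\<^sub>L \<phi> g | f b g. f \<in> c0_functions \<and> b \<in> B \<and> g \<in> c0_functions}"
  have "uminus ` ?S \<subseteq> ?S"
  proof safe
    fix f g :: "'x \<Rightarrow>\<^sub>C complex" and b assume h: "f \<in> c0_functions" "b \<in> B" "g \<in> c0_functions"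
    then have "- (\<phi> f o\<^sub>L b o\<^sub>L \<phi> g) = \<phi> (- f) o\<^sub>L b o\<^sub>L \<phi> g"
      by (intro blinfun_eqI) (simp add: phi_minus blinfun.minus_left)
    moreover have "- f \<in> c0_functions"
      using h(1) by (simp add: c0_functions_def)
    ultimately show "\<exists>f' b' g'. - (\<phi> f o\<^sub>L b o\<^sub>L \<phi> g) = \<phi> f' o\<^sub>L b' o\<^sub>L \<phi> g' \<and> f' \<in> c0_functions \<and> b' \<in> B \<and> g' \<in> c0_functions"
      using h by blast
  qed
  then have "uminus ` closure ?S \<subseteq> closure ?S"
    by (intro image_closure_subset continuous_intros) (use closure_subset[of ?S] in blast)+
  then show ?thesis
    using assms by (auto simp: compact_ideal_def)
qed

text \<open>Split g by a large cutoff. The inner part is in C_0(X), so its commutator lies in the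
  ideal by \<open>K\<close>; the outer part has small variation everywhere, so its commutator is
  small by quasi-locality. Hence the commutator of g is a limit of elements of the ideal, which is
  closed.\<close>

lemma higson_commutator_compact:
  assumes ql: "quasi_local \<phi> b" and b: "b \<in> bounded_ops"
    and K: "\<And>f. f \<in> c0_functions \<Longrightarrow> commutator (\<phi> f) b \<in> compact_ideal \<phi> B"
    and g: "g \<in> higson_functions"
  shows "commutator b (\<phi> g) \<in> compact_ideal \<phi> B"
proof -
  have "\<exists>y\<in>compact_ideal \<phi> B. dist y (commutator b (\<phi> g)) < e" if "e > 0" for e
  proof -
    have "e / 2 > 0" "norm g + 1 > 0" using that by (auto simp: add_nonneg_pos)
    then obtain R \<eta> where R: "R > 0" "\<eta> > 0" and
      small: "\<And>f. norm f \<le> norm g + 1 \<Longrightarrow> (\<And>x y. dist x y \<le> R \<Longrightarrow> cmod (apply_bcontfun f x - apply_bcontfun f y) < \<eta>) \<Longrightarrow>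
        norm (commutator b (\<phi> f)) \<le> e / 2"
      using quasi_local_commutator[OF ql b] by metis
    obtain A where A: "compact A"
      "\<And>x y. x \<notin> A \<Longrightarrow> y \<notin> A \<Longrightarrow> dist x y < R + 1 \<Longrightarrow> cmod (g x - g y) < \<eta> / 2"
    proof -
      have "R + 1 > 0" "\<eta> / 2 > 0" using R by auto
      then show thesis
        using g that unfolding higson_functions_def by blast
    qed
    define z :: 'x where "z = undefined"
    obtain \<rho> where \<rho>: "A \<subseteq> cball z \<rho>"
      using compact_imp_bounded[OF A(1)] bounded_any_center[of A z] by (auto simp: subset_eq mem_cball)
    \<comment> \<open>The first bound puts any two points within R of each other, one of them in
      \<open>A\<close>, into the ball where \<open>c\<close> vanishes. The second makes the change
      of \<open>c\<close> over distance R, multiplied by the size of g, less than \<eta> /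
      2.\<close>
    define r where "r = max (\<rho> + R) (2 * R * (norm g + 1) / \<eta>) + 1"
    have r: "r > \<rho> + R" "r > 2 * R * (norm g + 1) / \<eta>" by (auto simp: r_def)
    moreover have "2 * R * (norm g + 1) / \<eta> \<ge> 0"
      using R by simp
    ultimately have "r > 0" by linarith
    define c where "c = cocutoff z r"
    have c_le: "cmod (c x) \<le> 1" for x
      using norm_bounded[of c x] norm_cocutoff[OF \<open>r > 0\<close>, of z] by (simp add: c_def)
    have c0: "c x = 0" if "dist x z \<le> r" for x
      using cocutoff_nonzero[OF \<open>r > 0\<close>, of z x] that by (force simp: c_def)
    have c_lip: "cmod (c x - c y) \<le> dist x y / r" for x y
    proof -
      have "c x - c y = complex_of_real (bump (2 * r) r {z} y - bump (2 * r) r {z} x)"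
        by (simp add: c_def cocutoff_def cutoff_apply \<open>r > 0\<close>)
      then show ?thesis
        using bump_lipschitz[OF \<open>r > 0\<close>, of "2 * r" "{z}" y x] by (simp add: dist_commute del: of_real_diff)
    qed
    have "norm (commutator b (\<phi> (bc_mult g c))) \<le> e / 2"
    proof (rule small)
      show "norm (bc_mult g c) \<le> norm g + 1"
        using norm_bc_mult_le[of g c] norm_cocutoff[OF \<open>r > 0\<close>, of z] mult_left_mono[of "norm c" 1 "norm g"]
        by (simp add: c_def)
      fix x y :: 'x assume xy: "dist x y \<le> R"
      have gc: "cmod (g x) * cmod (c x - c y) < \<eta> / 2"
      proof -
        have "cmod (g x) * cmod (c x - c y) \<le> (norm g + 1) * (R / r)"
          using norm_bounded[of g x] c_lip[of x y] xy \<open>r > 0\<close>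
          by (intro mult_mono order_trans[OF c_lip] divide_right_mono) auto
        also have "\<dots> < \<eta> / 2"
          using r(2) R \<open>r > 0\<close> by (simp add: field_simps)
        finally show ?thesis .
      qed
      show "cmod (bc_mult g c x - bc_mult g c y) < \<eta>"
      proof (cases "x \<in> A \<or> y \<in> A")
        case True
        then have "dist x z \<le> r \<and> dist y z \<le> r"
          using \<rho> xy r(1) R dist_triangle[of x z y] dist_triangle[of y z x] by (auto simp: dist_commute)
        then show ?thesis using c0 R by simp
      next
        case False
        then have "cmod (g x - g y) * cmod (c y) \<le> \<eta> / 2 * 1"
          using A(2)[of x y] xy c_le[of y] R by (intro mult_mono) auto
        moreover have "bc_mult g c x - bc_mult g c y = g x * (c x - c y) + (g x - g y) * c y"
          by (simp add: algebra_simps)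
        ultimately show ?thesis
          using gc norm_triangle_ineq[of "g x * (c x - c y)" "(g x - g y) * c y"]
          by (simp add: norm_mult)
      qed
    qed
    moreover have "commutator b (\<phi> g) = commutator b (\<phi> (bc_mult g (cutoff z r))) + commutator b (\<phi> (bc_mult g c))"
    proof -
      have "g = bc_mult g (cutoff z r) + bc_mult g c"
        by (rule bcontfun_eqI) (simp add: c_def cocutoff_def algebra_simps)
      then show ?thesis
        by (metis commutator_add_right phi_add)
    qed
    moreover have "commutator b (\<phi> (bc_mult g (cutoff z r))) \<in> compact_ideal \<phi> B"
    proof -
      have "- commutator (\<phi> (bc_mult g (cutoff z r))) b \<in> compact_ideal \<phi> B"
        by (intro compact_ideal_minus K bc_mult_c0 cutoff_c0 \<open>r > 0\<close>)
      then show ?thesis by (simp add: commutator_def)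
    qed
    ultimately show ?thesis
      using \<open>e > 0\<close>
      by (intro bexI[of _ "commutator b (\<phi> (bc_mult g (cutoff z r)))"]) (auto simp: dist_norm)
  qed
  then have "commutator b (\<phi> g) \<in> closure (compact_ideal \<phi> B)"
    by (simp add: closure_approachable)
  then show ?thesis
    by (simp add: compact_ideal_def)
qed

end

section \<open>Commutators detect quasi-locality\<close>

lemma SUP_diff_le:
  fixes a b :: "nat \<Rightarrow> real"
  assumes "\<And>k. a k \<le> 1" "\<And>k. b k \<le> 1" "\<And>k. \<bar>a k - b k\<bar> \<le> c"
  shows "\<bar>(SUP k. a k) - (SUP k. b k)\<bar> \<le> c"
proof -
  have le: "(SUP k. a k) \<le> (SUP k. b k) + c"
    if "\<And>k. b k \<le> 1" "\<And>k. \<bar>a k - b k\<bar> \<le> c" for a b :: "nat \<Rightarrow> real"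
  proof (rule cSUP_least)
    fix k
    have "b k \<le> (SUP k. b k)"
      using that(1) by (intro cSUP_upper) (auto simp: bdd_above_def)
    then show "a k \<le> (SUP k. b k) + c"
      using that(2)[of k] by linarith
  qed simp
  show ?thesis
    using le[of b a] le[of a b] assms by (simp add: abs_minus_commute abs_le_iff)
qed

context x_module
begin

lemma phi_absorb:
  assumes "\<And>x. apply_bcontfun f x \<noteq> 0 \<Longrightarrow> apply_bcontfun g x = 1"
  shows "\<phi> f o\<^sub>L \<phi> g = \<phi> f" "\<phi> g o\<^sub>L \<phi> f = \<phi> f"
proof -
  have "bc_mult f g = f"
    using assms by (intro bcontfun_eqI) force
  then show "\<phi> f o\<^sub>L \<phi> g = \<phi> f" "\<phi> g o\<^sub>L \<phi> f = \<phi> f"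
    by (metis phi_mult, metis phi_mult bc_mult_commute)
qed

lemma phi_absorb_apply:
  assumes "\<And>x. apply_bcontfun f x \<noteq> 0 \<Longrightarrow> apply_bcontfun g x = 1"
  shows "\<phi> f (\<phi> g y) = \<phi> f y" "\<phi> g (\<phi> f y) = \<phi> f y"
  using phi_absorb[of f g, OF assms] by (metis blinfun_apply_blinfun_compose)+

lemma phi_disjoint_apply:
  assumes "\<And>x. apply_bcontfun f x = 0 \<or> apply_bcontfun g x = 0"
  shows "\<phi> f (\<phi> g y) = 0"
  using phi_disjoint[of f g, OF assms] by (metis blinfun_apply_blinfun_compose blinfun.zero_left)

lemma norm_phi_cutdown_le:
  assumes "norm f \<le> 1" "norm g \<le> 1"
  shows "norm (\<phi> f o\<^sub>L a o\<^sub>L \<phi> g) \<le> norm a"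
  using norm_compose_phi_le(1)[OF assms(2), of "\<phi> f o\<^sub>L a"] norm_compose_phi_le(2)[OF assms(1), of a]
  by linarith

text \<open>One of the two terms of the commutator dies because g annihilates f', the other is f b
  f' because g is absorbed by f.\<close>

lemma separate_product_commutator:
  assumes "\<And>x. apply_bcontfun f x \<noteq> 0 \<Longrightarrow> apply_bcontfun g x = 1"
    and "\<And>x. apply_bcontfun f' x = 0 \<or> apply_bcontfun g x = 0"
  shows "\<phi> f o\<^sub>L b o\<^sub>L \<phi> f' = - (\<phi> f o\<^sub>L commutator b (\<phi> g) o\<^sub>L \<phi> f')"
proof (rule blinfun_eqI)
  fix x
  have "\<phi> f (\<phi> g y) = \<phi> f y" for y
    by (rule phi_absorb_apply(1)[OF assms(1)])
  moreover have "\<phi> g (\<phi> f' y) = 0" for y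
    using assms(2) by (intro phi_disjoint_apply) blast
  ultimately show "(\<phi> f o\<^sub>L b o\<^sub>L \<phi> f') x = (- (\<phi> f o\<^sub>L commutator b (\<phi> g) o\<^sub>L \<phi> f')) x"
    by (simp add: commutator_def blinfun.diff_left blinfun.diff_right blinfun.minus_left blinfun.minus_right)
qed

text \<open>The part of b connecting a fixed ball with infinity fades out. The intermediate cutoff s
  of radius 2 \<rho> is 1 where the inner cutoff e lives and 0 where the outer function k lives, so
  e b k = e [s, b] k, and [s, b] belongs to the ideal.\<close>

lemma cutoff_cocutoff_small:
  assumes K: "\<And>f. f \<in> c0_functions \<Longrightarrow> commutator (\<phi> f) b \<in> compact_ideal \<phi> B"
    and "\<rho> > 0" "e > 0"
  shows "eventually (\<lambda>r. norm (\<phi> (cutoff z \<rho>) o\<^sub>L b o\<^sub>L \<phi> (cocutoff z r)) < e \<and>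
      norm (\<phi> (cocutoff z r) o\<^sub>L b o\<^sub>L \<phi> (cutoff z \<rho>)) < e) at_top"
proof -
  define s where "s = cutoff z (2 * \<rho>)"
  define a where "a = commutator (\<phi> s) b"
  have "a \<in> compact_ideal \<phi> B"
    using \<open>\<rho> > 0\<close> by (auto simp: a_def s_def intro!: K cutoff_c0)
  then show ?thesis
    using compact_ideal_cocutoff_small[OF _ \<open>e > 0\<close>, of a B z] eventually_ge_at_top[of "4 * \<rho>"]
  proof (elim eventually_elim2[rotated])
    show "eventually (\<lambda>r. norm (a o\<^sub>L \<phi> (cocutoff z r)) < e \<and> norm (\<phi> (cocutoff z r) o\<^sub>L a) < e) at_top"
      by (rule compact_ideal_cocutoff_small) fact+
    fix r assume small: "norm (a o\<^sub>L \<phi> (cocutoff z r)) < e \<and> norm (\<phi> (cocutoff z r) o\<^sub>L a) < e" and r: "4 * \<rho> \<le> r"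
    let ?e = "\<phi> (cutoff z \<rho>)" and ?k = "\<phi> (cocutoff z r)"
    have "r > 0" "2 * \<rho> > 0" using r \<open>\<rho> > 0\<close> by auto
    have disj: "s x = 0 \<or> cocutoff z r x = 0" for x
    proof (rule ccontr)
      assume "\<not> (s x = 0 \<or> cocutoff z r x = 0)"
      then have "dist x z < 2 * (2 * \<rho>)" "r < dist x z"
        using cutoff_nonzero[OF \<open>2 * \<rho> > 0\<close>, of z x] cocutoff_nonzero[OF \<open>r > 0\<close>, of z x] by (auto simp: s_def)
      then show False using r by simp
    qed
    have sk: "\<phi> s (?k y) = 0" "?k (\<phi> s y) = 0" for y
      using disj by (auto intro!: phi_disjoint_apply)
    have "s x = 1" if "cutoff z \<rho> x \<noteq> 0" for x
      using cutoff_nonzero[OF \<open>\<rho> > 0\<close> that] \<open>\<rho> > 0\<close> by (simp add: s_def cutoff_eq_1)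
    then have es: "?e (\<phi> s y) = ?e y" "\<phi> s (?e y) = ?e y" for y
      by (auto intro!: phi_absorb_apply)
    have "?e o\<^sub>L b o\<^sub>L ?k = ?e o\<^sub>L (a o\<^sub>L ?k)"
      by (rule blinfun_eqI) (simp add: a_def commutator_def blinfun.diff_left blinfun.diff_right sk es)
    moreover have "?k o\<^sub>L b o\<^sub>L ?e = - ((?k o\<^sub>L a) o\<^sub>L ?e)"
      by (rule blinfun_eqI) (simp add: a_def commutator_def blinfun.diff_left blinfun.diff_right blinfun.minus_left sk es)
    ultimately show "norm (?e o\<^sub>L b o\<^sub>L ?k) < e \<and> norm (?k o\<^sub>L b o\<^sub>L ?e) < e"
      using small norm_compose_phi_le(2)[OF norm_cutoff[OF \<open>\<rho> > 0\<close>, of z], of "a o\<^sub>L ?k"]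
        norm_compose_phi_le(1)[OF norm_cutoff[OF \<open>\<rho> > 0\<close>, of z], of "?k o\<^sub>L a"] by simp
  qed
qed

text \<open>The norm is lower semicontinuous for strong convergence: one vector witnesses that it
  exceeds c, and the cutoffs converge strongly to the identity while staying contractive, so the
  witness survives compression.\<close>

lemma compress_to_compact:
  assumes "norm (\<phi> f o\<^sub>L b o\<^sub>L \<phi> f') > c"
  obtains r where "r > 0" "norm (\<phi> (bc_mult f (cutoff z r)) o\<^sub>L b o\<^sub>L \<phi> (bc_mult (cutoff z r) f')) > c"
proof -
  show thesis
  proof (cases "c < 0")
    case True
    then show thesis
      using that[of 1] by (simp add: less_le_trans[OF _ norm_ge_zero])
  next
    case False
    then have "\<not> (\<forall>x. norm ((\<phi> f o\<^sub>L b o\<^sub>L \<phi> f') x) \<le> c * norm x)"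
      using assms norm_blinfun_bound[of c "\<phi> f o\<^sub>L b o\<^sub>L \<phi> f'"] by fastforce
    then obtain x where x: "c * norm x < norm (\<phi> f (b (\<phi> f' x)))"
      by (auto simp: not_le)
    define k where "k = (\<lambda>r. \<phi> (cutoff z (max 1 r)))"
    have k1: "norm (k r y) \<le> norm y" for r y
      unfolding k_def by (intro norm_phi_apply_le norm_cutoff) simp
    have lim: "((\<lambda>r. k r y) \<longlongrightarrow> y) at_top" for y
      unfolding k_def by (rule phi_cutoff_strong)
    define y where "y = b (\<phi> f' x)"
    have l1: "((\<lambda>r. b (k r (\<phi> f' x)) - y) \<longlongrightarrow> 0) at_top"
      using tendsto_diff[OF blinfun.tendsto[OF tendsto_const lim] tendsto_const, of b "\<phi> f' x" y] by (simp add: y_def)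
    have "((\<lambda>r. k r (b (k r (\<phi> f' x)) - y)) \<longlongrightarrow> 0) at_top"
      using l1 by (rule tendsto_0_le[where K = 1]) (simp add: k1)
    from tendsto_add[OF this lim[of y]] have "((\<lambda>r. k r (b (k r (\<phi> f' x)))) \<longlongrightarrow> y) at_top"
      by (simp add: blinfun.diff_right)
    then have "((\<lambda>r. norm (\<phi> f (k r (b (k r (\<phi> f' x)))))) \<longlongrightarrow> norm (\<phi> f y)) at_top"
      by (intro tendsto_norm blinfun.tendsto tendsto_const)
    then have "eventually (\<lambda>r. c * norm x < norm (\<phi> f (k r (b (k r (\<phi> f' x)))))) at_top"
      using x by (intro order_tendstoD(1)) (auto simp: y_def)
    then obtain r where r: "c * norm x < norm (\<phi> f (k r (b (k r (\<phi> f' x)))))"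
      using eventually_happens[of _ "at_top :: real filter"] by auto
    let ?T = "\<phi> (bc_mult f (cutoff z (max 1 r))) o\<^sub>L b o\<^sub>L \<phi> (bc_mult (cutoff z (max 1 r)) f')"
    have "c * norm x < norm ?T * norm x"
      using r norm_blinfun[of ?T x] by (simp add: phi_mult k_def)
    then have "c < norm ?T"
      by (simp add: mult_less_cancel_right)
    then show thesis
      using that[of "max 1 r"] by simp
  qed
qed

text \<open>Failure of quasi-locality cannot be caused by a bounded region. A sufficiently separated
  pair cannot have both members meeting the ball, so every term touching it connects the ball with
  far away, where b is small; the rest is cut off at a large radius.\<close>

lemma annulus_pair:
  assumes K: "\<And>f. f \<in> c0_functions \<Longrightarrow> commutator (\<phi> f) b \<in> compact_ideal \<phi> B"
    and nql: "\<And>R. R \<ge> 0 \<Longrightarrow> \<not> eps_propagation_le \<phi> \<epsilon> R b" and "\<epsilon> > 0" and "\<rho> > 0"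
  obtains f f' s where "norm f \<le> 1" "norm f' \<le> 1"
    "\<And>x. apply_bcontfun f x \<noteq> 0 \<Longrightarrow> \<rho> < dist x z \<and> dist x z < s"
    "\<And>x. apply_bcontfun f' x \<noteq> 0 \<Longrightarrow> \<rho> < dist x z \<and> dist x z < s"
    "apart n (csupp f) (csupp f')" "norm (\<phi> f o\<^sub>L b o\<^sub>L \<phi> f') > \<epsilon> / 2"
proof -
  define e where "e = cutoff z \<rho>"
  define c where "c = cocutoff z \<rho>"
  have "eventually (\<lambda>r. (norm (\<phi> e o\<^sub>L b o\<^sub>L \<phi> (cocutoff z r)) < \<epsilon> / 8 \<and>
      norm (\<phi> (cocutoff z r) o\<^sub>L b o\<^sub>L \<phi> e) < \<epsilon> / 8) \<and> \<rho> \<le> r) at_top"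
    unfolding e_def using assms by (intro eventually_conj cutoff_cocutoff_small[OF K] eventually_ge_at_top) auto
  then obtain r where r: "norm (\<phi> e o\<^sub>L b o\<^sub>L \<phi> (cocutoff z r)) < \<epsilon> / 8"
      "norm (\<phi> (cocutoff z r) o\<^sub>L b o\<^sub>L \<phi> e) < \<epsilon> / 8" "\<rho> \<le> r"
    using eventually_happens[of _ "at_top :: real filter"] by force
  have "r > 0" using r \<open>\<rho> > 0\<close> by simp
  define k where "k = cutoff z r"
  have le1: "norm e \<le> 1" "norm c \<le> 1" "norm k \<le> 1"
    using \<open>\<rho> > 0\<close> \<open>r > 0\<close> by (auto simp: e_def c_def k_def norm_cutoff norm_cocutoff)
  \<comment> \<open>Two points in the ball of radius 2r, which contains the supports of
    \<open>e\<close> and \<open>k\<close>, are at most 4r apart. Beyond that separation at most one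
    of f, f' meets this ball.\<close>
  have "max n (4 * r) \<ge> 0" using \<open>r > 0\<close> by simp
  then obtain f f' where f: "norm f \<le> 1" "norm f' \<le> 1" "apart (max n (4 * r)) (csupp f) (csupp f')"
      "\<epsilon> \<le> norm (\<phi> f o\<^sub>L b o\<^sub>L \<phi> f')"
    using nql unfolding eps_propagation_le_def by (metis not_less)
  have near: "(\<forall>x. f x = 0 \<or> dist x z \<ge> 2 * r) \<or> (\<forall>x. f' x = 0 \<or> dist x z \<ge> 2 * r)"
  proof (rule ccontr)
    assume "\<not> ?thesis"
    then obtain x y where xy: "f x \<noteq> 0" "dist x z < 2 * r" "f' y \<noteq> 0" "dist y z < 2 * r"
      by (auto simp: not_le)
    then have "max n (4 * r) < dist x y"
      using apartD[OF f(3)] csupp_memI by blast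
    then show False
      using xy dist_triangle2[of x y z] by auto
  qed
  have k0: "k x = 0" "e x = 0" if "dist x z \<ge> 2 * r" for x
    using cutoff_nonzero[OF \<open>r > 0\<close>, of z x] cutoff_nonzero[OF \<open>\<rho> > 0\<close>, of z x] that r(3) by (force simp: k_def e_def)+
  have 1: "(\<phi> f o\<^sub>L \<phi> e = 0) \<or> (\<phi> k o\<^sub>L \<phi> f' = 0)" "(\<phi> f o\<^sub>L \<phi> k = 0) \<or> (\<phi> e o\<^sub>L \<phi> f' = 0)"
    using near by (metis phi_disjoint k0)+
  have split: "y = \<phi> e y + \<phi> c y" "y = \<phi> k y + \<phi> (cocutoff z r) y" for y
    by (simp_all add: c_def e_def k_def phi_cocutoff blinfun.diff_left)
  \<comment> \<open>Either f e = 0 or k f' = 0. In both cases f e b k f' = 0, so b may be followed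
    by 1 - k, and e b (1 - k) was made small. The next estimate is the mirror image, with
    \<open>c\<close> standing by.\<close>
  have 2: "norm (\<phi> f o\<^sub>L (\<phi> e o\<^sub>L b) o\<^sub>L \<phi> f') \<le> \<epsilon> / 8"
  proof -
    have "\<phi> f (\<phi> e (b (\<phi> k (\<phi> f' x)))) = 0" for x
      using 1(1) by (metis blinfun.zero_left blinfun.zero_right blinfun_apply_blinfun_compose)
    then have "\<phi> f o\<^sub>L (\<phi> e o\<^sub>L b) o\<^sub>L \<phi> f' = \<phi> f o\<^sub>L (\<phi> e o\<^sub>L b o\<^sub>L \<phi> (cocutoff z r)) o\<^sub>L \<phi> f'"
      by (intro blinfun_eqI) (simp, subst split(2), simp add: blinfun.add_right)
    then show ?thesis
      using norm_phi_cutdown_le[OF f(1,2), of "\<phi> e o\<^sub>L b o\<^sub>L \<phi> (cocutoff z r)"] r(1) by simp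
  qed
  have 3: "norm (\<phi> f o\<^sub>L (\<phi> c o\<^sub>L b o\<^sub>L \<phi> e) o\<^sub>L \<phi> f') \<le> \<epsilon> / 8"
  proof -
    have comm: "\<phi> f (\<phi> c y) = \<phi> c (\<phi> f y)" "\<phi> c (\<phi> k' y) = \<phi> k' (\<phi> c y)" for y k'
      using arg_cong[OF phi_commute[of f c], of "\<lambda>T. blinfun_apply T y"]
        arg_cong[OF phi_commute[of c k'], of "\<lambda>T. blinfun_apply T y"] by auto
    have z: "\<phi> f (\<phi> k (b (\<phi> e (\<phi> f' x)))) = 0" for x
      using 1(2) by (metis blinfun.zero_left blinfun.zero_right blinfun_apply_blinfun_compose)
    have "\<phi> f o\<^sub>L (\<phi> c o\<^sub>L b o\<^sub>L \<phi> e) o\<^sub>L \<phi> f' = \<phi> (bc_mult f c) o\<^sub>L (\<phi> (cocutoff z r) o\<^sub>L b o\<^sub>L \<phi> e) o\<^sub>L \<phi> f'"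
    proof (rule blinfun_eqI)
      fix x
      let ?v = "b (\<phi> e (\<phi> f' x))"
      have "\<phi> f (\<phi> c ?v) = \<phi> c (\<phi> f (\<phi> k ?v + \<phi> (cocutoff z r) ?v))"
        using split(2)[of ?v] comm(1) by simp
      also have "\<dots> = \<phi> f (\<phi> c (\<phi> (cocutoff z r) ?v))"
        by (simp add: blinfun.add_right z comm(1))
      finally show "(\<phi> f o\<^sub>L (\<phi> c o\<^sub>L b o\<^sub>L \<phi> e) o\<^sub>L \<phi> f') x = (\<phi> (bc_mult f c) o\<^sub>L (\<phi> (cocutoff z r) o\<^sub>L b o\<^sub>L \<phi> e) o\<^sub>L \<phi> f') x"
        by (simp add: phi_mult)
    qed
    then show ?thesis
      using norm_phi_cutdown_le[OF norm_bc_mult_le_one[OF f(1) le1(2)] f(2), of "\<phi> (cocutoff z r) o\<^sub>L b o\<^sub>L \<phi> e"] r(2) by simp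
  qed
  have eq: "\<phi> f o\<^sub>L b o\<^sub>L \<phi> f' = (\<phi> f o\<^sub>L (\<phi> e o\<^sub>L b) o\<^sub>L \<phi> f') + ((\<phi> f o\<^sub>L (\<phi> c o\<^sub>L b o\<^sub>L \<phi> e) o\<^sub>L \<phi> f') +
      (\<phi> (bc_mult f c) o\<^sub>L b o\<^sub>L \<phi> (bc_mult c f')))"
  proof (rule blinfun_eqI)
    fix x
    let ?y = "\<phi> f' x"
    have A: "T w = T (\<phi> e w) + T (\<phi> c w)" for w and T :: "'h \<Rightarrow>\<^sub>L 'h"
      using arg_cong[OF split(1)[of w], of "blinfun_apply T"] by (simp add: blinfun.add_right)
    have "\<phi> f (b ?y) = \<phi> f (\<phi> e (b ?y)) + \<phi> f (\<phi> c (b ?y))"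
      by (rule A)
    moreover have "\<phi> f (\<phi> c (b ?y)) = \<phi> f (\<phi> c (b (\<phi> e ?y))) + \<phi> f (\<phi> c (b (\<phi> c ?y)))"
      using A[of "\<phi> f o\<^sub>L \<phi> c o\<^sub>L b" ?y] by simp
    ultimately show "(\<phi> f o\<^sub>L b o\<^sub>L \<phi> f') x = ((\<phi> f o\<^sub>L (\<phi> e o\<^sub>L b) o\<^sub>L \<phi> f') + ((\<phi> f o\<^sub>L (\<phi> c o\<^sub>L b o\<^sub>L \<phi> e) o\<^sub>L \<phi> f') +
      (\<phi> (bc_mult f c) o\<^sub>L b o\<^sub>L \<phi> (bc_mult c f')))) x"
      by (simp add: phi_mult blinfun.add_left)
  qed
  \<comment> \<open>The two terms touching the ball cost \<epsilon> / 8 each, so the term with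
    \<open>c\<close> on both sides keeps at least 3 \<epsilon> / 4.\<close>
  have "\<epsilon> \<le> \<epsilon> / 8 + (\<epsilon> / 8 + norm (\<phi> (bc_mult f c) o\<^sub>L b o\<^sub>L \<phi> (bc_mult c f')))"
    using f(4) unfolding eq
    by (rule order_trans[OF _ order_trans[OF norm_triangle_ineq add_mono[OF 2 order_trans[OF norm_triangle_ineq add_mono[OF 3 order_refl]]]]])
  then have "norm (\<phi> (bc_mult f c) o\<^sub>L b o\<^sub>L \<phi> (bc_mult c f')) > \<epsilon> / 2"
    using \<open>\<epsilon> > 0\<close> by linarith
  then obtain s where s: "s > 0" "norm (\<phi> (bc_mult (bc_mult f c) (cutoff z s)) o\<^sub>L b o\<^sub>L \<phi> (bc_mult (cutoff z s) (bc_mult c f'))) > \<epsilon> / 2"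
    by (rule compress_to_compact)
  show thesis
  proof (rule that[OF _ _ _ _ _ s(2)])
    show "norm (bc_mult (bc_mult f c) (cutoff z s)) \<le> 1" "norm (bc_mult (cutoff z s) (bc_mult c f')) \<le> 1"
      by (intro norm_bc_mult_le_one f le1 norm_cutoff s)+
    have range: "\<rho> < dist x z \<and> dist x z < 2 * s" if "c x \<noteq> 0" "cutoff z s x \<noteq> 0" for x
      using cutoff_nonzero[OF s(1) that(2)] cocutoff_nonzero[OF \<open>\<rho> > 0\<close> that(1)[unfolded c_def]] by simp
    show "\<rho> < dist x z \<and> dist x z < 2 * s" if "bc_mult (bc_mult f c) (cutoff z s) x \<noteq> 0" for x
      by (rule range) (use that in simp_all)
    show "\<rho> < dist x z \<and> dist x z < 2 * s" if "bc_mult (cutoff z s) (bc_mult c f') x \<noteq> 0" for x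
      by (rule range) (use that in simp_all)
    show "apart n (csupp (bc_mult (bc_mult f c) (cutoff z s))) (csupp (bc_mult (cutoff z s) (bc_mult c f')))"
      by (rule apart_mono[OF f(3)]) (simp, (rule csupp_mono, simp)+)
  qed
qed

lemma quasi_local_if_higson:
  assumes K: "\<And>f. f \<in> c0_functions \<Longrightarrow> commutator (\<phi> f) b \<in> compact_ideal \<phi> B"
    and H: "\<And>g. g \<in> higson_functions \<Longrightarrow> commutator b (\<phi> g) \<in> compact_ideal \<phi> B"
  shows "quasi_local \<phi> b"
proof (rule ccontr)
  assume "\<not> quasi_local \<phi> b"
  then obtain \<epsilon> where \<epsilon>: "\<epsilon> > 0" "\<And>R. R \<ge> 0 \<Longrightarrow> \<not> eps_propagation_le \<phi> \<epsilon> R b"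
    by (auto simp: quasi_local_def)
  define z :: 'x where "z = undefined"
  define P where "P = (\<lambda>\<rho> (k::nat) f f' s. norm f \<le> 1 \<and> norm f' \<le> 1 \<and>
    (\<forall>x. apply_bcontfun f x \<noteq> 0 \<longrightarrow> \<rho> < dist x z \<and> dist x z < s) \<and>
    (\<forall>x. apply_bcontfun f' x \<noteq> 0 \<longrightarrow> \<rho> < dist x z \<and> dist x z < s) \<and>
    apart (real k + 1) (csupp f) (csupp f') \<and> norm (\<phi> f o\<^sub>L b o\<^sub>L \<phi> f') > \<epsilon> / 2)"
  have "\<exists>f f' s. P \<rho> k f f' s" if "\<rho> > 0" for \<rho> k
    using annulus_pair[OF K \<epsilon>(2,1) that, where n = "real k + 1" and z = z] unfolding P_def by metis
  then obtain F F' S where P: "\<And>\<rho> k. \<rho> > 0 \<Longrightarrow> P \<rho> k (F \<rho> k) (F' \<rho> k) (S \<rho> k)"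
    by metis
  \<comment> \<open>The increment 2k + 4 exceeds (k + 1) + (k + 2), the widths of the bumps around
    pair k and pair k + 1; thus the enlarged annuli between \<open>lo\<close> and \<open>hi\<close>
    are disjoint. The \<open>max\<close> makes the radii increase in any case.\<close>
  define \<rho> where "\<rho> = rec_nat (1::real) (\<lambda>k r. max (S r k) r + (2 * real k + 4))"
  have \<rho>_Suc: "\<rho> (Suc k) = max (S (\<rho> k) k) (\<rho> k) + (2 * real k + 4)" for k
    by (simp add: \<rho>_def)
  have \<rho>_ge: "\<rho> k \<ge> 1 + real k" for k
    by (induction k) (auto simp: \<rho>_Suc, simp add: \<rho>_def)
  define f where "f = (\<lambda>k. F (\<rho> k) k)"
  define f' where "f' = (\<lambda>k. F' (\<rho> k) k)"
  define lo where "lo = (\<lambda>k. \<rho> k - (real k + 1))"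
  define hi where "hi = (\<lambda>k. S (\<rho> k) k + (real k + 1))"
  have f: "norm (f k) \<le> 1" "norm (f' k) \<le> 1"
    "\<And>x. f k x \<noteq> 0 \<Longrightarrow> lo k + (real k + 1) < dist x z \<and> dist x z < hi k - (real k + 1)"
    "\<And>x. f' k x \<noteq> 0 \<Longrightarrow> lo k + (real k + 1) < dist x z \<and> dist x z < hi k - (real k + 1)"
    "apart (real k + 1) (csupp (f k)) (csupp (f' k))" "norm (\<phi> (f k) o\<^sub>L b o\<^sub>L \<phi> (f' k)) > \<epsilon> / 2" for k
  proof -
    have "\<rho> k > 0" using \<rho>_ge[of k] by linarith
    from P[OF this, of k]
    show "norm (f k) \<le> 1" "norm (f' k) \<le> 1"
      "\<And>x. f k x \<noteq> 0 \<Longrightarrow> lo k + (real k + 1) < dist x z \<and> dist x z < hi k - (real k + 1)"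
      "\<And>x. f' k x \<noteq> 0 \<Longrightarrow> lo k + (real k + 1) < dist x z \<and> dist x z < hi k - (real k + 1)"
      "apart (real k + 1) (csupp (f k)) (csupp (f' k))" "norm (\<phi> (f k) o\<^sub>L b o\<^sub>L \<phi> (f' k)) > \<epsilon> / 2"
      by (simp_all add: P_def f_def f'_def lo_def hi_def)
  qed
  have "hi k \<le> lo (Suc k)" "lo k \<le> lo (Suc k)" for k
    by (auto simp: hi_def lo_def \<rho>_Suc)
  then have hi_lo: "hi k \<le> lo n" if "k < n" for k n
    using lift_Suc_mono_le[of lo "Suc k" n] that by (meson Suc_leI order_trans)
  define A where "A = (\<lambda>k. {x. f k x \<noteq> 0})"
  \<comment> \<open>Width and slope are matched: the bump reaches exactly as far as the pair is
    separated, so it misses f' k, and its slope 1 / (k + 1) tends to 0.\<close>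
  define h where "h = (\<lambda>k. bump (real k + 1) (real k + 1) (A k))"
  have h_nonzero: "\<exists>a\<in>A k. dist x a < real k + 1" "lo k < dist x z" "dist x z < hi k" if "h k x \<noteq> 0" for k x
  proof -
    have "real k + 1 > 0" by simp
    from bump_nonzeroE[OF this that[unfolded h_def]]
    obtain a where a: "a \<in> A k" "dist x a < real k + 1" .
    then show "\<exists>a\<in>A k. dist x a < real k + 1" by blast
    have "lo k + (real k + 1) < dist a z \<and> dist a z < hi k - (real k + 1)"
      using f(3) a(1) by (simp add: A_def)
    then show "lo k < dist x z" "dist x z < hi k"
      using a(2) dist_triangle[of a z x] dist_triangle[of x z a] by (auto simp: dist_commute)
  qed
  \<comment> \<open>The annuli are disjoint, so at each point the supremum is the sum. As a supremum
    it inherits Lipschitz estimates termwise; outside the ball of radius \<open>lo n\<close> only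
    the bumps from n on contribute, with slope at most 1 / (n + 1), which is the Higson
    condition.\<close>
  define G where "G = (\<lambda>x. SUP k. h k x)"
  have h01: "0 \<le> h k x \<and> h k x \<le> 1" for k x
    unfolding h_def by (rule bump_bounds)
  have hG: "h k x \<le> G x" for k x
    unfolding G_def using h01 by (intro cSUP_upper) (auto simp: bdd_above_def)
  have G01: "0 \<le> G x \<and> G x \<le> 1" for x
  proof
    show "0 \<le> G x" using hG[of 0 x] h01[of 0 x] by linarith
    show "G x \<le> 1" using h01 by (auto simp: G_def intro!: cSUP_least)
  qed
  have h_lip: "\<bar>h k x - h k y\<bar> \<le> dist x y / (real k + 1)" for k x y
    unfolding h_def by (rule bump_lipschitz) simp
  have "continuous_on UNIV G"
  proof (rule lipschitz_on_continuous_on)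
    show "1-lipschitz_on UNIV G"
    proof (rule lipschitz_onI)
      fix x y :: 'x
      have "\<bar>h k x - h k y\<bar> \<le> dist x y" for k
      proof -
        have "dist x y / (real k + 1) \<le> dist x y / 1"
          by (rule divide_left_mono) auto
        then show ?thesis using h_lip[of k x y] by simp
      qed
      then show "dist (G x) (G y) \<le> 1 * dist x y"
        unfolding G_def dist_real_def using h01 by (simp add: SUP_diff_le)
    qed simp
  qed
  define g where "g = bc_of_real G"
  have g: "g x = complex_of_real (G x)" for x
    unfolding g_def using \<open>continuous_on UNIV G\<close> G01 by (rule bc_of_real_unit)
  have "g \<in> higson_functions"
    unfolding higson_functions_def
  proof safe
    fix R \<epsilon>' :: real assume "R > 0" "\<epsilon>' > 0"
    obtain n :: nat where n: "R / \<epsilon>' < n"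
      using reals_Archimedean2 by blast
    have "cmod (g x - g y) < \<epsilon>'" if xy: "x \<notin> cball z (lo n)" "y \<notin> cball z (lo n)" "dist x y < R" for x y
    proof -
      have "\<bar>h k x - h k y\<bar> \<le> R / (real n + 1)" for k
      proof (cases "k < n")
        case True
        then have "h k x = 0" "h k y = 0"
          using h_nonzero(3)[of k x] h_nonzero(3)[of k y] hi_lo[OF True] xy(1,2) by (force simp: dist_commute)+
        then show ?thesis using \<open>R > 0\<close> by simp
      next
        case False
        then have "dist x y / (real k + 1) \<le> R / (real n + 1)"
          using xy(3) \<open>R > 0\<close> by (intro frac_le) auto
        then show ?thesis using h_lip[of k x y] by linarith
      qed
      then have "\<bar>G x - G y\<bar> \<le> R / (real n + 1)"
        unfolding G_def using h01 by (intro SUP_diff_le) auto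
      also have "\<dots> < \<epsilon>'"
        using n \<open>\<epsilon>' > 0\<close> by (simp add: field_simps)
      finally show ?thesis by (simp add: g of_real_diff[symmetric] del: of_real_diff)
    qed
    then show "\<exists>A. compact A \<and> (\<forall>x y. x \<notin> A \<longrightarrow> y \<notin> A \<longrightarrow> dist x y < R \<longrightarrow> cmod (g x - g y) < \<epsilon>')"
      by (intro exI[of _ "cball z (lo n)"] conjI compact_cball allI impI)
  qed
  then have "commutator b (\<phi> g) \<in> compact_ideal \<phi> B"
    by (rule H)
  have "\<epsilon> / 2 > 0" using \<epsilon> by simp
  have "eventually (\<lambda>r. norm (\<phi> (cocutoff z r) o\<^sub>L commutator b (\<phi> g)) < \<epsilon> / 2 \<and> r > 0) at_top"
    using compact_ideal_cocutoff_small[OF \<open>commutator b (\<phi> g) \<in> _\<close> \<open>\<epsilon> / 2 > 0\<close>, of z] eventually_gt_at_top[of 0]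
    by eventually_elim auto
  then obtain r where r: "norm (\<phi> (cocutoff z r) o\<^sub>L commutator b (\<phi> g)) < \<epsilon> / 2" "r > 0"
    using eventually_happens[of _ "at_top :: real filter"] by force
  \<comment> \<open>Pair n lies beyond radius 2r, where the cocutoff is 1. Inserting the cocutoff
    next to f n brings in the decay of the commutator and contradicts the lower bound \<epsilon> /
    2.\<close>
  obtain n :: nat where n: "2 * r < n"
    using reals_Archimedean2 by blast
  have g1: "g x = 1" if "f n x \<noteq> 0" for x
  proof -
    have "h n x = 1"
      unfolding h_def using that by (intro bump_eq_1) (auto simp: A_def)
    then show ?thesis using hG[of n x] G01[of x] by (simp add: g)
  qed
  have g0: "f' n x = 0 \<or> g x = 0" for x
  proof (rule disjCI)
    assume "g x \<noteq> 0"
    have "\<exists>k. h k x \<noteq> 0"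
    proof (rule ccontr)
      assume "\<not> (\<exists>k. h k x \<noteq> 0)"
      then show False using \<open>g x \<noteq> 0\<close> by (simp add: g G_def)
    qed
    then obtain k where k: "h k x \<noteq> 0" by blast
    show "f' n x = 0"
    proof (rule ccontr)
      assume nz: "f' n x \<noteq> 0"
      note range = f(4)[OF nz] h_nonzero(2,3)[OF k]
      have "\<not> k < n" "\<not> n < k"
        using range hi_lo[of k n] hi_lo[of n k] by auto
      then have "k = n" by simp
      then obtain a where "f n a \<noteq> 0" "dist x a < real n + 1"
        using h_nonzero(1)[OF k] by (auto simp: A_def)
      then show False
        using apartD[OF f(5) csupp_memI csupp_memI[OF nz], of a] by (simp add: dist_commute)
    qed
  qed
  have "cocutoff z r x = 1" if "f n x \<noteq> 0" for x
  proof -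
    have "dist x z \<ge> 2 * r"
      using f(3)[OF that] n \<rho>_ge[of n] by (simp add: lo_def)
    then have "cutoff z r x = 0"
      using cutoff_nonzero[OF r(2), of z x] by force
    then show ?thesis by (simp add: cocutoff_def)
  qed
  then have "\<phi> (f n) o\<^sub>L \<phi> (cocutoff z r) = \<phi> (f n)"
    by (rule phi_absorb)
  then have "\<phi> (f n) o\<^sub>L b o\<^sub>L \<phi> (f' n) = - (\<phi> (f n) o\<^sub>L (\<phi> (cocutoff z r) o\<^sub>L commutator b (\<phi> g)) o\<^sub>L \<phi> (f' n))"
    using separate_product_commutator[OF g1 g0, where b = b] by (simp add: blinfun_compose_assoc[symmetric])
  then have "norm (\<phi> (f n) o\<^sub>L b o\<^sub>L \<phi> (f' n)) \<le> norm (\<phi> (cocutoff z r) o\<^sub>L commutator b (\<phi> g))"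
    using norm_phi_cutdown_le[OF f(1,2)] by simp
  then show False
    using f(6)[of n] r(1) by linarith
qed

text \<open>A very Lipschitz sequence eventually varies by at most \<eta> / 2 over distance R.
  Conversely, a pair separated by more than n + 1 is separated by a bump of slope 1 / (n + 1), and
  these bumps form a very Lipschitz sequence; the pairs may stay in place, as different n need not
  be combined into one function.\<close>

lemma quasi_local_iff_very_lipschitz:
  assumes b: "b \<in> bounded_ops"
  shows "(\<forall>f\<in>very_lipschitz. (\<lambda>n. norm (commutator b (\<phi> (f n)))) \<longlonglongrightarrow> 0) \<longleftrightarrow> quasi_local \<phi> b"
proof safe
  fix f :: "nat \<Rightarrow> 'x \<Rightarrow>\<^sub>C complex"
  assume ql: "quasi_local \<phi> b" and f: "f \<in> very_lipschitz"
  obtain M where M: "M > 0" "\<And>n. norm (f n) \<le> M"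
    using f unfolding very_lipschitz_def bounded_pos by auto
  show "(\<lambda>n. norm (commutator b (\<phi> (f n)))) \<longlonglongrightarrow> 0"
    unfolding tendsto_iff
  proof (intro allI impI)
    fix e :: real assume "e > 0"
    then have "e / 2 > 0" by simp
    then obtain R \<eta> where R: "R > 0" "\<eta> > 0" and
      small: "\<And>f. norm f \<le> M \<Longrightarrow> (\<And>x y. dist x y \<le> R \<Longrightarrow> cmod (apply_bcontfun f x - apply_bcontfun f y) < \<eta>) \<Longrightarrow>
        norm (commutator b (\<phi> f)) \<le> e / 2"
      using quasi_local_commutator[OF ql b _ M(1)] by metis
    define L where "L = \<eta> / (2 * R)"
    have "L > 0" using R by (simp add: L_def)
    then obtain n0 where n0: "\<And>n. n \<ge> n0 \<Longrightarrow> L-lipschitz_on UNIV (apply_bcontfun (f n))"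
      using f unfolding very_lipschitz_def by blast
    show "eventually (\<lambda>n. dist (norm (commutator b (\<phi> (f n)))) 0 < e) sequentially"
      using eventually_ge_at_top[of n0]
    proof eventually_elim
      case (elim n)
      have "norm (commutator b (\<phi> (f n))) \<le> e / 2"
      proof (rule small[OF M(2)])
        fix x y :: 'x assume "dist x y \<le> R"
        then have "L * dist x y \<le> L * R" using \<open>L > 0\<close> by simp
        also have "\<dots> < \<eta>" using R by (simp add: L_def)
        finally show "cmod (f n x - f n y) < \<eta>"
          using lipschitz_onD[OF n0[OF elim], of x y] by (simp add: dist_norm)
      qed
      then show ?case using \<open>e > 0\<close> by simp
    qed
  qed
next
  assume VL: "\<forall>f\<in>very_lipschitz. (\<lambda>n. norm (commutator b (\<phi> (f n)))) \<longlonglongrightarrow> 0"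
  show "quasi_local \<phi> b"
  proof (rule ccontr)
    assume "\<not> quasi_local \<phi> b"
    then obtain \<epsilon> where \<epsilon>: "\<epsilon> > 0" "\<And>R. R \<ge> 0 \<Longrightarrow> \<not> eps_propagation_le \<phi> \<epsilon> R b"
      by (auto simp: quasi_local_def)
    have "\<exists>f f'. norm f \<le> 1 \<and> norm f' \<le> 1 \<and> apart (real n + 1) (csupp f) (csupp f') \<and> \<epsilon> \<le> norm (\<phi> f o\<^sub>L b o\<^sub>L \<phi> f')" for n
      using \<epsilon>(2)[of "real n + 1"] by (auto simp: eps_propagation_le_def not_less)
    then obtain f f' where f: "\<And>n. norm (f n) \<le> 1" "\<And>n. norm (f' n) \<le> 1"
      "\<And>n. apart (real n + 1) (csupp (f n)) (csupp (f' n))" "\<And>n. \<epsilon> \<le> norm (\<phi> (f n) o\<^sub>L b o\<^sub>L \<phi> (f' n))"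
      by metis
    define g where "g = (\<lambda>n. bc_of_real (bump (real n + 1) (real n + 1) {x. f n x \<noteq> 0}))"
    have g: "g n x = complex_of_real (bump (real n + 1) (real n + 1) {x. f n x \<noteq> 0} x)" for n x
      unfolding g_def by (rule bc_bump_apply) simp
    have "g \<in> very_lipschitz"
      unfolding very_lipschitz_def
    proof (intro CollectI conjI allI impI)
      show "bounded (range g)"
        unfolding bounded_iff g_def by (auto intro!: exI[of _ 1] norm_bc_bump)
      fix L :: real assume "L > 0"
      obtain n0 :: nat where n0: "1 / L < n0"
        using reals_Archimedean2 by blast
      have "L-lipschitz_on UNIV (apply_bcontfun (g n))" if "n \<ge> n0" for n
      proof (rule lipschitz_onI)
        fix x y :: 'x
        have "1 / L < real n + 1" using n0 that by linarith
        then have "1 / (real n + 1) \<le> L" using \<open>L > 0\<close> by (simp add: field_simps)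
        then have "dist x y / (real n + 1) \<le> L * dist x y"
          using mult_right_mono[of "1 / (real n + 1)" L "dist x y"] by simp
        then show "dist (g n x) (g n y) \<le> L * dist x y"
          using bump_lipschitz[of "real n + 1" "real n + 1" "{x. f n x \<noteq> 0}" x y]
          by (simp add: g dist_of_real dist_real_def)
      qed (use \<open>L > 0\<close> in simp)
      then show "\<exists>n\<^sub>0. \<forall>n\<ge>n\<^sub>0. L-lipschitz_on UNIV (apply_bcontfun (g n))" by blast
    qed
    then have "(\<lambda>n. norm (commutator b (\<phi> (g n)))) \<longlonglongrightarrow> 0"
      using VL by blast
    then have "eventually (\<lambda>n. norm (commutator b (\<phi> (g n))) < \<epsilon>) sequentially"
      using \<epsilon>(1) by (rule order_tendstoD(2))
    then obtain n where n: "norm (commutator b (\<phi> (g n))) < \<epsilon>"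
      using eventually_happens[of _ sequentially] by auto
    have "g n x = 1" if "f n x \<noteq> 0" for x
      using that by (simp add: g) (intro bump_eq_1, auto)
    moreover have "f' n x = 0 \<or> g n x = 0" for x
    proof (rule ccontr)
      assume "\<not> (f' n x = 0 \<or> g n x = 0)"
      then have nz: "f' n x \<noteq> 0" "bump (real n + 1) (real n + 1) {x. f n x \<noteq> 0} x \<noteq> 0"
        by (auto simp: g)
      have "real n + 1 > 0" by simp
      then obtain a where "f n a \<noteq> 0" "dist x a < real n + 1"
        using bump_nonzeroE[OF _ nz(2)] by blast
      then show False
        using apartD[OF f(3) csupp_memI csupp_memI[OF nz(1)], of a] by (simp add: dist_commute)
    qed
    ultimately have "\<phi> (f n) o\<^sub>L b o\<^sub>L \<phi> (f' n) = - (\<phi> (f n) o\<^sub>L commutator b (\<phi> (g n)) o\<^sub>L \<phi> (f' n))"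
      by (rule separate_product_commutator)
    then have "norm (\<phi> (f n) o\<^sub>L b o\<^sub>L \<phi> (f' n)) \<le> norm (commutator b (\<phi> (g n)))"
      using norm_phi_cutdown_le[OF f(1,2)] by simp
    then show False
      using f(4)[of n] n by linarith
  qed
qed

text \<open>The quotient is partial: \<open>asymp_eq\<close> is reflexive only on bounded sequences
  of complex-linear operators, so each representative has to be shown to lie in its domain before
  classes can be computed.\<close>

lemma vl_infty_commutant_iff:
  assumes b: "b \<in> bounded_ops"
  shows "(\<forall>f\<in>vl_infty \<phi>. const_infty b * f - f * const_infty b = 0) \<longleftrightarrow>
    (\<forall>f\<in>very_lipschitz. (\<lambda>n. norm (commutator b (\<phi> (f n)))) \<longlonglongrightarrow> 0)"
proof -
  have "const_infty b * abs_ops_infty (\<lambda>n. \<phi> (f n)) - abs_ops_infty (\<lambda>n. \<phi> (f n)) * const_infty b = 0 \<longleftrightarrow>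
      (\<lambda>n. norm (commutator b (\<phi> (f n)))) \<longlonglongrightarrow> 0" if f: "f \<in> very_lipschitz" for f
  proof -
    obtain M where M: "\<And>n. norm (f n) \<le> M"
      using f unfolding very_lipschitz_def bounded_iff by auto
    have r1: "asymp_eq (\<lambda>_. b) (\<lambda>_. b)"
      using b by (auto simp: asymp_eq_def)
    have r2: "asymp_eq (\<lambda>n. \<phi> (f n)) (\<lambda>n. \<phi> (f n))"
      using in_bounded_ops norm_phi_le[OF M] by (auto simp: asymp_eq_def bounded_iff)
    have r3: "asymp_eq (\<lambda>n. b o\<^sub>L \<phi> (f n)) (\<lambda>n. b o\<^sub>L \<phi> (f n))" "asymp_eq (\<lambda>n. \<phi> (f n) o\<^sub>L b) (\<lambda>n. \<phi> (f n) o\<^sub>L b)"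
      using times_ops_infty.rsp r1 r2 by (auto simp: rel_fun_def)
    have r4: "asymp_eq (\<lambda>n. commutator b (\<phi> (f n))) (\<lambda>n. commutator b (\<phi> (f n)))"
      using minus_ops_infty.rsp r3 by (auto simp: rel_fun_def commutator_def)
    have "const_infty b * abs_ops_infty (\<lambda>n. \<phi> (f n)) - abs_ops_infty (\<lambda>n. \<phi> (f n)) * const_infty b =
        abs_ops_infty (\<lambda>n. commutator b (\<phi> (f n)))"
      unfolding const_infty_def commutator_def
      by (simp add: times_ops_infty.abs_eq r1 r2 minus_ops_infty.abs_eq r3)
    also have "\<dots> = 0 \<longleftrightarrow> asymp_eq (\<lambda>n. commutator b (\<phi> (f n))) (\<lambda>_. 0)"
      unfolding zero_ops_infty_def
      using Quotient_rel[OF Quotient_ops_infty] r4 zero_ops_infty.rsp by (auto simp: zero_ops_infty_def)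
    also have "\<dots> \<longleftrightarrow> (\<lambda>n. norm (commutator b (\<phi> (f n)))) \<longlonglongrightarrow> 0"
      using r4 zero_ops_infty.rsp by (auto simp: asymp_eq_def)
    finally show ?thesis .
  qed
  then show ?thesis
    unfolding vl_infty_def by blast
qed

end

section \<open>Block sums\<close>

lemma summable_on_if_small_tails:
  fixes f :: "'a \<Rightarrow> 'b::banach"
  assumes "\<And>e. e > 0 \<Longrightarrow> \<exists>P. finite P \<and> P \<subseteq> A \<and> (\<forall>F. finite F \<and> F \<subseteq> A - P \<longrightarrow> norm (sum f F) < e)"
  shows "f summable_on A"
proof -
  have "cauchy_filter (filtermap (sum f) (finite_subsets_at_top A))"
    unfolding cauchy_filter_metric_filtermap
  proof (intro allI impI)
    fix e :: real assume "e > 0"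
    then obtain P where P: "finite P" "P \<subseteq> A" "\<And>F. finite F \<Longrightarrow> F \<subseteq> A - P \<Longrightarrow> norm (sum f F) < e / 2"
      using assms[of "e / 2"] by auto
    have d: "norm (sum f F - sum f P) < e / 2" if "finite F" "P \<subseteq> F" "F \<subseteq> A" for F
      using P(3)[of "F - P"] that by (simp add: sum_diff P(1)) blast
    have ev: "eventually (\<lambda>F. finite F \<and> P \<subseteq> F \<and> F \<subseteq> A) (finite_subsets_at_top A)"
      unfolding eventually_finite_subsets_at_top using P(1,2) by blast
    have "dist (sum f F) (sum f F') < e"
      if "finite F \<and> P \<subseteq> F \<and> F \<subseteq> A" "finite F' \<and> P \<subseteq> F' \<and> F' \<subseteq> A" for F F'
      using dist_triangle_half_l[of "sum f F" "sum f P" e "sum f F'"] d[of F] d[of F'] that by (simp add: dist_norm)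
    then show "\<exists>Q. eventually Q (finite_subsets_at_top A) \<and> (\<forall>x y. Q x \<and> Q y \<longrightarrow> dist (sum f x) (sum f y) < e)"
      by (intro exI[of _ "\<lambda>F. finite F \<and> P \<subseteq> F \<and> F \<subseteq> A"] conjI ev allI impI) simp
  qed
  moreover have "complete (UNIV :: 'b set)"
    by (meson Cauchy_convergent UNIV_I complete_def convergent_def)
  ultimately obtain L where "(sum f \<longlongrightarrow> L) (finite_subsets_at_top A)"
    using complete_uniform[where S = UNIV] by (force simp add: filterlim_def)
  then show ?thesis
    using summable_on_def has_sum_def by blast
qed

section \<open>Sign averages and strongly convergent block sums\<close>

definition set_sign :: "'i set \<Rightarrow> 'i \<Rightarrow> real" where
  "set_sign S i = (if i \<in> S then 1 else - 1)"

text \<open>Orthogonality of random signs: toggling membership of i permutes the subsets and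
  reverses the sign of the product when i and j differ.\<close>

lemma sum_set_sign_mult:
  assumes "finite F" "i \<in> F" "j \<in> F"
  shows "(\<Sum>S\<in>Pow F. set_sign S i * set_sign S j) = (if i = j then 2 ^ card F else 0)"
proof (cases "i = j")
  case True
  then have "(\<Sum>S\<in>Pow F. set_sign S i * set_sign S j) = (\<Sum>S\<in>Pow F. 1)"
    by (intro sum.cong) (auto simp: set_sign_def)
  then show ?thesis
    using assms True by (simp add: card_Pow)
next
  case False
  let ?flip = "\<lambda>S. if i \<in> S then S - {i} else insert i S"
  have "(\<Sum>S\<in>Pow F. set_sign S i * set_sign S j) = (\<Sum>S\<in>Pow F. - (set_sign S i * set_sign S j))"
    by (rule sum.reindex_bij_witness[of _ ?flip ?flip]) (use assms False in \<open>auto simp: set_sign_def\<close>)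
  then show ?thesis
    using False by (simp add: sum_negf)
qed

text \<open>Composition is not jointly continuous for the strong topology, but it is on bounded
  nets; this is needed for limits of P b P.\<close>

lemma bounded_strong_limit_apply:
  fixes T :: "'i \<Rightarrow> 'a::real_normed_vector \<Rightarrow>\<^sub>L 'b::real_normed_vector"
  assumes T: "\<And>y. ((\<lambda>i. T i y) \<longlongrightarrow> T' y) F" and le: "\<And>i. norm (T i) \<le> C" and v: "(v \<longlongrightarrow> v') F"
  shows "((\<lambda>i. T i (v i)) \<longlongrightarrow> T' v') F"
proof -
  have "((\<lambda>i. v i - v') \<longlongrightarrow> 0) F"
    using tendsto_diff[OF v tendsto_const[of v']] by simp
  then have "((\<lambda>i. T i (v i - v')) \<longlongrightarrow> 0) F"
  proof (rule tendsto_0_le[where K = "\<bar>C\<bar>"])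
    have "norm (T i y) \<le> norm y * \<bar>C\<bar>" for i y
      using order_trans[OF norm_blinfun mult_right_mono[of "norm (T i)" "\<bar>C\<bar>" "norm y"]] le[of i]
      by (simp add: mult.commute)
    then show "eventually (\<lambda>i. norm (T i (v i - v')) \<le> norm (v i - v') * \<bar>C\<bar>) F"
      by simp
  qed
  from tendsto_add[OF this T[of v']] show ?thesis
    by (simp add: blinfun.diff_right)
qed

definition unit_fun :: "('x::topological_space \<Rightarrow>\<^sub>C complex) \<Rightarrow> bool" where
  "unit_fun f \<longleftrightarrow> (\<forall>x. f x \<in> \<real> \<and> 0 \<le> Re (f x) \<and> Re (f x) \<le> 1)"

lemma unit_fun_real: "unit_fun f \<Longrightarrow> apply_bcontfun f x \<in> \<real>"
  by (simp add: unit_fun_def)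

lemma norm_unit_fun: "unit_fun f \<Longrightarrow> norm f \<le> 1"
  by (rule norm_bound) (auto simp: unit_fun_def in_Reals_norm complex_is_Real_iff cmod_def)

lemma unit_fun_mult: "unit_fun f \<Longrightarrow> unit_fun g \<Longrightarrow> unit_fun (bc_mult f g)"
  by (auto simp: unit_fun_def complex_is_Real_iff intro: mult_le_one)

lemma unit_fun_of_real:
  assumes "continuous_on UNIV h" "\<And>x. 0 \<le> h x \<and> h x \<le> 1"
  shows "unit_fun (bc_of_real h)"
  using assms by (simp add: unit_fun_def bc_of_real_unit)

text \<open>Disjointness is asked of the nonvanishing sets instead of the closed supports; this
  already gives orthogonal ranges.\<close>

definition disjoint_units :: "'i set \<Rightarrow> ('i \<Rightarrow> 'x::topological_space \<Rightarrow>\<^sub>C complex) \<Rightarrow> bool" where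
  "disjoint_units J e \<longleftrightarrow> (\<forall>i\<in>J. unit_fun (e i)) \<and>
     (\<forall>i\<in>J. \<forall>j\<in>J. i \<noteq> j \<longrightarrow> (\<forall>x. e i x = 0 \<or> e j x = 0))"

lemma disjoint_unitsD:
  assumes "disjoint_units J e"
  shows "i \<in> J \<Longrightarrow> unit_fun (e i)" "i \<in> J \<Longrightarrow> j \<in> J \<Longrightarrow> i \<noteq> j \<Longrightarrow> e i x = 0 \<or> e j x = 0"
  using assms unfolding disjoint_units_def by blast+

context x_module
begin

lemma sum_norm_units_sq_le:
  assumes "disjoint_units J e" "A \<subseteq> J"
  shows "(\<Sum>i\<in>A. (norm (\<phi> (e i) x))\<^sup>2) \<le> (norm x)\<^sup>2"
  by (rule sum_norm_phi_sq_le)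
    (use disjoint_unitsD[OF assms(1)] assms(2) norm_unit_fun in \<open>blast+\<close>)

text \<open>The form bound says that \<open>v j\<close> is of the shape \<open>e j T (e j) x\<close> with \<open>\<parallel>T\<parallel> \<le> C\<close>.\<close>

lemma block_sum:
  assumes J: "disjoint_units J e" and "C \<ge> 0"
    and form: "\<And>j y. j \<in> J \<Longrightarrow> inner (v j) y \<le> C * norm (\<phi> (e j) x) * norm (\<phi> (e j) y)"
  shows "v summable_on J" "norm (infsum v J) \<le> C * norm x"
proof -
  have fin: "(norm (sum v A))\<^sup>2 \<le> C\<^sup>2 * (\<Sum>j\<in>A. (norm (\<phi> (e j) x))\<^sup>2)" if "A \<subseteq> J" for A
  proof -
    have "(norm (sum v A))\<^sup>2 \<le> (\<Sum>j\<in>A. (C * norm (\<phi> (e j) x))\<^sup>2)"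
      using that by (intro norm_sum_sq_le_of_form_bound[where N = "\<lambda>j y. norm (\<phi> (e j) y)"] form sum_norm_units_sq_le[OF J]) auto
    then show ?thesis
      by (simp add: power_mult_distrib sum_distrib_left)
  qed
  let ?a = "\<lambda>j. (norm (\<phi> (e j) x))\<^sup>2"
  \<comment> \<open>Bessel's inequality bounds this scalar series by ||x||^2; by \<open>fin\<close>,
    C^2 times its tails dominates the tails of the vector series.\<close>
  have "?a summable_on J"
  proof (rule nonneg_bdd_above_summable_on)
    show "bdd_above (sum ?a ` {F. F \<subseteq> J \<and> finite F})"
      using sum_norm_units_sq_le[OF J] by (intro bdd_aboveI[where M = "(norm x)\<^sup>2"]) blast
  qed simp
  then have a: "((sum ?a) \<longlongrightarrow> infsum ?a J) (finite_subsets_at_top J)"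
    using has_sum_infsum unfolding has_sum_def by blast
  show "v summable_on J"
  proof (rule summable_on_if_small_tails)
    fix \<epsilon> :: real assume "\<epsilon> > 0"
    define d where "d = \<epsilon>\<^sup>2 / (2 * (C\<^sup>2 + 1))"
    have "d > 0" using \<open>\<epsilon> > 0\<close> by (simp add: d_def add_nonneg_pos)
    from tendstoD[OF a \<open>d > 0\<close>, unfolded eventually_finite_subsets_at_top]
    obtain P where "finite P \<and> P \<subseteq> J \<and> (\<forall>F. finite F \<and> P \<subseteq> F \<and> F \<subseteq> J \<longrightarrow> dist (sum ?a F) (infsum ?a J) < d)"
      by (rule exE)
    then have P: "finite P" "P \<subseteq> J" "\<And>F. finite F \<Longrightarrow> P \<subseteq> F \<Longrightarrow> F \<subseteq> J \<Longrightarrow> dist (sum ?a F) (infsum ?a J) < d"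
      by simp_all
    have "norm (sum v F) < \<epsilon>" if F: "finite F" "F \<subseteq> J - P" for F
    proof -
      have "sum ?a (F \<union> P) = sum ?a F + sum ?a P"
        using F P by (intro sum.union_disjoint) auto
      moreover have "dist (sum ?a (F \<union> P)) (infsum ?a J) < d" "dist (sum ?a P) (infsum ?a J) < d"
        using F P by (auto intro!: P(3))
      ultimately have "sum ?a F < 2 * d"
        by (auto simp: dist_real_def)
      have "(norm (sum v F))\<^sup>2 \<le> C\<^sup>2 * sum ?a F"
        using F by (intro fin) auto
      also have "\<dots> \<le> C\<^sup>2 * (2 * d)"
        using \<open>sum ?a F < 2 * d\<close> by (intro mult_left_mono) auto
      also have "\<dots> < (C\<^sup>2 + 1) * (2 * d)"
        using \<open>d > 0\<close> by simp
      also have "\<dots> = \<epsilon>\<^sup>2"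
      proof -
        have "2 * C\<^sup>2 + 2 \<noteq> 0" by (simp add: add_nonneg_eq_0_iff)
        then show ?thesis by (simp add: d_def field_simps)
      qed
      finally show ?thesis
        using \<open>\<epsilon> > 0\<close> by (simp add: power2_less_imp_less)
    qed
    then show "\<exists>P. finite P \<and> P \<subseteq> J \<and> (\<forall>F. finite F \<and> F \<subseteq> J - P \<longrightarrow> norm (sum v F) < \<epsilon>)"
      using P by blast
  qed
  then have lim: "((sum v) \<longlongrightarrow> infsum v J) (finite_subsets_at_top J)"
    using has_sum_infsum unfolding has_sum_def by blast
  have "norm (sum v A) \<le> C * norm x" if "A \<subseteq> J" for A
  proof -
    have "(norm (sum v A))\<^sup>2 \<le> (C * norm x)\<^sup>2"
      using fin[OF that] mult_left_mono[OF sum_norm_units_sq_le[OF J that, of x], of "C\<^sup>2"]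
      by (simp add: power_mult_distrib)
    then show ?thesis
      by (rule power2_le_imp_le) (use \<open>C \<ge> 0\<close> in simp)
  qed
  then have "eventually (\<lambda>A. norm (sum v A) \<le> C * norm x) (finite_subsets_at_top J)"
    by (intro eventually_finite_subsets_at_top_weakI)
  then show "norm (infsum v J) \<le> C * norm x"
    by (rule tendsto_upperbound[OF tendsto_norm[OF lim] _ finite_subsets_at_top_neq_bot])
qed

lemma block_form_bound:
  assumes "unit_fun e"
  shows "inner (\<phi> e (blinfun_apply T (\<phi> e x))) y \<le> norm T * norm (\<phi> e x) * norm (\<phi> e y)"
proof -
  have "inner (\<phi> e (T (\<phi> e x))) y = inner (T (\<phi> e x)) (\<phi> e y)"
    by (rule inner_phi_real[OF unit_fun_real[OF assms]])
  also have "\<dots> \<le> norm (T (\<phi> e x)) * norm (\<phi> e y)"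
    by (rule norm_cauchy_schwarz)
  also have "\<dots> \<le> norm T * norm (\<phi> e x) * norm (\<phi> e y)"
    by (intro mult_right_mono norm_blinfun) simp
  finally show ?thesis .
qed

lemma block_summable:
  assumes "disjoint_units J e"
  shows "(\<lambda>j. \<phi> (e j) (blinfun_apply a (\<phi> (e j) x))) summable_on J"
    and "norm (\<Sum>\<^sub>\<infinity>j\<in>J. \<phi> (e j) (blinfun_apply a (\<phi> (e j) x))) \<le> norm a * norm x"
  using block_sum[OF assms norm_ge_zero block_form_bound[OF disjoint_unitsD(1)[OF assms]]] by blast+

text \<open>\<open>Blinfun\<close> yields the intended operator once the pointwise sum is known to
  be bounded and linear, which follows from the uniform bound on block sums.\<close>

lemma block_cutdown_apply:
  assumes J: "disjoint_units J e"
  shows "block_cutdown \<phi> J e a x = (\<Sum>\<^sub>\<infinity>j\<in>J. \<phi> (e j) (blinfun_apply a (\<phi> (e j) x)))"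
proof -
  have "bounded_linear (\<lambda>x. \<Sum>\<^sub>\<infinity>j\<in>J. \<phi> (e j) (blinfun_apply a (\<phi> (e j) x)))"
  proof (rule bounded_linear_intro[where K = "norm a"])
    fix x y :: 'h and r :: real
    show "(\<Sum>\<^sub>\<infinity>j\<in>J. \<phi> (e j) (blinfun_apply a (\<phi> (e j) (x + y)))) =
        (\<Sum>\<^sub>\<infinity>j\<in>J. \<phi> (e j) (blinfun_apply a (\<phi> (e j) x))) + (\<Sum>\<^sub>\<infinity>j\<in>J. \<phi> (e j) (blinfun_apply a (\<phi> (e j) y)))"
      by (simp add: blinfun.add_right infsum_add block_summable(1)[OF J])
    show "(\<Sum>\<^sub>\<infinity>j\<in>J. \<phi> (e j) (blinfun_apply a (\<phi> (e j) (r *\<^sub>R x)))) = r *\<^sub>R (\<Sum>\<^sub>\<infinity>j\<in>J. \<phi> (e j) (blinfun_apply a (\<phi> (e j) x)))"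
      by (simp add: blinfun.scaleR_right infsum_scaleR_right)
    show "norm (\<Sum>\<^sub>\<infinity>j\<in>J. \<phi> (e j) (blinfun_apply a (\<phi> (e j) x))) \<le> norm x * norm a"
      using block_summable(2)[OF J] by (simp add: mult.commute)
  qed
  then show ?thesis
    by (simp add: block_cutdown_def bounded_linear_Blinfun_apply)
qed

text \<open>By local finiteness the partial sums agree with g on a given compact set from some
  finite index set on. The intersection with \<open>J\<close> makes the uniform bound hold for every
  F, including those not contained in \<open>J\<close>.\<close>

lemma units_partial_sums_strong:
  fixes g :: "'x \<Rightarrow>\<^sub>C complex" and e :: "'i \<Rightarrow> 'x \<Rightarrow>\<^sub>C complex"
  assumes J: "disjoint_units J e"
    and locfin: "\<And>A. compact A \<Longrightarrow> finite {j \<in> J. \<exists>x\<in>A. e j x \<noteq> 0}"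
    and g: "\<And>x. (\<And>j. j \<in> J \<Longrightarrow> e j x = 0) \<Longrightarrow> g x = 0" "\<And>j x. j \<in> J \<Longrightarrow> e j x \<noteq> 0 \<Longrightarrow> g x = e j x"
  shows "((\<lambda>F. \<phi> (sum e (F \<inter> J)) x) \<longlongrightarrow> \<phi> g x) (finite_subsets_at_top J)"
proof (rule phi_strong_limit)
  show "cmod (sum e (F \<inter> J) x) \<le> 1" for F x
  proof -
    have "norm (sum e (F \<inter> J)) \<le> 1"
      by (rule norm_sum_disjoint_le) (use disjoint_unitsD[OF J] norm_unit_fun in \<open>blast+\<close>)
    then show ?thesis
      using norm_bounded[of "sum e (F \<inter> J)" x] by linarith
  qed
  fix A :: "'x set" assume "compact A"
  define P where "P = {j \<in> J. \<exists>x\<in>A. e j x \<noteq> 0}"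
  have P: "finite P" "P \<subseteq> J"
    using locfin[OF \<open>compact A\<close>] by (auto simp: P_def)
  have "sum e (F \<inter> J) x = g x" if F: "finite F" "P \<subseteq> F" "F \<subseteq> J" and x: "x \<in> A" for F x
  proof (cases "\<exists>j\<in>J. e j x \<noteq> 0")
    case True
    then obtain j where j: "j \<in> J" "e j x \<noteq> 0" by blast
    then have "j \<in> F" using F x by (auto simp: P_def)
    have "(\<Sum>i\<in>F. e i x) = (\<Sum>i\<in>{j}. e i x)"
      using disjoint_unitsD(2)[OF J _ j(1)] j(2) F \<open>j \<in> F\<close> by (intro sum.mono_neutral_right) auto
    then show ?thesis
      using g(2)[OF j] F by (simp add: Int_absorb2)
  next
    case False
    then show ?thesis
      using g(1)[of x] by simp
  qed
  then show "eventually (\<lambda>F. \<forall>x\<in>A. sum e (F \<inter> J) x = g x) (finite_subsets_at_top J)"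
    using P unfolding eventually_finite_subsets_at_top by blast
qed

text \<open>Off-diagonal terms are removed by averaging \<open>u b u\<close> over the sign functions \<open>u = 2 h\<^sub>S - 1\<close>,
  which commute with \<open>b\<close> up to \<open>2\<delta>\<close>.\<close>

lemma decouple_blocks_finite:
  fixes e q :: "'x \<Rightarrow>\<^sub>C complex" and \<kappa> :: "'i \<Rightarrow> 'x \<Rightarrow>\<^sub>C complex" and h :: "'i set \<Rightarrow> 'x \<Rightarrow>\<^sub>C complex"
  assumes units: "unit_fun e" "unit_fun q" "disjoint_units U \<kappa>"
    and sep: "\<And>x. e x * q x \<noteq> 0 \<Longrightarrow>
      \<exists>Y\<in>U. \<kappa> Y x = 1 \<and> (\<forall>S\<subseteq>U. h S x = (if Y \<in> S then 1 else 0))"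
    and h: "\<And>S. S \<subseteq> U \<Longrightarrow> unit_fun (h S)" "\<And>S. S \<subseteq> U \<Longrightarrow> norm (commutator b (\<phi> (h S))) \<le> \<delta>"
    and F: "finite F" "F \<subseteq> U"
    and p_def: "p = (\<lambda>Y. bc_mult (bc_mult e q) (\<kappa> Y))"
  shows "inner (\<phi> (sum p F) (b (\<phi> (sum p F) x)) - (\<Sum>Y\<in>F. \<phi> (p Y) (b (\<phi> (p Y) x)))) y \<le>
    2 * \<delta> * norm (\<phi> e x) * norm (\<phi> e y)"
proof -
  define u where "u = (\<lambda>S. 2 *\<^sub>R h S - const_bcontfun 1)"
  \<comment> \<open>Factoring P as e w keeps e on both sides of every error term, so that the final
    bound is a form bound in e.\<close>
  define w where "w = bc_mult q (sum \<kappa> F)"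
  define P where "P = sum p F"
  have Pew: "P = bc_mult e w"
    by (rule bcontfun_eqI) (simp add: P_def p_def w_def sum_distrib_left mult.assoc)
  have "norm (sum \<kappa> F) \<le> 1"
    by (rule norm_sum_disjoint_le) (use disjoint_unitsD[OF units(3)] norm_unit_fun F(2) in \<open>blast+\<close>)
  then have w1: "norm w \<le> 1"
    unfolding w_def by (rule norm_bc_mult_le_one[OF norm_unit_fun[OF units(2)]])
  have u1: "norm (u S) \<le> 1" if "S \<subseteq> U" for S
  proof (rule norm_bound)
    fix x
    have "h S x = complex_of_real (Re (h S x))" "0 \<le> Re (h S x)" "Re (h S x) \<le> 1"
      using h(1)[OF that] by (auto simp: unit_fun_def complex_is_Real_iff complex_eq_iff)
    then have "u S x = complex_of_real (2 * Re (h S x) - 1)" "\<bar>2 * Re (h S x) - 1\<bar> \<le> 1"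
      by (auto simp: u_def scaleR_conv_of_real)
    then show "norm (u S x) \<le> 1"
      by (metis norm_of_real)
  qed
  \<comment> \<open>Where p Y does not vanish, the piece provided by \<open>sep\<close> must be Y
    itself, as the \<kappa> are disjoint; there u S is constantly 1 or -1.\<close>
  have pu: "bc_mult (p Y) (u S) = set_sign S Y *\<^sub>R p Y" if "Y \<in> F" "S \<subseteq> F" for Y S
  proof (rule bcontfun_eqI)
    fix x
    show "bc_mult (p Y) (u S) x = (set_sign S Y *\<^sub>R p Y) x"
    proof (cases "p Y x = 0")
      case False
      then have nz: "e x * q x \<noteq> 0" "\<kappa> Y x \<noteq> 0" by (auto simp: p_def)
      then obtain Y' where Y': "Y' \<in> U" "\<kappa> Y' x = 1" "\<forall>S\<subseteq>U. h S x = (if Y' \<in> S then 1 else 0)"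
        using sep by blast
      have "Y' = Y"
        using disjoint_unitsD(2)[OF units(3) Y'(1), of Y x] Y'(2) nz(2) that F by auto
      then have "h S x = (if Y \<in> S then 1 else 0)"
        using Y'(3) that F(2) by (meson order_trans)
      then show ?thesis
        by (simp add: u_def set_sign_def scaleR_conv_of_real)
    qed simp
  qed
  have Pu: "bc_mult P (u S) = (\<Sum>Y\<in>F. set_sign S Y *\<^sub>R p Y)" if "S \<subseteq> F" for S
  proof -
    have "bc_mult P (u S) = (\<Sum>Y\<in>F. bc_mult (p Y) (u S))"
      by (rule bcontfun_eqI) (simp add: P_def sum_distrib_right)
    then show ?thesis
      using pu that by simp
  qed
  have Puu: "bc_mult (bc_mult P (u S)) (u S) = P" if "S \<subseteq> F" for S
  proof -
    have "bc_mult (bc_mult P (u S)) (u S) = (\<Sum>Y\<in>F. set_sign S Y *\<^sub>R bc_mult (p Y) (u S))"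
      unfolding Pu[OF that] by (rule bcontfun_eqI) (simp add: sum_distrib_right)
    also have "\<dots> = P"
      unfolding P_def by (rule sum.cong) (simp_all add: pu that set_sign_def)
    finally show ?thesis .
  qed
  \<comment> \<open>Since u squares to 1 on P, the defect is P (b - u b u) P = - P u [b, u] P, and
    [b, u] = 2 [b, h S] has norm at most 2 \<delta>.\<close>
  define G where "G = (\<lambda>S. \<phi> P (b (\<phi> P x)) - \<phi> P (\<phi> (u S) (b (\<phi> (u S) (\<phi> P x)))))"
  have G_le: "inner (G S) y \<le> 2 * \<delta> * norm (\<phi> e x) * norm (\<phi> e y)" if S: "S \<subseteq> F" for S
  proof -
    define c where "c = commutator b (\<phi> (u S))"
    have "S \<subseteq> U" using S F by blast
    have "c = 2 *\<^sub>R commutator b (\<phi> (h S))"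
      by (rule blinfun_eqI) (simp add: c_def u_def commutator_def phi_diff phi_scaleR phi_one
          blinfun.diff_left blinfun.diff_right blinfun.scaleR_left blinfun.scaleR_right scaleR_diff_right)
    then have c: "norm c \<le> 2 * \<delta>"
      using h(2)[OF \<open>S \<subseteq> U\<close>] by simp
    have "\<phi> P v = \<phi> P (\<phi> (u S) (\<phi> (u S) v))" for v
      using Puu[OF S] by (simp add: phi_mult_apply) (metis phi_mult_apply)
    then have "G S = - \<phi> P (\<phi> (u S) (c (\<phi> P x)))"
      by (simp add: G_def c_def commutator_def blinfun.diff_left blinfun.diff_right)
    also have "\<dots> = \<phi> e ((- (\<phi> w o\<^sub>L (\<phi> (u S) o\<^sub>L c) o\<^sub>L \<phi> w)) (\<phi> e x))"
      unfolding Pew by (simp add: phi_mult blinfun.minus_left blinfun.minus_right) (metis bc_mult_commute phi_mult_apply)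
    finally have "inner (G S) y \<le> norm (- (\<phi> w o\<^sub>L (\<phi> (u S) o\<^sub>L c) o\<^sub>L \<phi> w)) * norm (\<phi> e x) * norm (\<phi> e y)"
      by (simp only: block_form_bound[OF units(1)])
    also have "norm (- (\<phi> w o\<^sub>L (\<phi> (u S) o\<^sub>L c) o\<^sub>L \<phi> w)) \<le> 2 * \<delta>"
      using norm_phi_cutdown_le[OF w1 w1, of "\<phi> (u S) o\<^sub>L c"] norm_compose_phi_le(2)[OF u1[OF \<open>S \<subseteq> U\<close>], of c] c
      by simp
    finally show ?thesis
      by (simp add: mult_right_mono)
  qed
  let ?D = "\<phi> P (b (\<phi> P x)) - (\<Sum>Y\<in>F. \<phi> (p Y) (b (\<phi> (p Y) x)))"
  \<comment> \<open>Summed over all subsets, the cross terms between different pieces cancel and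
    each diagonal term is counted once per subset.\<close>
  have "(\<Sum>S\<in>Pow F. \<phi> P (\<phi> (u S) (b (\<phi> (u S) (\<phi> P x))))) =
      (\<Sum>S\<in>Pow F. \<Sum>i\<in>F. \<Sum>j\<in>F. (set_sign S i * set_sign S j) *\<^sub>R \<phi> (p i) (b (\<phi> (p j) x)))"
  proof (rule sum.cong[OF refl])
    fix S assume "S \<in> Pow F"
    then have Pu': "\<phi> P (\<phi> (u S) v) = (\<Sum>Y\<in>F. set_sign S Y *\<^sub>R \<phi> (p Y) v)" "\<phi> (u S) (\<phi> P v) = (\<Sum>Y\<in>F. set_sign S Y *\<^sub>R \<phi> (p Y) v)" for v
      unfolding phi_mult_apply bc_mult_commute[of "u S"] using Pu[of S]
      by (simp_all add: phi_sum phi_scaleR blinfun.sum_left blinfun.scaleR_left)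
    show "\<phi> P (\<phi> (u S) (b (\<phi> (u S) (\<phi> P x)))) =
        (\<Sum>i\<in>F. \<Sum>j\<in>F. (set_sign S i * set_sign S j) *\<^sub>R \<phi> (p i) (b (\<phi> (p j) x)))"
      unfolding Pu' by (simp add: blinfun.sum_right blinfun.scaleR_right scaleR_sum_right)
  qed
  also have "\<dots> = (\<Sum>i\<in>F. \<Sum>j\<in>F. (\<Sum>S\<in>Pow F. set_sign S i * set_sign S j) *\<^sub>R \<phi> (p i) (b (\<phi> (p j) x)))"
    unfolding scaleR_sum_left by (subst sum.swap) (rule sum.cong[OF refl], rule sum.swap)
  also have "\<dots> = (\<Sum>i\<in>F. \<Sum>j\<in>F. (if i = j then 2 ^ card F else 0) *\<^sub>R \<phi> (p i) (b (\<phi> (p j) x)))"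
    by (intro sum.cong refl) (simp add: sum_set_sign_mult[OF F(1)])
  also have "\<dots> = (\<Sum>i\<in>F. \<Sum>j\<in>F. if i = j then 2 ^ card F *\<^sub>R \<phi> (p i) (b (\<phi> (p j) x)) else 0)"
    by (intro sum.cong refl) simp
  also have "\<dots> = 2 ^ card F *\<^sub>R (\<Sum>i\<in>F. \<phi> (p i) (b (\<phi> (p i) x)))"
    using F(1) by (simp add: scaleR_sum_right)
  finally have "(\<Sum>S\<in>Pow F. G S) = 2 ^ card F *\<^sub>R ?D"
    using F(1) by (simp add: G_def sum_subtractf card_Pow scaleR_diff_right sum_constant_scaleR)
  then have "2 ^ card F * inner ?D y = (\<Sum>S\<in>Pow F. inner (G S) y)"
    by (simp only: inner_sum_left[symmetric] inner_scaleR_left[symmetric])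
  also have "\<dots> \<le> (\<Sum>S\<in>Pow F. 2 * \<delta> * norm (\<phi> e x) * norm (\<phi> e y))"
    by (intro sum_mono G_le) simp
  also have "\<dots> = 2 ^ card F * (2 * \<delta> * norm (\<phi> e x) * norm (\<phi> e y))"
    using F(1) by (simp add: card_Pow)
  finally show ?thesis
    by (simp add: P_def)
qed

text \<open>The averaging needs finitely many signs, but its bound does not depend on how many. Both
  sides converge along finite subfamilies, the compression of b by local finiteness and the block
  sum by orthogonality, and the inequality of forms survives the limit.\<close>

lemma decouple_blocks:
  fixes e q :: "'x \<Rightarrow>\<^sub>C complex" and \<kappa> :: "'i \<Rightarrow> 'x \<Rightarrow>\<^sub>C complex" and h :: "'i set \<Rightarrow> 'x \<Rightarrow>\<^sub>C complex"
  assumes units: "unit_fun e" "unit_fun q" "disjoint_units U \<kappa>"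
    and sep: "\<And>x. e x * q x \<noteq> 0 \<Longrightarrow>
      \<exists>Y\<in>U. \<kappa> Y x = 1 \<and> (\<forall>S\<subseteq>U. h S x = (if Y \<in> S then 1 else 0))"
    and h: "\<And>S. S \<subseteq> U \<Longrightarrow> unit_fun (h S)" "\<And>S. S \<subseteq> U \<Longrightarrow> norm (commutator b (\<phi> (h S))) \<le> \<delta>"
    and locfin: "\<And>A. compact A \<Longrightarrow> finite {Y \<in> U. \<exists>x\<in>A. \<kappa> Y x \<noteq> 0}"
    and p_def: "p = (\<lambda>Y. bc_mult (bc_mult e q) (\<kappa> Y))"
  shows "disjoint_units U p"
    and "inner (\<phi> (bc_mult e q) (b (\<phi> (bc_mult e q) x)) - (\<Sum>\<^sub>\<infinity>Y\<in>U. \<phi> (p Y) (b (\<phi> (p Y) x)))) y \<le>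
      2 * \<delta> * norm (\<phi> e x) * norm (\<phi> e y)"
proof -
  show p: "disjoint_units U p"
    unfolding disjoint_units_def
  proof (intro conjI ballI allI impI)
    fix i assume "i \<in> U"
    then show "unit_fun (p i)"
      unfolding p_def by (intro unit_fun_mult units disjoint_unitsD(1)[OF units(3)])
    fix j x assume "j \<in> U" "i \<noteq> j"
    then show "p i x = 0 \<or> p j x = 0"
      using disjoint_unitsD(2)[OF units(3) \<open>i \<in> U\<close>, of j x] by (auto simp: p_def)
  qed
  let ?F = "finite_subsets_at_top U"
  define P where "P = (\<lambda>F. sum p (F \<inter> U))"
  have lim: "((\<lambda>F. \<phi> (P F) v) \<longlongrightarrow> \<phi> (bc_mult e q) v) ?F" for v
    unfolding P_def
  proof (rule units_partial_sums_strong[OF p])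
    show "finite {Y \<in> U. \<exists>x\<in>A. p Y x \<noteq> 0}" if "compact A" for A
      by (rule finite_subset[OF _ locfin[OF that]]) (auto simp: p_def)
    show "bc_mult e q x = 0" if "\<And>j. j \<in> U \<Longrightarrow> p j x = 0" for x
      using sep[of x] that by (force simp: p_def)
    show "bc_mult e q x = p j x" if "j \<in> U" "p j x \<noteq> 0" for j x
    proof -
      have nz: "e x * q x \<noteq> 0" "\<kappa> j x \<noteq> 0" using that(2) by (auto simp: p_def)
      then obtain Y where "Y \<in> U" "\<kappa> Y x = 1" using sep by blast
      then have "\<kappa> j x = 1"
        using disjoint_unitsD(2)[OF units(3) \<open>j \<in> U\<close>, of Y x] nz(2) by (cases "j = Y") auto
      then show ?thesis by (simp add: p_def)
    qed
  qed
  have P1: "norm (\<phi> (P F)) \<le> 1" for F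
    unfolding P_def
    by (intro norm_phi_le norm_sum_disjoint_le) (use disjoint_unitsD[OF p] norm_unit_fun in \<open>blast+\<close>)
  have lim1: "((\<lambda>F. \<phi> (P F) (b (\<phi> (P F) x))) \<longlongrightarrow> \<phi> (bc_mult e q) (b (\<phi> (bc_mult e q) x))) ?F"
    by (rule bounded_strong_limit_apply[OF lim P1]) (intro blinfun.tendsto tendsto_const lim)
  have lim2: "((\<lambda>F. \<Sum>Y\<in>F. \<phi> (p Y) (b (\<phi> (p Y) x))) \<longlongrightarrow> (\<Sum>\<^sub>\<infinity>Y\<in>U. \<phi> (p Y) (b (\<phi> (p Y) x)))) ?F"
    using has_sum_infsum[OF block_summable(1)[OF p]] unfolding has_sum_def .
  have "eventually (\<lambda>F. inner (\<phi> (P F) (b (\<phi> (P F) x)) - (\<Sum>Y\<in>F. \<phi> (p Y) (b (\<phi> (p Y) x)))) y \<le>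
      2 * \<delta> * norm (\<phi> e x) * norm (\<phi> e y)) ?F"
  proof (rule eventually_finite_subsets_at_top_weakI)
    fix F assume F: "finite F" "F \<subseteq> U"
    then have "P F = sum p F" by (simp add: P_def Int_absorb2)
    then show "inner (\<phi> (P F) (b (\<phi> (P F) x)) - (\<Sum>Y\<in>F. \<phi> (p Y) (b (\<phi> (p Y) x)))) y \<le>
      2 * \<delta> * norm (\<phi> e x) * norm (\<phi> e y)"
      using decouple_blocks_finite[OF units sep h F p_def] by simp
  qed
  then show "inner (\<phi> (bc_mult e q) (b (\<phi> (bc_mult e q) x)) - (\<Sum>\<^sub>\<infinity>Y\<in>U. \<phi> (p Y) (b (\<phi> (p Y) x)))) y \<le>
      2 * \<delta> * norm (\<phi> e x) * norm (\<phi> e y)"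
    by (rule tendsto_upperbound[OF tendsto_inner[OF tendsto_diff[OF lim1 lim2] tendsto_const] _ finite_subsets_at_top_neq_bot])
qed

text \<open>As the squares sum to 1, b minus the two cutdowns equals minus the sum of q [b, q]. A
  cutdown uses its function twice, which is why the squares, and not the functions, form a partition
  of unity.\<close>

lemma split_block_form:
  fixes e q\<^sub>0 q\<^sub>1 :: "'x \<Rightarrow>\<^sub>C complex"
  assumes e: "unit_fun e" and q: "unit_fun q\<^sub>0" "unit_fun q\<^sub>1"
    and sq: "\<And>x. (q\<^sub>0 x)\<^sup>2 + (q\<^sub>1 x)\<^sup>2 = 1"
    and comm: "norm (commutator b (\<phi> q\<^sub>0)) \<le> \<delta>" "norm (commutator b (\<phi> q\<^sub>1)) \<le> \<delta>"
  shows "inner (\<phi> e (b (\<phi> e x)) - \<phi> (bc_mult e q\<^sub>0) (b (\<phi> (bc_mult e q\<^sub>0) x)) - \<phi> (bc_mult e q\<^sub>1) (b (\<phi> (bc_mult e q\<^sub>1) x))) y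
    \<le> 2 * \<delta> * norm (\<phi> e x) * norm (\<phi> e y)"
proof -
  define T where "T = - ((\<phi> q\<^sub>0 o\<^sub>L commutator b (\<phi> q\<^sub>0)) + (\<phi> q\<^sub>1 o\<^sub>L commutator b (\<phi> q\<^sub>1)))"
  have id: "\<phi> q\<^sub>0 (\<phi> q\<^sub>0 v) + \<phi> q\<^sub>1 (\<phi> q\<^sub>1 v) = v" for v
  proof -
    have "bc_mult q\<^sub>0 q\<^sub>0 + bc_mult q\<^sub>1 q\<^sub>1 = const_bcontfun 1"
      using sq by (intro bcontfun_eqI) (simp add: power2_eq_square)
    then have "\<phi> (bc_mult q\<^sub>0 q\<^sub>0) + \<phi> (bc_mult q\<^sub>1 q\<^sub>1) = id_blinfun"
      by (metis phi_add phi_one)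
    then show ?thesis
      by (simp add: phi_mult_apply blinfun.add_left[symmetric])
  qed
  have T: "T v = b v - \<phi> q\<^sub>0 (b (\<phi> q\<^sub>0 v)) - \<phi> q\<^sub>1 (b (\<phi> q\<^sub>1 v))" for v
    using id[of "b v"]
    by (simp add: T_def commutator_def blinfun.minus_left blinfun.add_left blinfun.diff_left blinfun.diff_right algebra_simps)
  have "\<phi> e (b (\<phi> e x)) - \<phi> (bc_mult e q\<^sub>0) (b (\<phi> (bc_mult e q\<^sub>0) x)) - \<phi> (bc_mult e q\<^sub>1) (b (\<phi> (bc_mult e q\<^sub>1) x)) = \<phi> e (T (\<phi> e x))"
  proof -
    have m: "\<phi> (bc_mult e q) v = \<phi> e (\<phi> q v)" "\<phi> (bc_mult e q) v = \<phi> q (\<phi> e v)" for q v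
      by (simp_all only: phi_mult_apply bc_mult_commute)
    have "\<phi> (bc_mult e q) (b (\<phi> (bc_mult e q) x)) = \<phi> e (\<phi> q (b (\<phi> q (\<phi> e x))))" for q
      by (simp only: m(1)[of q "b (\<phi> q (\<phi> e x))"] m(2)[of q x])
    then show ?thesis
      by (simp only: T blinfun.diff_right)
  qed
  then have "inner (\<phi> e (b (\<phi> e x)) - \<phi> (bc_mult e q\<^sub>0) (b (\<phi> (bc_mult e q\<^sub>0) x)) - \<phi> (bc_mult e q\<^sub>1) (b (\<phi> (bc_mult e q\<^sub>1) x))) y
      \<le> norm T * norm (\<phi> e x) * norm (\<phi> e y)"
    using block_form_bound[OF e] by simp
  also have "norm T \<le> 2 * \<delta>"
    using norm_triangle_ineq[of "\<phi> q\<^sub>0 o\<^sub>L commutator b (\<phi> q\<^sub>0)" "\<phi> q\<^sub>1 o\<^sub>L commutator b (\<phi> q\<^sub>1)"] comm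
      norm_compose_phi_le(2)[OF norm_unit_fun[OF q(1)], of "commutator b (\<phi> q\<^sub>0)"]
      norm_compose_phi_le(2)[OF norm_unit_fun[OF q(2)], of "commutator b (\<phi> q\<^sub>1)"]
    unfolding T_def norm_minus_cancel by linarith
  finally show ?thesis
    by (simp add: mult_right_mono)
qed

end

section \<open>Refining blocks along decompositions\<close>

lemma abs_sin_diff_le: "\<bar>sin a - sin b\<bar> \<le> \<bar>a - b\<bar>" for a b :: real
proof -
  have "\<bar>sin ((a - b) / 2) * cos ((a + b) / 2)\<bar> \<le> \<bar>(a - b) / 2\<bar> * 1"
    unfolding abs_mult by (intro mult_mono abs_sin_x_le_abs_x abs_cos_le_one) auto
  then show ?thesis
    by (simp add: sin_diff_sin abs_mult)
qed

lemma abs_cos_diff_le: "\<bar>cos a - cos b\<bar> \<le> \<bar>a - b\<bar>" for a b :: real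
proof -
  have "\<bar>sin (pi / 2 - a) - sin (pi / 2 - b)\<bar> \<le> \<bar>(pi / 2 - a) - (pi / 2 - b)\<bar>"
    by (rule abs_sin_diff_le)
  then show ?thesis
    by (simp add: sin_diff abs_minus_commute)
qed

lemma has_sum_diff:
  fixes f g :: "'a \<Rightarrow> 'b::topological_ab_group_add"
  assumes "(f has_sum a) A" "(g has_sum b) A"
  shows "((\<lambda>x. f x - g x) has_sum (a - b)) A"
  using has_sum_add[OF assms(1), of "\<lambda>x. - g x" "- b"] assms(2) by (simp add: has_sum_uminus)

lemma infdist_lessE:
  assumes "infdist x Z < r" "Z \<noteq> {}"
  obtains a where "a \<in> Z" "dist x a < r"
  using assms by (auto simp: infdist_def cINF_less_iff)

lemma lipschitz_bc_of_real:
  assumes "continuous_on UNIV h" "\<And>x. 0 \<le> h x \<and> h x \<le> 1" "L \<ge> 0"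
    and "\<And>x y. \<bar>h x - h y\<bar> \<le> L * dist x y"
  shows "L-lipschitz_on UNIV (apply_bcontfun (bc_of_real h))"
  using assms by (intro lipschitz_onI) (auto simp: bc_of_real_unit dist_of_real dist_real_def)

lemma unit_fun_bump: "t > 0 \<Longrightarrow> unit_fun (bc_of_real (bump r t Z))"
  by (intro unit_fun_of_real bump_continuous bump_bounds)

lemma lipschitz_bc_bump: "t > 0 \<Longrightarrow> (1 / t)-lipschitz_on UNIV (apply_bcontfun (bc_of_real (bump r t Z)))"
  using bump_lipschitz[of t r Z] by (intro lipschitz_bc_of_real bump_continuous bump_bounds) auto

lemma lipschitz_bc_mult:
  assumes "unit_fun f" "unit_fun g"
    and f: "K-lipschitz_on UNIV (apply_bcontfun f)" and g: "L-lipschitz_on UNIV (apply_bcontfun g)"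
  shows "(K + L)-lipschitz_on UNIV (apply_bcontfun (bc_mult f g))"
proof (rule lipschitz_onI)
  fix x y
  have 1: "cmod (f x) \<le> 1" "cmod (g y) \<le> 1"
    using norm_bounded[of f x] norm_bounded[of g y] norm_unit_fun[OF assms(1)] norm_unit_fun[OF assms(2)] by linarith+
  have "bc_mult f g x - bc_mult f g y = (f x - f y) * g y + f x * (g x - g y)"
    by (simp add: algebra_simps)
  then have "dist (bc_mult f g x) (bc_mult f g y) \<le> cmod (f x - f y) * cmod (g y) + cmod (f x) * cmod (g x - g y)"
    by (metis dist_norm norm_mult norm_triangle_ineq)
  also have "\<dots> \<le> (K * dist x y) * 1 + 1 * (L * dist x y)"
    using lipschitz_onD[OF f, of x y] lipschitz_onD[OF g, of x y] 1
      lipschitz_on_nonneg[OF f] lipschitz_on_nonneg[OF g]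
    by (intro add_mono mult_mono) (auto simp: dist_norm)
  finally show "dist (bc_mult f g x) (bc_mult f g y) \<le> (K + L) * dist x y"
    by (simp add: algebra_simps)
qed (use lipschitz_on_nonneg[OF f] lipschitz_on_nonneg[OF g] in simp)

text \<open>The functions \<open>q False\<close> and \<open>q True\<close> are the sine and cosine of a bump around the first half of
  the decomposition.\<close>

lemma decomposition_split:
  fixes Z :: "'x::metric_space set"
  assumes dec: "decomposes R Z \<Y>" and "r > 0" "t > 0" "Z \<noteq> {}"
  obtains q :: "bool \<Rightarrow> 'x \<Rightarrow>\<^sub>C complex" and U where
    "\<And>k. U k \<subseteq> \<Y> - {{}}" "\<And>k. pairwise (apart R) (U k)"
    "\<And>k. unit_fun (q k)" "\<And>k. (2 / t)-lipschitz_on UNIV (apply_bcontfun (q k))"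
    "\<And>x. (q False x)\<^sup>2 + (q True x)\<^sup>2 = 1"
    "\<And>k x. infdist x Z < r \<Longrightarrow> q k x \<noteq> 0 \<Longrightarrow> \<exists>Y\<in>U k. \<exists>a\<in>Y. dist x a < r + t"
proof -
  obtain U0 U1 where U: "U0 \<subseteq> \<Y>" "U1 \<subseteq> \<Y>" "pairwise (apart R) U0" "pairwise (apart R) U1" "Z = \<Union>U0 \<union> \<Union>U1"
    using dec by (auto simp: decomposes_def)
  \<comment> \<open>The empty set is discarded because \<open>infdist\<close> to it is 0, which
    would make every point near it.\<close>
  define U where "U = (\<lambda>k. (if k then U1 else U0) - {{}})"
  \<comment> \<open>The bump is 1 up to distance r from the first half and 0 from r + t on. Passing
    to sine and cosine of \<pi> / 2 times it multiplies the slope by at most 2, whence 2 /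
    t.\<close>
  define s where "s = bump (r + t) t (\<Union>U0)"
  define tr where "tr = (\<lambda>k x. if k then cos (pi / 2 * s x) else sin (pi / 2 * s x))"
  have s01: "0 \<le> s x" "s x \<le> 1" for x
    using bump_bounds[of "r + t" t "\<Union>U0" x] by (auto simp: s_def)
  have angle: "0 \<le> pi / 2 * s x" "pi / 2 * s x \<le> pi / 2" for x
    using s01[of x] mult_left_mono[of "s x" 1 "pi / 2"] by auto
  have tr01: "0 \<le> tr k x \<and> tr k x \<le> 1" for k x
  proof -
    have "0 \<le> cos (pi / 2 * s x)"
      by (rule cos_ge_zero) (use angle[of x] pi_ge_zero in linarith)+
    moreover have "0 \<le> sin (pi / 2 * s x)"
      by (rule sin_ge_zero) (use angle[of x] pi_ge_zero in linarith)+
    ultimately show ?thesis by (simp add: tr_def)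
  qed
  have "continuous_on UNIV s"
    unfolding s_def by (rule bump_continuous[OF \<open>t > 0\<close>])
  then have tr_cont: "continuous_on UNIV (tr k)" for k
    by (cases k) (auto simp: tr_def intro!: continuous_intros)
  have tr_lip: "\<bar>tr k x - tr k y\<bar> \<le> 2 / t * dist x y" for k x y
  proof -
    have "\<bar>tr k x - tr k y\<bar> \<le> \<bar>pi / 2 * s x - pi / 2 * s y\<bar>"
      using abs_cos_diff_le abs_sin_diff_le by (auto simp: tr_def)
    also have "\<dots> = pi / 2 * \<bar>s x - s y\<bar>"
      by (simp add: right_diff_distrib[symmetric] abs_mult del: times_divide_eq_left)
    also have "\<dots> \<le> 2 * (dist x y / t)"
      using bump_lipschitz[OF \<open>t > 0\<close>, of "r + t" "\<Union>U0" x y] pi_less_4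
      by (intro mult_mono) (auto simp: s_def)
    finally show ?thesis by simp
  qed
  define q where "q = (\<lambda>k. bc_of_real (tr k))"
  have q: "q k x = complex_of_real (tr k x)" for k x
    unfolding q_def by (rule bc_of_real_unit[OF tr_cont tr01])
  show thesis
  proof (rule that[of U q])
    show "U k \<subseteq> \<Y> - {{}}" "pairwise (apart R) (U k)" for k
      using U by (auto simp: U_def pairwise_def)
    show "unit_fun (q k)" for k
      unfolding q_def by (rule unit_fun_of_real[OF tr_cont tr01])
    show "(2 / t)-lipschitz_on UNIV (apply_bcontfun (q k))" for k
      unfolding q_def using \<open>t > 0\<close> by (intro lipschitz_bc_of_real tr_cont tr01 tr_lip) auto
    show "(q False x)\<^sup>2 + (q True x)\<^sup>2 = 1" for x
      by (simp add: q tr_def of_real_power[symmetric] of_real_add[symmetric] del: of_real_power of_real_add)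
    fix k x assume x: "infdist x Z < r" "q k x \<noteq> 0"
    show "\<exists>Y\<in>U k. \<exists>a\<in>Y. dist x a < r + t"
    proof (cases k)
      case True
      obtain a where a: "a \<in> Z" "dist x a < r"
        using infdist_lessE[OF x(1) \<open>Z \<noteq> {}\<close>] .
      \<comment> \<open>Within distance r of the first half the cosine vanishes. So where it does
        not, the nearby point of Z has to come from the second half.\<close>
      have "a \<notin> \<Union>U0"
      proof
        assume "a \<in> \<Union>U0"
        moreover from this have "infdist x (\<Union>U0) \<le> r"
          using a(2) by (meson infdist_le2 less_imp_le)
        ultimately have "s x = 1"
          unfolding s_def using \<open>t > 0\<close> by (intro bump_eq_1) auto
        then show False
          using x(2) True by (simp add: q tr_def)
      qed
      then obtain Y where "Y \<in> U1" "a \<in> Y"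
        using a(1) U(5) by blast
      then show ?thesis
        using a(2) True \<open>t > 0\<close> by (auto simp: U_def intro!: bexI[of _ Y] bexI[of _ a])
    next
      case False
      then have "s x \<noteq> 0"
        using x(2) by (auto simp: q tr_def)
      from bump_nonzeroE[OF \<open>t > 0\<close> this[unfolded s_def]]
      obtain a where "a \<in> \<Union>U0" "dist x a < r + t" .
      then show ?thesis
        using False by (auto simp: U_def)
    qed
  qed
qed

text \<open>Three radii: r bounds the old supports, r + t is reached after splitting, and r + 2 t
  bounds the bumps around single pieces. The summand 1 in the bound on R leaves a uniform gap
  between different neighbourhoods, which yields local finiteness and disjoint closed
  supports.\<close>

locale separated_family =
  fixes U :: "'x::heine_borel set set" and R r t :: real
  assumes apart: "pairwise (apart R) U" and nonempty: "{} \<notin> U"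
    and rt: "r > 0" "t > 0" "2 * (r + 2 * t) + 1 \<le> R"
begin

lemma near_unique:
  assumes "Y \<in> U" "Y' \<in> U" "infdist x Y < r + 2 * t" "infdist y Y' < r + 2 * t" "dist x y \<le> 1 / 2"
  shows "Y = Y'"
proof (rule ccontr)
  assume "Y \<noteq> Y'"
  then have "apart R Y Y'"
    using apart assms by (auto simp: pairwise_def)
  obtain a a' where a: "a \<in> Y" "dist x a < r + 2 * t" "a' \<in> Y'" "dist y a' < r + 2 * t"
    using assms nonempty infdist_lessE by metis
  have "R < dist a a'"
    using apartD[OF \<open>apart R Y Y'\<close>] a by blast
  then show False
    using a assms(5) rt(3) dist_triangle[of a a' x] dist_triangle[of x a' y] by (simp add: dist_commute)
qed

abbreviation "\<kappa> Y \<equiv> bc_of_real (bump (r + 2 * t) t Y)"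

lemma kappa_nonzero: "\<kappa> Y x \<noteq> 0 \<Longrightarrow> infdist x Y < r + 2 * t"
  using bump_nonzero[OF rt(2), of "r + 2 * t" Y x] by (simp add: bc_bump_apply rt)

lemma disjoint_units_kappa: "disjoint_units U \<kappa>"
  unfolding disjoint_units_def
proof (intro conjI ballI allI impI)
  fix Y Y' x assume "Y \<in> U" "Y' \<in> U" "Y \<noteq> Y'"
  then show "\<kappa> Y x = 0 \<or> \<kappa> Y' x = 0"
    using near_unique[of Y Y' x x] kappa_nonzero by fastforce
qed (rule unit_fun_bump[OF rt(2)])

text \<open>Points in a ball of radius 1/4 are less than 1/2 apart and so can be near only one
  piece. A finite cover of the compact set by such balls therefore bounds the number of
  pieces.\<close>

lemma locally_finite_kappa:
  assumes "compact A"
  shows "finite {Y \<in> U. \<exists>x\<in>A. \<kappa> Y x \<noteq> 0}"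
proof -
  let ?V = "{Y \<in> U. \<exists>x\<in>A. \<kappa> Y x \<noteq> 0}"
  obtain N where N: "finite N" "A \<subseteq> (\<Union>z\<in>N. ball z (1 / 4))"
  proof (rule compactE_image[OF assms])
    show "open (ball z (1 / 4))" for z :: 'x by simp
    show "A \<subseteq> (\<Union>z\<in>A. ball z (1 / 4))" by force
  qed
  have "\<forall>Y\<in>?V. \<exists>w. fst w \<in> N \<and> dist (fst w) (snd w) < 1 / 4 \<and> infdist (snd w) Y < r + 2 * t"
  proof
    fix Y assume Y: "Y \<in> ?V"
    obtain x where x: "x \<in> A" "\<kappa> Y x \<noteq> 0" using Y by blast
    then obtain z where "z \<in> N" "dist z x < 1 / 4" using N(2) by auto
    then show "\<exists>w. fst w \<in> N \<and> dist (fst w) (snd w) < 1 / 4 \<and> infdist (snd w) Y < r + 2 * t"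
      using kappa_nonzero[OF x(2)] by (intro exI[of _ "(z, x)"]) simp
  qed
  from bchoice[OF this] obtain w where w: "\<forall>Y\<in>?V. fst (w Y) \<in> N \<and> dist (fst (w Y)) (snd (w Y)) < 1 / 4 \<and> infdist (snd (w Y)) Y < r + 2 * t"
    by (rule exE)
  define z where "z = (\<lambda>Y. fst (w Y))"
  define x where "x = (\<lambda>Y. snd (w Y))"
  have zx: "z Y \<in> N" "dist (z Y) (x Y) < 1 / 4" "infdist (x Y) Y < r + 2 * t" if "Y \<in> ?V" for Y
    using bspec[OF w that] by (auto simp: z_def x_def)
  have "inj_on z ?V"
  proof (rule inj_onI)
    fix Y Y' assume Y: "Y \<in> ?V" "Y' \<in> ?V" "z Y = z Y'"
    have "dist (x Y) (x Y') \<le> 1 / 2"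
      using zx(2)[OF Y(1)] zx(2)[OF Y(2)] Y(3) dist_triangle3[of "x Y" "x Y'" "z Y"] by simp
    then show "Y = Y'"
      using near_unique[OF _ _ zx(3)[OF Y(1)] zx(3)[OF Y(2)]] Y(1,2) by simp
  qed
  then show ?thesis
    by (rule inj_on_finite[OF _ _ N(1)]) (intro image_subsetI zx(1))
qed

text \<open>The second part makes a bump around the union of \<open>S\<close> the 0-1 selector of
  \<open>S\<close>. Its Lipschitz bound 1 / t does not depend on \<open>S\<close>, so one commutator
  estimate covers all selections.\<close>

lemma kappa_eq_1:
  assumes "Y \<in> U" "a \<in> Y" "dist x a < r + t"
  shows "\<kappa> Y x = 1" "S \<subseteq> U \<Longrightarrow> \<kappa> (\<Union>S) x = (if Y \<in> S then 1 else 0)"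
proof -
  have le: "infdist x W \<le> r + 2 * t - t" if "a \<in> W" for W
    using infdist_le2[OF that, of x "r + t"] assms(3) by simp
  then show "\<kappa> Y x = 1"
    using assms(2) rt by (auto simp: bc_bump_apply intro!: bump_eq_1)
  assume S: "S \<subseteq> U"
  show "\<kappa> (\<Union>S) x = (if Y \<in> S then 1 else 0)"
  proof (cases "Y \<in> S")
    case True
    then have "a \<in> \<Union>S" using assms by blast
    then show ?thesis
      using le[of "\<Union>S"] True rt by (auto simp: bc_bump_apply intro!: bump_eq_1)
  next
    case False
    have "bump (r + 2 * t) t (\<Union>S) x = 0"
    proof (rule ccontr)
      assume "bump (r + 2 * t) t (\<Union>S) x \<noteq> 0"
      from bump_nonzeroE[OF rt(2) this]
      obtain a' where "a' \<in> \<Union>S" "dist x a' < r + 2 * t" .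
      then obtain Y' where Y': "Y' \<in> S" "a' \<in> Y'" by blast
      have "infdist x Y' < r + 2 * t" "infdist x Y < r + 2 * t"
        using infdist_le[OF Y'(2), of x] infdist_le[OF assms(2), of x] \<open>dist x a' < _\<close> assms(3) rt by auto
      then have "Y' = Y"
        using near_unique[of Y' Y x x] Y'(1) S assms(1) by auto
      then show False
        using False Y'(1) by simp
    qed
    then show ?thesis
      using False by (simp add: bc_bump_apply rt)
  qed
qed

text \<open>A common point of the closed supports would have points of both nonvanishing sets within
  1/4, hence 1/2 apart, against the gap.\<close>

lemma csupp_disjoint:
  assumes Y: "Y \<in> U" "Y' \<in> U" "Y \<noteq> Y'"
    and f: "\<And>x. apply_bcontfun f x \<noteq> 0 \<Longrightarrow> infdist x Y < r + 2 * t"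
    and f': "\<And>x. apply_bcontfun f' x \<noteq> 0 \<Longrightarrow> infdist x Y' < r + 2 * t"
  shows "csupp f \<inter> csupp f' = {}"
proof (rule ccontr)
  assume "csupp f \<inter> csupp f' \<noteq> {}"
  then obtain z where z: "z \<in> closure {x. f x \<noteq> 0}" "z \<in> closure {x. f' x \<noteq> 0}"
    by (auto simp: csupp_def)
  have "(1 / 4 :: real) > 0" by simp
  then obtain x y where xy: "f x \<noteq> 0" "dist x z < 1 / 4" "f' y \<noteq> 0" "dist y z < 1 / 4"
    using z unfolding closure_approachable by blast
  have "dist x y \<le> 1 / 2"
    using xy dist_triangle2[of x y z] by simp
  then have "Y = Y'"
    using near_unique[OF Y(1,2) f[OF xy(1)] f'[OF xy(3)]] by simp
  then show False using Y(3) by simp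
qed

end

text \<open>The family is a set of functions indexed by itself, matching the closure hypothesis on
  B. The constant K serves only equicontinuity: the members are never commuted past b, so K may grow
  from stage to stage.\<close>

definition near_family :: "real \<Rightarrow> real \<Rightarrow> 'x::metric_space set set \<Rightarrow> ('x \<Rightarrow>\<^sub>C complex) set \<Rightarrow> bool" where
  "near_family K r \<X> J \<longleftrightarrow>
     (\<forall>e\<in>J. unit_fun e \<and> K-lipschitz_on UNIV (apply_bcontfun e) \<and>
        (\<exists>Z\<in>\<X>. Z \<noteq> {} \<and> (\<forall>x. e x \<noteq> 0 \<longrightarrow> infdist x Z < r))) \<and>
     (\<forall>e\<in>J. \<forall>e'\<in>J. e \<noteq> e' \<longrightarrow> csupp e \<inter> csupp e' = {})"

lemma near_familyE:
  assumes "near_family K r \<X> J" "e \<in> J"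
  obtains Z where "Z \<in> \<X>" "Z \<noteq> {}" "\<And>x. apply_bcontfun e x \<noteq> 0 \<Longrightarrow> infdist x Z < r"
proof -
  have "\<exists>Z\<in>\<X>. Z \<noteq> {} \<and> (\<forall>x. e x \<noteq> 0 \<longrightarrow> infdist x Z < r)"
    using assms unfolding near_family_def by blast
  then show thesis
    using that by blast
qed

lemma near_family_disjoint_units: "near_family K r \<X> J \<Longrightarrow> disjoint_units J (\<lambda>e. e)"
  unfolding near_family_def disjoint_units_def using csupp_memI by blast

lemma near_family_block_family:
  assumes "near_family K r \<X> J"
  shows "block_family J (\<lambda>e. e)"
  unfolding block_family_def
proof (intro conjI allI impI ballI)
  fix x and \<epsilon> :: real assume "\<epsilon> > 0"
  define \<delta> where "\<delta> = \<epsilon> / (\<bar>K\<bar> + 1)"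
  have "cmod (e y - e x) < \<epsilon>" if "e \<in> J" "dist y x < \<delta>" for e y
  proof -
    have "dist (e y) (e x) \<le> K * dist y x"
      using assms that(1) by (intro lipschitz_onD[where X = UNIV]) (auto simp: near_family_def)
    also have "\<dots> \<le> (\<bar>K\<bar> + 1) * dist y x"
      by (intro mult_right_mono) auto
    also have "\<dots> < \<epsilon>"
      using that(2) by (simp add: \<delta>_def field_simps)
    finally show ?thesis by (simp add: dist_norm)
  qed
  moreover have "\<delta> > 0" using \<open>\<epsilon> > 0\<close> by (simp add: \<delta>_def)
  ultimately show "\<exists>\<delta>>0. \<forall>e\<in>J. \<forall>y. dist y x < \<delta> \<longrightarrow> cmod (e y - e x) < \<epsilon>"
    by blast
qed (use assms in \<open>auto simp: near_family_def unit_fun_def intro!: norm_unit_fun\<close>)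

context x_module
begin

text \<open>Two indices with the same function and disjoint supports carry the zero function. With 0
  removed the family is therefore injective, and its block sum is unchanged.\<close>

lemma block_cutdown_reindex:
  assumes I: "disjoint_units I p"
  shows "block_cutdown \<phi> (p ` I - {0}) (\<lambda>e. e) b = block_cutdown \<phi> I p b"
proof (rule blinfun_eqI)
  fix x
  define g where "g = (\<lambda>e. \<phi> e (b (\<phi> e x)))"
  define I' where "I' = {i \<in> I. p i \<noteq> 0}"
  have img: "disjoint_units (p ` I - {0}) (\<lambda>e. e)"
    using disjoint_unitsD[OF I] unfolding disjoint_units_def by blast
  have "inj_on p I'"
  proof (rule inj_onI, rule ccontr)
    fix i j assume ij: "i \<in> I'" "j \<in> I'" "p i = p j" "i \<noteq> j"
    then have "p i = 0"
      using disjoint_unitsD(2)[OF I, of i j] by (intro bcontfun_eqI) (auto simp: I'_def)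
    then show False using ij by (simp add: I'_def)
  qed
  have "block_cutdown \<phi> (p ` I - {0}) (\<lambda>e. e) b x = infsum g (p ` I - {0})"
    by (simp add: block_cutdown_apply[OF img] g_def)
  also have "\<dots> = infsum (g \<circ> p) I'"
  proof -
    have "p ` I - {0} = p ` I'"
      by (auto simp: I'_def)
    then show ?thesis
      by (simp only: infsum_reindex[OF \<open>inj_on p I'\<close>])
  qed
  also have "\<dots> = infsum (g \<circ> p) I"
    by (rule infsum_cong_neutral) (auto simp: I'_def g_def)
  also have "\<dots> = block_cutdown \<phi> I p b x"
    by (simp add: block_cutdown_apply[OF I] g_def comp_def)
  finally show "block_cutdown \<phi> (p ` I - {0}) (\<lambda>e. e) b x = block_cutdown \<phi> I p b x" .
qed

text \<open>Each block is split in two (error 2 \<delta>) and each half is decoupled into its pieces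
  (2 \<delta> each), which gives 6 \<delta>. All errors are form bounds in the same e, so the sum
  over blocks does not enlarge the constant. The splitting data are chosen separately for every
  block.\<close>

lemma refine_near_family:
  assumes J: "near_family K r \<X> J" and dec: "\<And>Z. Z \<in> \<X> \<Longrightarrow> decomposes R Z \<Y>"
    and rt: "r > 0" "t > 0" "2 * (r + 2 * t) + 1 \<le> R" and "\<delta> \<ge> 0"
    and comm: "\<And>h. unit_fun h \<Longrightarrow> (2 / t)-lipschitz_on UNIV (apply_bcontfun h) \<Longrightarrow> norm (commutator b (\<phi> h)) \<le> \<delta>"
  obtains K' J\<^sub>0 J\<^sub>1 where "near_family K' (r + 2 * t) \<Y> J\<^sub>0" "near_family K' (r + 2 * t) \<Y> J\<^sub>1"
    "norm (block_cutdown \<phi> J (\<lambda>e. e) b - block_cutdown \<phi> J\<^sub>0 (\<lambda>e. e) b - block_cutdown \<phi> J\<^sub>1 (\<lambda>e. e) b) \<le> 6 * \<delta>"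
proof -
  note Ju = near_family_disjoint_units[OF J]
  define split where "split = (\<lambda>(e :: 'x \<Rightarrow>\<^sub>C complex) (q :: bool \<Rightarrow> 'x \<Rightarrow>\<^sub>C complex) (U :: bool \<Rightarrow> 'x set set).
    (\<forall>k. U k \<subseteq> \<Y> - {{}} \<and> pairwise (apart R) (U k) \<and> unit_fun (q k) \<and> (2 / t)-lipschitz_on UNIV (apply_bcontfun (q k))) \<and>
    (\<forall>x. (apply_bcontfun (q False) x)\<^sup>2 + (apply_bcontfun (q True) x)\<^sup>2 = 1) \<and>
    (\<forall>k x. apply_bcontfun e x \<noteq> 0 \<longrightarrow> apply_bcontfun (q k) x \<noteq> 0 \<longrightarrow> (\<exists>Y\<in>U k. \<exists>a\<in>Y. dist x a < r + t)))"
  have "\<exists>q U. split e q U" if e: "e \<in> J" for e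
  proof -
    from near_familyE[OF J e]
    obtain Z where Z: "Z \<in> \<X>" "Z \<noteq> {}" "\<And>x. e x \<noteq> 0 \<Longrightarrow> infdist x Z < r" by blast
    show ?thesis
    proof (rule decomposition_split[OF dec[OF Z(1)] rt(1,2) Z(2)])
      fix q :: "bool \<Rightarrow> 'x \<Rightarrow>\<^sub>C complex" and U
      assume "\<And>k. U k \<subseteq> \<Y> - {{}}" "\<And>k. pairwise (apart R) (U k)"
        "\<And>k. unit_fun (q k)" "\<And>k. (2 / t)-lipschitz_on UNIV (apply_bcontfun (q k))"
        "\<And>x. (apply_bcontfun (q False) x)\<^sup>2 + (apply_bcontfun (q True) x)\<^sup>2 = 1"
        "\<And>k x. infdist x Z < r \<Longrightarrow> apply_bcontfun (q k) x \<noteq> 0 \<Longrightarrow> \<exists>Y\<in>U k. \<exists>a\<in>Y. dist x a < r + t"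
      then have "split e q U"
        unfolding split_def using Z(3) by (intro conjI allI impI) simp_all
      then show "\<exists>q U. split e q U" by blast
    qed
  qed
  then obtain q U where qU: "\<And>e. e \<in> J \<Longrightarrow> split e (q e) (U e)"
    by metis
  have U: "U e k \<subseteq> \<Y> - {{}}" "pairwise (apart R) (U e k)" "unit_fun (q e k)"
     "(2 / t)-lipschitz_on UNIV (apply_bcontfun (q e k))" if "e \<in> J" for e k
    using qU[OF that] unfolding split_def by blast+
  have q1: "(q e False x)\<^sup>2 + (q e True x)\<^sup>2 = 1" if "e \<in> J" for e x
    using qU[OF that] unfolding split_def by blast
  have near: "\<exists>Y\<in>U e k. \<exists>a\<in>Y. dist x a < r + t" if "e \<in> J" "e x * q e k x \<noteq> 0" for e k x
    using qU[OF that(1)] that(2) unfolding split_def by (metis mult_eq_0_iff)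
  have sep: "separated_family (U e k) R r t" if "e \<in> J" for e k
    using U(1,2)[OF that] rt unfolding separated_family_def by blast
  define \<kappa> where "\<kappa> = (\<lambda>Y. bc_of_real (bump (r + 2 * t) t Y) :: 'x \<Rightarrow>\<^sub>C complex)"
  define p where "p = (\<lambda>e k Y. bc_mult (bc_mult e (q e k)) (\<kappa> Y))"
  have Je: "unit_fun e" "K-lipschitz_on UNIV (apply_bcontfun e)" if "e \<in> J" for e
    using J that by (auto simp: near_family_def)
  have \<kappa>_unit: "unit_fun (\<kappa> Y)" "(1 / t)-lipschitz_on UNIV (apply_bcontfun (\<kappa> Y))" for Y
    using rt by (auto simp: \<kappa>_def unit_fun_bump lipschitz_bc_bump)
  have \<kappa>_comm: "norm (commutator b (\<phi> (\<kappa> Y))) \<le> \<delta>" for Y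
    using \<kappa>_unit[of Y] rt(2) by (intro comm lipschitz_on_mono[OF \<kappa>_unit(2)] divide_right_mono) auto
  have dec_units: "disjoint_units (U e k) (p e k)"
    and dec_form: "inner (\<phi> (bc_mult e (q e k)) (b (\<phi> (bc_mult e (q e k)) x)) - (\<Sum>\<^sub>\<infinity>Y\<in>U e k. \<phi> (p e k Y) (b (\<phi> (p e k Y) x)))) y \<le>
      2 * \<delta> * norm (\<phi> e x) * norm (\<phi> e y)" if e: "e \<in> J" for e k x y
  proof -
    interpret sep: separated_family "U e k" R r t by (rule sep[OF e])
    have pe: "p e k = (\<lambda>Y. bc_mult (bc_mult e (q e k)) (\<kappa> Y))"
      by (simp add: p_def)
    have s: "\<exists>Y\<in>U e k. \<kappa> Y x = 1 \<and> (\<forall>S\<subseteq>U e k. \<kappa> (\<Union>S) x = (if Y \<in> S then 1 else 0))"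
      if "e x * q e k x \<noteq> 0" for x
      using near[OF e that] sep.kappa_eq_1 unfolding \<kappa>_def by blast
    have 1: "disjoint_units (U e k) \<kappa>"
      unfolding \<kappa>_def by (rule sep.disjoint_units_kappa)
    have 2: "finite {Y \<in> U e k. \<exists>x\<in>A. \<kappa> Y x \<noteq> 0}" if "compact A" for A
      unfolding \<kappa>_def by (rule sep.locally_finite_kappa[OF that])
    note * = decouple_blocks[where h = "\<lambda>S. \<kappa> (\<Union>S)", OF Je(1)[OF e] U(3)[OF e] 1 s \<kappa>_unit(1) \<kappa>_comm 2 pe]
    show "disjoint_units (U e k) (p e k)"
      using * by blast
    show "inner (\<phi> (bc_mult e (q e k)) (b (\<phi> (bc_mult e (q e k)) x)) - (\<Sum>\<^sub>\<infinity>Y\<in>U e k. \<phi> (p e k Y) (b (\<phi> (p e k Y) x)))) y \<le>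
      2 * \<delta> * norm (\<phi> e x) * norm (\<phi> e y)"
      using * by blast
  qed
  \<comment> \<open>Pairs are needed since one set Y may occur as a piece for several blocks
    e.\<close>
  define I where "I = (\<lambda>k. Sigma J (\<lambda>e. U e k))"
  define P where "P = (\<lambda>k (e, Y). p e k Y)"
  \<comment> \<open>Pieces of one block are kept apart by the separation of \<open>U e k\<close>,
    pieces of different blocks by the supports of the blocks.\<close>
  have disj: "csupp (P k i) \<inter> csupp (P k j) = {}" if "i \<in> I k" "j \<in> I k" "i \<noteq> j" for k i j
  proof -
    obtain e Y e' Y' where ij: "i = (e, Y)" "j = (e', Y')" "e \<in> J" "e' \<in> J" "Y \<in> U e k" "Y' \<in> U e' k"
      using \<open>i \<in> I k\<close> \<open>j \<in> I k\<close> by (auto simp: I_def)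
    show ?thesis
    proof (cases "e = e'")
      case True
      interpret sep: separated_family "U e k" R r t by (rule sep[OF ij(3)])
      have "infdist x W < r + 2 * t" if "p e k W x \<noteq> 0" for W x
        using that sep.kappa_nonzero by (auto simp: p_def \<kappa>_def)
      then show ?thesis
        using sep.csupp_disjoint[of Y Y'] ij that(3) True by (auto simp: P_def)
    next
      case False
      have "csupp (P k i) \<subseteq> csupp e" "csupp (P k j) \<subseteq> csupp e'"
        unfolding ij P_def p_def prod.case by (rule csupp_mono, simp)+
      then show ?thesis
        using J ij(3,4) False unfolding near_family_def by blast
    qed
  qed
  have P_unit: "unit_fun (P k i)" if "i \<in> I k" for k i
    using that Je U(3) \<kappa>_unit by (auto simp: I_def P_def p_def intro!: unit_fun_mult)
  have P_units: "disjoint_units (I k) (P k)" for k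
    unfolding disjoint_units_def using P_unit disj csupp_memI by blast
  define J' where "J' = (\<lambda>k. P k ` I k - {0})"
  have near_J': "near_family (K + 2 / t + 1 / t) (r + 2 * t) \<Y> (J' k)" for k
    unfolding near_family_def
  proof (intro conjI ballI impI)
    fix f assume "f \<in> J' k"
    then obtain e Y where f: "f = p e k Y" "e \<in> J" "Y \<in> U e k"
      by (auto simp: J'_def I_def P_def)
    interpret sep: separated_family "U e k" R r t by (rule sep[OF f(2)])
    show "unit_fun f"
      using P_unit[of "(e, Y)" k] f by (simp add: P_def I_def)
    show "(K + 2 / t + 1 / t)-lipschitz_on UNIV (apply_bcontfun f)"
      unfolding f(1) p_def by (intro lipschitz_bc_mult unit_fun_mult Je U \<kappa>_unit f(2))
    have "infdist x Y < r + 2 * t" if "f x \<noteq> 0" for x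
      using that sep.kappa_nonzero by (auto simp: f(1) p_def \<kappa>_def)
    then show "\<exists>Z\<in>\<Y>. Z \<noteq> {} \<and> (\<forall>x. f x \<noteq> 0 \<longrightarrow> infdist x Z < r + 2 * t)"
      using U(1)[OF f(2)] f(3) by blast
    fix f' assume "f' \<in> J' k" "f \<noteq> f'"
    then show "csupp f \<inter> csupp f' = {}"
      using \<open>f \<in> J' k\<close> disj unfolding J'_def by blast
  qed
  have "norm (block_cutdown \<phi> J (\<lambda>e. e) b - block_cutdown \<phi> (J' False) (\<lambda>e. e) b - block_cutdown \<phi> (J' True) (\<lambda>e. e) b) \<le> 6 * \<delta>"
  proof (rule norm_blinfun_bound)
    fix x
    define S where "S = (\<lambda>k e. \<Sum>\<^sub>\<infinity>Y\<in>U e k. \<phi> (p e k Y) (b (\<phi> (p e k Y) x)))"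
    define v where "v = (\<lambda>e. \<phi> e (b (\<phi> e x)))"
    define A where "A = (\<lambda>k e. \<phi> (bc_mult e (q e k)) (b (\<phi> (bc_mult e (q e k)) x)))"
    have sumI: "(\<lambda>(e, Y). \<phi> (p e k Y) (b (\<phi> (p e k Y) x))) summable_on Sigma J (\<lambda>e. U e k)" for k
      using block_summable(1)[OF P_units[of k], of b x] by (simp add: P_def I_def case_prod_unfold)
    have cut: "block_cutdown \<phi> (J' k) (\<lambda>e. e) b x = infsum (S k) J" for k
    proof -
      have "block_cutdown \<phi> (J' k) (\<lambda>e. e) b x = block_cutdown \<phi> (I k) (P k) b x"
        by (simp add: J'_def block_cutdown_reindex[OF P_units])
      also have "\<dots> = infsum (\<lambda>(e, Y). \<phi> (p e k Y) (b (\<phi> (p e k Y) x))) (Sigma J (\<lambda>e. U e k))"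
        unfolding block_cutdown_apply[OF P_units] by (simp add: P_def I_def case_prod_unfold)
      also have "\<dots> = infsum (S k) J"
        unfolding S_def by (rule infsum_Sigma'_banach[OF sumI, symmetric])
      finally show ?thesis .
    qed
    have S_sum: "S k summable_on J" for k
      unfolding S_def by (rule summable_on_Sigma_banach[OF sumI])
    have v_sum: "v summable_on J"
      unfolding v_def by (rule block_summable(1)[OF Ju])
    have "(block_cutdown \<phi> J (\<lambda>e. e) b - block_cutdown \<phi> (J' False) (\<lambda>e. e) b - block_cutdown \<phi> (J' True) (\<lambda>e. e) b) x =
        infsum v J - infsum (S False) J - infsum (S True) J"
      by (simp add: blinfun.diff_left cut block_cutdown_apply[OF Ju] v_def)
    also have "\<dots> = infsum (\<lambda>e. v e - S False e - S True e) J"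
      by (rule infsumI[symmetric]) (intro has_sum_diff has_sum_infsum v_sum S_sum)
    also have "norm \<dots> \<le> 6 * \<delta> * norm x"
    proof (rule block_sum(2)[OF Ju])
      show "0 \<le> 6 * \<delta>" using \<open>\<delta> \<ge> 0\<close> by simp
      fix e y assume e: "e \<in> J"
      have 1: "inner (v e - A False e - A True e) y \<le> 2 * \<delta> * norm (\<phi> e x) * norm (\<phi> e y)"
        unfolding v_def A_def by (intro split_block_form Je U q1 comm e)
      have 2: "inner (A k e - S k e) y \<le> 2 * \<delta> * norm (\<phi> e x) * norm (\<phi> e y)" for k
        unfolding A_def S_def by (rule dec_form[OF e])
      have "inner (v e - S False e - S True e) y =
          inner (v e - A False e - A True e) y + inner (A False e - S False e) y + inner (A True e - S True e) y"
        by (simp add: inner_diff_left)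
      also have "\<dots> \<le> 3 * (2 * \<delta> * norm (\<phi> e x) * norm (\<phi> e y))"
        using 1 2[of False] 2[of True] by linarith
      also have "\<dots> = 6 * \<delta> * norm (\<phi> e x) * norm (\<phi> e y)"
        by simp
      finally show "inner (v e - S False e - S True e) y \<le> 6 * \<delta> * norm (\<phi> e x) * norm (\<phi> e y)" .
    qed
    finally show "norm ((block_cutdown \<phi> J (\<lambda>e. e) b - block_cutdown \<phi> (J' False) (\<lambda>e. e) b - block_cutdown \<phi> (J' True) (\<lambda>e. e) b) x) \<le> 6 * \<delta> * norm x" .
  qed (use \<open>\<delta> \<ge> 0\<close> in simp)
  then show thesis
    using that[OF near_J' near_J'] by blast
qed

section \<open>Finite propagation and the Roe algebra\<close>

lemma propagation_le_mono: "propagation_le \<phi> R a \<Longrightarrow> R \<le> R' \<Longrightarrow> propagation_le \<phi> R' a"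
  unfolding propagation_le_def using apart_mono by blast

lemma propagation_le_add:
  "propagation_le \<phi> R a \<Longrightarrow> propagation_le \<phi> R a' \<Longrightarrow> propagation_le \<phi> R (a + a')"
  unfolding propagation_le_def
  by (simp add: bounded_bilinear.add_left[OF bounded_bilinear_blinfun_compose]
      bounded_bilinear.add_right[OF bounded_bilinear_blinfun_compose])

text \<open>A block e b e sees only points within r of one set of diameter at most D, hence at most
  D + 2 r apart. The absolute value keeps the radius nonnegative when the metric family is
  empty.\<close>

lemma bounded_blocks_propagation:
  assumes J: "near_family K r \<X> J" and bd: "uniformly_bounded \<X>" and "r > 0"
  obtains R where "R \<ge> 0" "propagation_le \<phi> R (block_cutdown \<phi> J (\<lambda>e. e) b)"
proof -
  note Ju = near_family_disjoint_units[OF J]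
  obtain D where D: "\<And>Z. Z \<in> \<X> \<Longrightarrow> bounded Z \<and> diameter Z \<le> D"
    using bd by (auto simp: uniformly_bounded_def)
  define R where "R = \<bar>D\<bar> + 2 * r"
  have "propagation_le \<phi> R (block_cutdown \<phi> J (\<lambda>e. e) b)"
    unfolding propagation_le_def
  proof (intro allI impI)
    fix f f' :: "'x \<Rightarrow>\<^sub>C complex"
    assume ap: "apart R (csupp f) (csupp f')"
    have zero: "\<phi> f (\<phi> e (b (\<phi> e (\<phi> f' x)))) = 0" if e: "e \<in> J" for e x
    proof -
      from near_familyE[OF J e]
      obtain Z where Z: "Z \<in> \<X>" "Z \<noteq> {}" "\<And>x. e x \<noteq> 0 \<Longrightarrow> infdist x Z < r" by blast
      have "(\<forall>y. f y = 0 \<or> e y = 0) \<or> (\<forall>y. e y = 0 \<or> f' y = 0)"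
      proof (rule ccontr)
        assume "\<not> ?thesis"
        then obtain y y' where y: "f y \<noteq> 0" "e y \<noteq> 0" "f' y' \<noteq> 0" "e y' \<noteq> 0" by auto
        obtain a a' where a: "a \<in> Z" "dist y a < r" "a' \<in> Z" "dist y' a' < r"
          using infdist_lessE[OF Z(3)[OF y(2)] Z(2)] infdist_lessE[OF Z(3)[OF y(4)] Z(2)] by metis
        have "dist a a' \<le> D"
          using D[OF Z(1)] diameter_bounded_bound[of Z a a'] a by simp
        moreover have "R < dist y y'"
          using apartD[OF ap csupp_memI[OF y(1)] csupp_memI[OF y(3)]] .
        ultimately show False
          using a dist_triangle[of y y' a] dist_triangle[of a y' a'] by (simp add: R_def dist_commute)
      qed
      then show ?thesis
      proof
        assume "\<forall>y. f y = 0 \<or> e y = 0"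
        then show ?thesis by (intro phi_disjoint_apply) blast
      next
        assume "\<forall>y. e y = 0 \<or> f' y = 0"
        then have "\<phi> e (\<phi> f' x) = 0" by (intro phi_disjoint_apply) blast
        then show ?thesis by simp
      qed
    qed
    show "\<phi> f o\<^sub>L block_cutdown \<phi> J (\<lambda>e. e) b o\<^sub>L \<phi> f' = 0"
    proof (rule blinfun_eqI)
      fix x
      have "((\<lambda>e. \<phi> e (b (\<phi> e (\<phi> f' x)))) has_sum block_cutdown \<phi> J (\<lambda>e. e) b (\<phi> f' x)) J"
        unfolding block_cutdown_apply[OF Ju] by (rule has_sum_infsum[OF block_summable(1)[OF Ju]])
      then have "((\<lambda>e. \<phi> f (\<phi> e (b (\<phi> e (\<phi> f' x))))) has_sum \<phi> f (block_cutdown \<phi> J (\<lambda>e. e) b (\<phi> f' x))) J"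
        by (rule has_sum_bounded_linear[OF blinfun.bounded_linear_right])
      moreover have "((\<lambda>e. \<phi> f (\<phi> e (b (\<phi> e (\<phi> f' x))))) has_sum 0) J"
        by (rule has_sum_0) (rule zero)
      ultimately show "(\<phi> f o\<^sub>L block_cutdown \<phi> J (\<lambda>e. e) b o\<^sub>L \<phi> f') x = blinfun_apply 0 x"
        by (simp add: has_sum_unique)
    qed
  qed
  then show thesis
    using that[of R] \<open>r > 0\<close> by (simp add: R_def)
qed

lemma quasi_local_if_roe:
  assumes "b \<in> roe \<phi> B"
  shows "quasi_local \<phi> b"
  unfolding quasi_local_def
proof (intro allI impI)
  fix \<epsilon> :: real assume "\<epsilon> > 0"
  then obtain c where c: "c \<in> {b \<in> B. \<exists>R\<ge>0. propagation_le \<phi> R b}" "dist c b < \<epsilon>"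
    using assms unfolding roe_def closure_approachable by blast
  then obtain R where R: "R \<ge> 0" "propagation_le \<phi> R c" by blast
  have "norm (\<phi> f o\<^sub>L b o\<^sub>L \<phi> f') < \<epsilon>"
    if "norm f \<le> 1" "norm f' \<le> 1" "apart R (csupp f) (csupp f')" for f f'
  proof -
    have "\<phi> f o\<^sub>L c o\<^sub>L \<phi> f' = 0"
      using R(2) that(3) by (simp add: propagation_le_def)
    then have "\<phi> f o\<^sub>L b o\<^sub>L \<phi> f' = \<phi> f o\<^sub>L (b - c) o\<^sub>L \<phi> f'"
      by (simp add: bounded_bilinear.diff_left[OF bounded_bilinear_blinfun_compose]
          bounded_bilinear.diff_right[OF bounded_bilinear_blinfun_compose])
    then show ?thesis
      using norm_phi_cutdown_le[OF that(1,2), of "b - c"] c(2) by (simp add: dist_norm norm_minus_commute)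
  qed
  then have "eps_propagation_le \<phi> \<epsilon> R b"
    by (simp add: eps_propagation_le_def)
  then show "\<exists>R\<ge>0. eps_propagation_le \<phi> \<epsilon> R b"
    using R(1) by blast
qed

lemma roe_if_quasi_local:
  assumes B: "cstar_subalgebra B" "closed_under_block_cutdowns \<phi> B" "b \<in> B"
    and ql: "quasi_local \<phi> b" and fdc: "straight_fdc TYPE('x)"
  shows "b \<in> roe \<phi> B"
  unfolding roe_def closure_approachable
proof (intro allI impI)
  fix \<epsilon>' :: real assume "\<epsilon>' > 0"
  define \<epsilon> where "\<epsilon> = \<epsilon>' / 2"
  have "\<epsilon> > 0" using \<open>\<epsilon>' > 0\<close> by (simp add: \<epsilon>_def)
  have b: "b \<in> bounded_ops"
    using B by (auto simp: cstar_subalgebra_def)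
  \<comment> \<open>Chosen so that 6 \<delta> (i + 1) is one third of \<epsilon> / 3^i; the two
    refined cutdowns at stage i + 1 use up the other two thirds.\<close>
  define \<delta> where "\<delta> = (\<lambda>i::nat. \<epsilon> / (6 * 3 ^ i))"
  have \<delta>: "\<delta> i > 0" for i using \<open>\<epsilon> > 0\<close> by (simp add: \<delta>_def)
  have "\<exists>t>0. \<forall>h. unit_fun h \<longrightarrow> (2 / t)-lipschitz_on UNIV (apply_bcontfun h) \<longrightarrow> norm (commutator b (\<phi> h)) \<le> \<delta> i" for i
  proof -
    obtain R \<eta> where R: "R > 0" "\<eta> > 0" and
      small: "\<And>f. norm f \<le> 1 \<Longrightarrow> (\<And>x y. dist x y \<le> R \<Longrightarrow> cmod (apply_bcontfun f x - apply_bcontfun f y) < \<eta>) \<Longrightarrow>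
        norm (commutator b (\<phi> f)) \<le> \<delta> i"
      using quasi_local_commutator[OF ql b \<delta> zero_less_one] by metis
    \<comment> \<open>Then 2 / t is \<eta> / (2 R), so such a function varies by at most \<eta> / 2
      over distance R.\<close>
    define t where "t = 4 * R / \<eta>"
    have "t > 0" using R by (simp add: t_def)
    have "norm (commutator b (\<phi> h)) \<le> \<delta> i" if h: "unit_fun h" "(2 / t)-lipschitz_on UNIV (apply_bcontfun h)" for h
    proof (rule small[OF norm_unit_fun[OF h(1)]])
      fix x y :: 'x assume "dist x y \<le> R"
      then have "2 / t * dist x y \<le> 2 / t * R"
        using \<open>t > 0\<close> by (intro mult_left_mono) auto
      also have "\<dots> < \<eta>"
        using R by (simp add: t_def)
      finally show "cmod (h x - h y) < \<eta>"
        using lipschitz_onD[OF h(2), of x y] by (simp add: dist_norm)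
    qed
    then show ?thesis using \<open>t > 0\<close> by blast
  qed
  then obtain t where t: "\<And>i. t i > 0"
    "\<And>i h. unit_fun h \<Longrightarrow> (2 / t i)-lipschitz_on UNIV (apply_bcontfun h) \<Longrightarrow> norm (commutator b (\<phi> h)) \<le> \<delta> i"
    by metis
  \<comment> \<open>Radius of the supports around the sets of stage i; every refinement adds 2 t.
    The start is positive because nearness is a strict inequality.\<close>
  define r where "r = rec_nat 1 (\<lambda>i s. s + 2 * t (Suc i))"
  have r0: "r 0 = 1" and rS: "r (Suc i) = r i + 2 * t (Suc i)" for i
    by (simp_all add: r_def)
  have r_pos: "r i > 0" for i
    by (induction i) (auto simp: r0 rS intro!: add_pos_pos t)
  \<comment> \<open>Since r already includes the increment of its own stage, this is exactly the
    separation 2 (r + 2 t) + 1 required for refinement.\<close>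
  define R where "R = (\<lambda>i. 2 * r i + 1)"
  have "0 \<le> R 1 \<and> (\<forall>i\<ge>1. R i < R (Suc i))"
    using r_pos[of 1] t(1) by (auto simp: R_def rS)
  then obtain m and \<X> :: "nat \<Rightarrow> 'x set set" where X: "\<X> 0 = {UNIV}"
    "\<And>i Z. i \<in> {1..m} \<Longrightarrow> Z \<in> \<X> (i - 1) \<Longrightarrow> decomposes (R i) Z (\<X> i)" "uniformly_bounded (\<X> m)"
    using fdc unfolding straight_fdc_def by metis
  \<comment> \<open>Proved downwards from m: at the last stage the sets are uniformly bounded, so
    the cutdown has finite propagation and lies in B by the closure hypothesis. Quantifying over all
    families and all K is what allows the statement to be used for both families of a
    refinement.\<close>
  define approx where "approx = (\<lambda>i. \<forall>J K. near_family K (r i) (\<X> i) J \<longrightarrow>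
    (\<exists>c\<in>B. (\<exists>R\<ge>0. propagation_le \<phi> R c) \<and> norm (block_cutdown \<phi> J (\<lambda>e. e) b - c) \<le> \<epsilon> / 3 ^ i))"
  have "approx 0"
  proof (rule inc_induct[of 0 m])
    show "approx m"
      unfolding approx_def
    proof (intro allI impI)
      fix J K assume J: "near_family K (r m) (\<X> m) J"
      have "block_cutdown \<phi> J (\<lambda>e. e) b \<in> B"
        using B near_family_block_family[OF J] unfolding closed_under_block_cutdowns_def by blast
      moreover obtain R where "R \<ge> 0" "propagation_le \<phi> R (block_cutdown \<phi> J (\<lambda>e. e) b)"
        by (rule bounded_blocks_propagation[OF J X(3) r_pos])
      ultimately show "\<exists>c\<in>B. (\<exists>R\<ge>0. propagation_le \<phi> R c) \<and> norm (block_cutdown \<phi> J (\<lambda>e. e) b - c) \<le> \<epsilon> / 3 ^ m"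
        using \<open>\<epsilon> > 0\<close> by (intro bexI[of _ "block_cutdown \<phi> J (\<lambda>e. e) b"]) auto
    qed
    fix i assume "i < m" and IH: "approx (Suc i)"
    show "approx i"
      unfolding approx_def
    proof (intro allI impI)
      fix J K assume J: "near_family K (r i) (\<X> i) J"
      have dec: "decomposes (R (Suc i)) Z (\<X> (Suc i))" if "Z \<in> \<X> i" for Z
        using X(2)[of "Suc i" Z] that \<open>i < m\<close> by simp
      have sep: "2 * (r i + 2 * t (Suc i)) + 1 \<le> R (Suc i)"
        by (simp add: R_def rS)
      obtain K' J\<^sub>0 J\<^sub>1 where J': "near_family K' (r (Suc i)) (\<X> (Suc i)) J\<^sub>0" "near_family K' (r (Suc i)) (\<X> (Suc i)) J\<^sub>1"
        and le: "norm (block_cutdown \<phi> J (\<lambda>e. e) b - block_cutdown \<phi> J\<^sub>0 (\<lambda>e. e) b - block_cutdown \<phi> J\<^sub>1 (\<lambda>e. e) b) \<le> 6 * \<delta> (Suc i)"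
        using refine_near_family[OF J dec r_pos t(1) sep less_imp_le[OF \<delta>] t(2), folded rS] by blast
      obtain c\<^sub>0 R\<^sub>0 where c0: "c\<^sub>0 \<in> B" "R\<^sub>0 \<ge> 0" "propagation_le \<phi> R\<^sub>0 c\<^sub>0" "norm (block_cutdown \<phi> J\<^sub>0 (\<lambda>e. e) b - c\<^sub>0) \<le> \<epsilon> / 3 ^ Suc i"
        using IH J'(1) unfolding approx_def by blast
      obtain c\<^sub>1 R\<^sub>1 where c1: "c\<^sub>1 \<in> B" "R\<^sub>1 \<ge> 0" "propagation_le \<phi> R\<^sub>1 c\<^sub>1" "norm (block_cutdown \<phi> J\<^sub>1 (\<lambda>e. e) b - c\<^sub>1) \<le> \<epsilon> / 3 ^ Suc i"
        using IH J'(2) unfolding approx_def by blast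
      have "c\<^sub>0 + c\<^sub>1 \<in> B"
        using B(1) c0(1) c1(1) by (auto simp: cstar_subalgebra_def)
      moreover have "propagation_le \<phi> (max R\<^sub>0 R\<^sub>1) (c\<^sub>0 + c\<^sub>1)"
        by (intro propagation_le_add propagation_le_mono[OF c0(3)] propagation_le_mono[OF c1(3)]) auto
      moreover have "norm (block_cutdown \<phi> J (\<lambda>e. e) b - (c\<^sub>0 + c\<^sub>1)) \<le> \<epsilon> / 3 ^ i"
      proof -
        let ?\<theta> = "\<lambda>J. block_cutdown \<phi> J (\<lambda>e. e) b"
        have eq: "?\<theta> J - (c\<^sub>0 + c\<^sub>1) = (?\<theta> J - ?\<theta> J\<^sub>0 - ?\<theta> J\<^sub>1) + ((?\<theta> J\<^sub>0 - c\<^sub>0) + (?\<theta> J\<^sub>1 - c\<^sub>1))"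
          by simp
        have "norm (?\<theta> J - (c\<^sub>0 + c\<^sub>1)) \<le> 6 * \<delta> (Suc i) + (\<epsilon> / 3 ^ Suc i + \<epsilon> / 3 ^ Suc i)"
          unfolding eq by (rule norm_triangle_mono[OF le norm_triangle_mono[OF c0(4) c1(4)]])
        also have "\<dots> = \<epsilon> / 3 ^ i"
          by (simp add: \<delta>_def field_simps)
        finally show ?thesis .
      qed
      ultimately show "\<exists>c\<in>B. (\<exists>R\<ge>0. propagation_le \<phi> R c) \<and> norm (block_cutdown \<phi> J (\<lambda>e. e) b - c) \<le> \<epsilon> / 3 ^ i"
        using c0(2) by (intro bexI[of _ "c\<^sub>0 + c\<^sub>1"] conjI exI[of _ "max R\<^sub>0 R\<^sub>1"]) auto
    qed
  qed simp
  \<comment> \<open>The constant function 1 is a family near the whole space, and its cutdown of b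
    is b itself.\<close>
  define one :: "'x \<Rightarrow>\<^sub>C complex" where "one = const_bcontfun 1"
  have near1: "near_family 0 (r 0) (\<X> 0) {one}"
    by (auto simp: near_family_def X(1) r0 one_def unit_fun_def lipschitz_on_def)
  have "block_cutdown \<phi> {one} (\<lambda>e. e) b = b"
  proof (rule blinfun_eqI)
    show "block_cutdown \<phi> {one} (\<lambda>e. e) b x = b x" for x
      unfolding block_cutdown_apply[OF near_family_disjoint_units[OF near1]] by (simp add: one_def phi_one)
  qed
  then obtain c where "c \<in> B" "\<exists>R\<ge>0. propagation_le \<phi> R c" "norm (b - c) \<le> \<epsilon>"
    using \<open>approx 0\<close> near1 unfolding approx_def by fastforce
  then show "\<exists>c\<in>{b \<in> B. \<exists>R\<ge>0. propagation_le \<phi> R b}. dist c b < \<epsilon>'"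
    using \<open>\<epsilon>' > 0\<close> by (intro bexI[of _ c]) (auto simp: dist_norm norm_minus_commute \<epsilon>_def)
qed

end

theorem theorem2p8:
  fixes \<phi> :: "('x::heine_borel \<Rightarrow>\<^sub>C complex) \<Rightarrow> ('h::complex_hilbert_space \<Rightarrow>\<^sub>L 'h)"
    and B :: "('h \<Rightarrow>\<^sub>L 'h) set"
    and b :: "'h \<Rightarrow>\<^sub>L 'h"
  assumes "X_module \<phi>"
    and "cstar_subalgebra B"
    and "{\<phi> f o\<^sub>L a o\<^sub>L \<phi> g | f a g. a \<in> B} = B"
    and "closed_under_block_cutdowns \<phi> B"
    and "\<forall>f\<in>c0_functions. \<forall>a\<in>B. commutator (\<phi> f) a \<in> compact_ideal \<phi> B"
    and "b \<in> B"
  shows "((\<forall>f\<in>vl_infty \<phi>. const_infty b * f - f * const_infty b = 0) \<longleftrightarrow> quasi_local \<phi> b) \<and>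
         (quasi_local \<phi> b \<longleftrightarrow>
            (\<forall>g\<in>higson_functions. commutator b (\<phi> g) \<in> compact_ideal \<phi> B)) \<and>
         (straight_fdc TYPE('x) \<longrightarrow> (quasi_local \<phi> b \<longleftrightarrow> b \<in> roe \<phi> B))"
proof -
  interpret x_module \<phi>
    using assms(1) by unfold_locales
  have b: "b \<in> bounded_ops"
    using assms(2,6) by (auto simp: cstar_subalgebra_def)
  have K: "commutator (\<phi> f) b \<in> compact_ideal \<phi> B" if "f \<in> c0_functions" for f
    using assms(5,6) that by blast
  have "(\<forall>f\<in>vl_infty \<phi>. const_infty b * f - f * const_infty b = 0) \<longleftrightarrow> quasi_local \<phi> b"
    using vl_infty_commutant_iff[OF b] quasi_local_iff_very_lipschitz[OF b] by simp
  moreover have "quasi_local \<phi> b \<longleftrightarrow> (\<forall>g\<in>higson_functions. commutator b (\<phi> g) \<in> compact_ideal \<phi> B)"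
    using higson_commutator_compact[OF _ b K] quasi_local_if_higson[OF K] by blast
  moreover have "straight_fdc TYPE('x) \<longrightarrow> (quasi_local \<phi> b \<longleftrightarrow> b \<in> roe \<phi> B)"
    using roe_if_quasi_local[OF assms(2,4,6)] quasi_local_if_roe by blast
  ultimately show ?thesis
    by blast
qed

end
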